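(* Let $(X_n)_{n\ge 0}$ be a real-valued Markov chain whose transition kernel has a density $\pi$, and which satisfies Assumptions A1, A2, A3', A4, A5 (listed in the context). Let $g$ be the density of $(X_i,X_{i+1})$ restricted to $[0,1]^2$. Let $(S_m)_{m\in\mathcal{M}_n}$ be a collection of models satisfying Assumptions M1', M2, M3 (listed in the context) with constant $r_0$. Then there is a constant $K_0^{(2)}$, depending on the chain and on $r_0$ but not on $n$, such that for every $K^{(2)}>K_0^{(2)}$ the following holds. Set $\mathrm{pen}^{(2)}(m)=K^{(2)}\frac{D_m^2}{n}$ and $$\tilde g=\hat g_{\hat m^{(2)}},\qquad \hat m^{(2)}=\underset{m\in\mathcal{M}_n}{\arg\min}\,\big[\gamma_n^{(2)}(\hat g_m)+\mathrm{pen}^{(2)}(m)\big].$$ Then there is a constant $C_1$, not depending on $n$, such that $$\mathbb{E}\|\tilde g-g\|^2\le 3\inf_{m\in\mathcal{M}_n}\{d^2(g,S_m^{(2)})+\mathrm{pen}^{(2)}(m)\}+\frac{C_1}{n}.$$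
   Context: Chain assumptions. $(X_n)_{n\ge 0}$ is a Markov chain on $\mathbb{R}$ with transition kernel $P$ having a density $\pi$, i.e. $P(x,dy)=\pi(x,y)\,dy$, and: A1. $(X_n)$ is irreducible and positive recurrent, with stationary probability measure $\mu$. The measure $\mu$ has a density with respect to Lebesgue measure, and $f$ denotes this density multiplied by $\mathbf 1_{[0,1]}$. A2. $X_0$ has distribution $\mu$ (so the chain is strictly stationary). A3'. $\pi$ (restricted to $[0,1]^2$) belongs to $L^\infty([0,1]^2)$. A4. There are a function $h:[0,1]\to[0,1]$ (extended by $0$ outside $[0,1]$) with $\int h\,d\mu>0$ and a probability measure $\nu$ such that $P(x,A)\ge h(x)\nu(A)$ for all events $A$ and all $x$. A5. There are a finite function $V>0$ and a constant $\rho\in(0,1)$ such that $\|P^n(x,\cdot)-\mu\|_{TV}\le V(x)\rho^n$ for all $n\ge 1$ and all $x$, where $\|\cdot\|_{TV}$ is the total variation norm. The function $g$ is the density of $(X_i,X_{i+1})$ restricted to $[0,1]^2$, so $g(x,y)=f(x)\pi(x,y)$ there. Models. $S_m$ is a finite-dimensional subspace of $(L^\infty\cap L^2)([0,1])$ with dimension $D_m$ and orthonormal basis $(\varphi_\lambda)_{\lambda\in\Lambda_m}$. The associated bivariate space is $S_m^{(2)}=\{t\in L^2([0,1]^2): t(x,y)=\sum_{\lambda,\mu\in\Lambda_m}\alpha_{\lambda,\mu}\varphi_\lambda(x)\varphi_\mu(y)\}$, of dimension $D_m^2$. The index set is $\mathcal M_n=\{m:D_m^2\le\sqrt n\}$.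 M1'. Each $S_m^{(2)}$, $m\in\mathcal M_n$, is a linear subspace of $(L^\infty\cap L^2)([0,1]^2)$ with dimension $D_m^2\le\sqrt n$. M2. There is a real $r_0$ such that for all $m$, $\frac{1}{\sqrt{D_m}}\sup_{t\in S_m\setminus\{0\}}\frac{\|t\|_\infty}{\|t\|}\le r_0$. M3. The models are nested: $D_m\le D_{m'}\Rightarrow S_m\subset S_{m'}$. Estimators. The data are $X_1,\dots,X_n$. $\|\cdot\|$ is the $L^2$ norm (on $[0,1]$ or $[0,1]^2$) and $d(g,S)=\inf_{t\in S}\|g-t\|$. The contrast is $\gamma_n^{(2)}(t)=\frac1{n-1}\sum_{i=1}^{n-1}\{\|t\|^2-2t(X_i,X_{i+1})\}$, and $\hat g_m=\arg\min_{t\in S_m^{(2)}}\gamma_n^{(2)}(t)$. *)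

theory Defs
  imports "HOL-Probability.Probability"
begin

section \<open>Markov chains on the real line\<close>

text \<open>The iterates \<open>P^n(x, A)\<close> of a transition kernel.\<close>

primrec kernel_pow :: "(real \<Rightarrow> real measure) \<Rightarrow> nat \<Rightarrow> real \<Rightarrow> real measure" where
  "kernel_pow P 0 x = return borel x"
| "kernel_pow P (Suc n) x = P x \<bind> kernel_pow P n"

definition past :: "'w measure \<Rightarrow> (nat \<Rightarrow> 'w \<Rightarrow> real) \<Rightarrow> nat \<Rightarrow> 'w measure" where
  "past M X n =
     vimage_algebra (space M) (\<lambda>\<omega>. \<lambda>i\<in>{..n}. X i \<omega>) (PiM {..n} (\<lambda>_. borel))"

definition markov_chain ::
  "'w measure \<Rightarrow> (nat \<Rightarrow> 'w \<Rightarrow> real) \<Rightarrow> (real \<Rightarrow> real measure) \<Rightarrow> bool" where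
  "markov_chain M X P \<longleftrightarrow>
     prob_space M \<and>
     (\<forall>n. X n \<in> borel_measurable M) \<and>
     P \<in> borel \<rightarrow>\<^sub>M prob_algebra borel \<and>
     (\<forall>n. \<forall>A\<in>sets borel. AE \<omega> in M.
        real_cond_exp M (past M X n) (\<lambda>\<omega>'. indicator A (X (Suc n) \<omega>')) \<omega>
          = measure (P (X n \<omega>)) A)"

definition has_transition_density ::
  "(real \<Rightarrow> real measure) \<Rightarrow> (real \<Rightarrow> real \<Rightarrow> real) \<Rightarrow> bool" where
  "has_transition_density P \<pi> \<longleftrightarrow>
     (\<lambda>(x, y). \<pi> x y) \<in> borel_measurable borel \<and>
     (\<forall>x y. 0 \<le> \<pi> x y) \<and>
     (\<forall>x. P x = density lborel (\<lambda>y. ennreal (\<pi> x y)))"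

text \<open>
  Irreducibility and recurrence are those of chains on a general state space, in the sense of
  Nummelin and of Meyn and Tweedie.
\<close>

definition irreducibility_measure :: "(real \<Rightarrow> real measure) \<Rightarrow> real measure \<Rightarrow> bool" where
  "irreducibility_measure P \<phi> \<longleftrightarrow>
     sets \<phi> = sets borel \<and> sigma_finite_measure \<phi> \<and> emeasure \<phi> (space \<phi>) > 0 \<and>
     (\<forall>x. \<forall>A\<in>sets borel. emeasure \<phi> A > 0 \<longrightarrow> (\<exists>n\<ge>1. emeasure (kernel_pow P n x) A > 0))"

definition irreducible_kernel :: "(real \<Rightarrow> real measure) \<Rightarrow> bool" where
  "irreducible_kernel P \<longleftrightarrow> (\<exists>\<phi>. irreducibility_measure P \<phi>)"

definition maximal_irreducibility_measure ::
  "(real \<Rightarrow> real measure) \<Rightarrow> real measure \<Rightarrow> bool" where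
  "maximal_irreducibility_measure P \<psi> \<longleftrightarrow>
     irreducibility_measure P \<psi> \<and>
     (\<forall>\<phi>. irreducibility_measure P \<phi> \<longrightarrow> absolutely_continuous \<psi> \<phi>)"

text \<open>
  All maximal irreducibility measures have the same null sets, so the choice of \<open>\<psi>\<close> is immaterial.
\<close>

definition recurrent_kernel :: "(real \<Rightarrow> real measure) \<Rightarrow> bool" where
  "recurrent_kernel P \<longleftrightarrow>
     (\<exists>\<psi>. maximal_irreducibility_measure P \<psi> \<and>
        (\<forall>x. \<forall>A\<in>sets borel. emeasure \<psi> A > 0 \<longrightarrow>
           (\<Sum>n. emeasure (kernel_pow P (Suc n) x) A) = \<infinity>))"

definition stationary_distribution ::
  "(real \<Rightarrow> real measure) \<Rightarrow> real measure \<Rightarrow> bool" where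
  "stationary_distribution P \<mu> \<longleftrightarrow>
     prob_space \<mu> \<and> sets \<mu> = sets borel \<and> \<mu> \<bind> P = \<mu>"

definition positive_recurrent_kernel :: "(real \<Rightarrow> real measure) \<Rightarrow> bool" where
  "positive_recurrent_kernel P \<longleftrightarrow>
     recurrent_kernel P \<and> (\<exists>\<mu>. stationary_distribution P \<mu>)"

definition has_lebesgue_density :: "real measure \<Rightarrow> bool" where
  "has_lebesgue_density \<mu> \<longleftrightarrow> (\<exists>p\<in>borel_measurable lborel. \<mu> = density lborel p)"

text \<open>
  The total variation norm of the signed measure \<open>\<mu> - \<nu>\<close>, that is, the sum of the masses of its
  positive and its negative part (twice the supremum over events if both are probability measures).
\<close>

definition tv_norm_diff :: "real measure \<Rightarrow> real measure \<Rightarrow> real" where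
  "tv_norm_diff \<mu> \<nu> =
     (SUP A\<in>sets borel. measure \<mu> A - measure \<nu> A) - (INF A\<in>sets borel. measure \<mu> A - measure \<nu> A)"

definition minorization :: "(real \<Rightarrow> real measure) \<Rightarrow> real measure \<Rightarrow> bool" where
  "minorization P \<mu> \<longleftrightarrow>
     (\<exists>h \<nu>. h \<in> borel_measurable borel \<and> (\<forall>x. 0 \<le> h x \<and> h x \<le> 1) \<and> (\<forall>x. x \<notin> {0..1} \<longrightarrow> h x = 0) \<and>
        (\<integral>x. h x \<partial>\<mu>) > 0 \<and>
        prob_space \<nu> \<and> sets \<nu> = sets borel \<and>
        (\<forall>x. \<forall>A\<in>sets borel. measure (P x) A \<ge> h x * measure \<nu> A))"

definition geometrically_ergodic :: "(real \<Rightarrow> real measure) \<Rightarrow> real measure \<Rightarrow> bool" where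
  "geometrically_ergodic P \<mu> \<longleftrightarrow>
     (\<exists>(V :: real \<Rightarrow> real) \<rho>. (\<forall>x. V x > 0) \<and> 0 < \<rho> \<and> \<rho> < 1 \<and>
        (\<forall>n\<ge>1. \<forall>x. tv_norm_diff (kernel_pow P n x) \<mu> \<le> V x * \<rho> ^ n))"

section \<open>Function spaces on the unit interval and the unit square\<close>

abbreviation unit_interval :: "real measure" where
  "unit_interval \<equiv> restrict_space lborel {0..1}"

abbreviation unit_square :: "(real \<times> real) measure" where
  "unit_square \<equiv> restrict_space lborel ({0..1} \<times> {0..1})"

definition sup_norm :: "'a measure \<Rightarrow> ('a \<Rightarrow> real) \<Rightarrow> ereal" where
  "sup_norm L t = esssup L (\<lambda>x. ereal \<bar>t x\<bar>)"

text \<open>The squared \<open>L\<^sup>2\<close> norm takes the value \<open>\<infinity>\<close> at functions that are not square integrable.\<close>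

definition sq_norm :: "'a measure \<Rightarrow> ('a \<Rightarrow> real) \<Rightarrow> ennreal" where
  "sq_norm L t = (\<integral>\<^sup>+x. ennreal ((t x)\<^sup>2) \<partial>L)"

definition L2_norm :: "'a measure \<Rightarrow> ('a \<Rightarrow> real) \<Rightarrow> real" where
  "L2_norm L t = sqrt (enn2real (sq_norm L t))"

definition Linf_L2 :: "'a measure \<Rightarrow> ('a \<Rightarrow> real) set" where
  "Linf_L2 L = {t \<in> borel_measurable L. sup_norm L t < \<infinity> \<and> sq_norm L t < \<infinity>}"

text \<open>\<open>d\<^sup>2(g, S)\<close>, the infimum of the squares being the square of the infimum.\<close>

definition sq_dist :: "'a measure \<Rightarrow> ('a \<Rightarrow> real) \<Rightarrow> ('a \<Rightarrow> real) set \<Rightarrow> ennreal" where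
  "sq_dist L g S = (INF t\<in>S. sq_norm L (\<lambda>x. g x - t x))"

section \<open>Models\<close>

text \<open>
  A model is given by a finite orthonormal family \<open>\<phi> m l\<close>, \<open>l \<in> \<Lambda> m\<close>. Since the contrast evaluates
  functions at the data, elements of \<open>L\<^sup>2\<close> are represented by genuine functions, extended by \<open>0\<close>
  outside \<open>[0,1]\<close>; two functions are orthogonal or bounded in the almost everywhere sense.
\<close>

definition model_space ::
  "('m \<Rightarrow> 'l set) \<Rightarrow> ('m \<Rightarrow> 'l \<Rightarrow> real \<Rightarrow> real) \<Rightarrow> 'm \<Rightarrow> (real \<Rightarrow> real) set" where
  "model_space \<Lambda> \<phi> m = range (\<lambda>\<alpha> x. \<Sum>l\<in>\<Lambda> m. \<alpha> l * \<phi> m l x)"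

definition bivariate_space ::
  "('m \<Rightarrow> 'l set) \<Rightarrow> ('m \<Rightarrow> 'l \<Rightarrow> real \<Rightarrow> real) \<Rightarrow> 'm \<Rightarrow> (real \<times> real \<Rightarrow> real) set" where
  "bivariate_space \<Lambda> \<phi> m =
     range (\<lambda>\<alpha> (x, y). \<Sum>l\<in>\<Lambda> m. \<Sum>k\<in>\<Lambda> m. \<alpha> l k * \<phi> m l x * \<phi> m k y)"

definition model_dim :: "('m \<Rightarrow> 'l set) \<Rightarrow> 'm \<Rightarrow> nat" where
  "model_dim \<Lambda> m = card (\<Lambda> m)"

definition model_indices :: "('m \<Rightarrow> 'l set) \<Rightarrow> nat \<Rightarrow> 'm set" where
  "model_indices \<Lambda> n = {m. real ((model_dim \<Lambda> m)\<^sup>2) \<le> sqrt (real n)}"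

text \<open>
  The condition on \<open>bivariate_space\<close> follows from the one on the basis functions. That the
  bivariate space has dimension \<open>(model_dim \<Lambda> m)\<^sup>2\<close> follows from orthonormality, and that this is at
  most \<open>\<surd>n\<close> is what membership in \<open>model_indices \<Lambda> n\<close> says.
\<close>

definition orthonormal_models ::
  "('m \<Rightarrow> 'l set) \<Rightarrow> ('m \<Rightarrow> 'l \<Rightarrow> real \<Rightarrow> real) \<Rightarrow> bool" where
  "orthonormal_models \<Lambda> \<phi> \<longleftrightarrow>
     (\<forall>m. finite (\<Lambda> m) \<and>
        (\<forall>l\<in>\<Lambda> m. \<phi> m l \<in> borel_measurable borel \<and> (\<forall>x. x \<notin> {0..1} \<longrightarrow> \<phi> m l x = 0)) \<and>
        (\<forall>l\<in>\<Lambda> m. \<phi> m l \<in> Linf_L2 unit_interval) \<and>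
        (\<forall>l\<in>\<Lambda> m. \<forall>k\<in>\<Lambda> m.
           (\<integral>x. \<phi> m l x * \<phi> m k x \<partial>unit_interval) = (if l = k then 1 else 0)) \<and>
        bivariate_space \<Lambda> \<phi> m \<subseteq> Linf_L2 unit_square)"

definition sup_norm_connected ::
  "('m \<Rightarrow> 'l set) \<Rightarrow> ('m \<Rightarrow> 'l \<Rightarrow> real \<Rightarrow> real) \<Rightarrow> real \<Rightarrow> bool" where
  "sup_norm_connected \<Lambda> \<phi> r\<^sub>0 \<longleftrightarrow>
     (\<forall>m. ereal (1 / sqrt (real (model_dim \<Lambda> m))) *
        (SUP t\<in>model_space \<Lambda> \<phi> m - {\<lambda>_. 0}.
           sup_norm unit_interval t / ereal (L2_norm unit_interval t)) \<le> ereal r\<^sub>0)"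

text \<open>
  Nesting is inclusion of sets of functions: the versions of the elements of \<open>L\<^sup>2\<close> are chosen
  coherently in the whole collection. If nesting held only almost everywhere, then an uncountable
  collection could contain versions of one and the same space that differ at the observations.
\<close>

definition nested_models ::
  "('m \<Rightarrow> 'l set) \<Rightarrow> ('m \<Rightarrow> 'l \<Rightarrow> real \<Rightarrow> real) \<Rightarrow> bool" where
  "nested_models \<Lambda> \<phi> \<longleftrightarrow>
     (\<forall>m m'. model_dim \<Lambda> m \<le> model_dim \<Lambda> m' \<longrightarrow> model_space \<Lambda> \<phi> m \<subseteq> model_space \<Lambda> \<phi> m')"

section \<open>Estimators\<close>

definition contrast :: "nat \<Rightarrow> (nat \<Rightarrow> real) \<Rightarrow> (real \<times> real \<Rightarrow> real) \<Rightarrow> real" where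
  "contrast n x t =
     1 / (real n - 1) * (\<Sum>i=1..n - 1. (L2_norm unit_square t)\<^sup>2 - 2 * t (x i, x (Suc i)))"

text \<open>
  The minimiser is unique for \<open>n \<ge> 2\<close>, because the contrast is a strictly convex quadratic function
  of the coefficients.
\<close>

definition g_hat ::
  "('m \<Rightarrow> 'l set) \<Rightarrow> ('m \<Rightarrow> 'l \<Rightarrow> real \<Rightarrow> real) \<Rightarrow> nat \<Rightarrow> (nat \<Rightarrow> real) \<Rightarrow> 'm \<Rightarrow> real \<times> real \<Rightarrow> real" where
  "g_hat \<Lambda> \<phi> n x m = arg_min (contrast n x) (\<lambda>t. t \<in> bivariate_space \<Lambda> \<phi> m)"

definition pen :: "('m \<Rightarrow> 'l set) \<Rightarrow> real \<Rightarrow> nat \<Rightarrow> 'm \<Rightarrow> real" where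
  "pen \<Lambda> K n m = K * real ((model_dim \<Lambda> m)\<^sup>2) / real n"

definition selected_model ::
  "('m \<Rightarrow> 'l set) \<Rightarrow> ('m \<Rightarrow> 'l \<Rightarrow> real \<Rightarrow> real) \<Rightarrow> real \<Rightarrow> nat \<Rightarrow> (nat \<Rightarrow> real) \<Rightarrow> 'm \<Rightarrow> bool" where
  "selected_model \<Lambda> \<phi> K n x m \<longleftrightarrow>
     is_arg_min (\<lambda>m. contrast n x (g_hat \<Lambda> \<phi> n x m) + pen \<Lambda> K n m)
       (\<lambda>m. m \<in> model_indices \<Lambda> n) m"

end

theory Submission
  imports Defs "HOL-Complex_Analysis.Complex_Analysis"
begin

text \<open>
  Let \<open>\<nu>(t)\<close> be the difference between the empirical mean of \<open>t(X\<^sub>i, X\<^sub>i\<^sub>+\<^sub>1)\<close> and \<open>\<integral> t g\<close>.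
  Because the estimator minimises a penalised contrast, its loss exceeds that of a competitor
  \<open>s\<close> by terms in \<open>\<nu>\<close> and in the penalties only. All of these involve one function of the larger
  of two nested models, so that \<open>\<nu>\<close> is controlled by the sum \<open>Z\<^sup>2\<close> of \<open>\<nu>(e\<^sub>j)\<^sup>2\<close> over an
  orthonormal basis of that model; this is \<open>oracle_inequality\<close>, and the factor 3 comes out of
  splitting a product there. It remains to show that the expected excess of \<open>8 Z\<^sup>2\<close> over the
  penalty, for a model of dimension \<open>D\<close>, is at most a multiple of \<open>1 / (n D\<^sup>2)\<close>. Models of equal
  dimension coincide by nesting, so one term for each dimension is enough, and \<open>\<Sum> 1 / D\<^sup>2\<close>
  converges.

  With \<open>N = n - 1\<close>, the variable \<open>N\<^sup>2 Z\<^sup>2\<close> is the squared length of a sum of \<open>N\<close> centred random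
  vectors \<open>\<Phi>(X\<^sub>i, X\<^sub>i\<^sub>+\<^sub>1) - E \<Phi>\<close> with \<open>D\<^sup>2\<close> coordinates. Its excess over a multiple of \<open>D\<^sup>2 N\<close>
  is estimated by eighth moments. Split each vector into the martingale difference \<open>\<Phi> - P\<Phi>\<close> and
  the centred function \<open>P\<Phi> - E \<Phi>\<close> of \<open>X\<^sub>i\<close> alone.

  The squared length of the martingale is twice a real martingale \<open>Q\<close> plus the sum of the
  squared lengths of the differences. That sum is at most a constant times \<open>D\<^sup>2 N\<close> with
  certainty, and the penalty pays for it. The conditional variance of an increment of \<open>Q\<close> is of
  order \<open>D\<close> times the squared length of the martingale, and not of order \<open>D\<^sup>2\<close>, since \<open>\<pi>\<close> is
  bounded and the second factor of \<open>\<Phi>\<close> is orthonormal (\<open>one_step_variance\<close>). So \<open>Q\<close> has size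
  \<open>N D\<^bsup>3/2\<^esup>\<close>, below \<open>N D\<^sup>2\<close> by a factor whose eighth power makes the sum over the dimensions
  converge (\<open>square_mart_eighth_moment\<close>); it is here that \<open>D\<^sup>4 \<le> n\<close> is needed.

  The same computation shows that \<open>P\<Phi>\<close> has length of order \<open>D\<^bsup>1/2\<^esup>\<close> only (\<open>F_square_sum\<close>).
  Since the chain mixes geometrically, a Poisson equation turns the sum of this part into
  another martingale, of size \<open>(N D)\<^bsup>1/2\<^esup>\<close> (\<open>additive_functional_eighth_moment\<close>). All the
  martingale moments come from a single recursion, \<open>moment_growth\<close>.

  Mixing has to be derived in mean over the stationary law, whereas the hypothesis gives a rate
  \<open>V(x) \<rho>\<^sup>n\<close> with a function \<open>V\<close> that need not be integrable. The minorising measure is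
  restricted to a set on which the rate is uniform; then the probabilities of regeneration at
  time \<open>n\<close> converge geometrically, and an argument with power series
  (\<open>convolution_inverse_geometric\<close>, a form of Kendall's theorem) shows that the time until the
  next regeneration has a geometric tail. Decompositions at the first and the last regeneration
  convert this tail into mixing (\<open>regeneration_imp_mixing\<close>).
\<close>

section \<open>Bounded measurable functions\<close>

text \<open>
  The bound is required at every point of the type, also outside the space of the measure. Then
  one and the same notion serves for test functions on the line and for random variables, it is
  stable under composition, and all integrals with respect to finite measures exist.
\<close>

definition bounded_meas :: "'a measure \<Rightarrow> ('a \<Rightarrow> real) \<Rightarrow> bool" where
  "bounded_meas M f \<longleftrightarrow> f \<in> borel_measurable M \<and> (\<exists>c. \<forall>x. \<bar>f x\<bar> \<le> c)"

lemma bounded_measI: "f \<in> borel_measurable M \<Longrightarrow> (\<And>x. \<bar>f x\<bar> \<le> c) \<Longrightarrow> bounded_meas M f"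
  unfolding bounded_meas_def by blast

lemma bounded_meas_measurable: "bounded_meas M f \<Longrightarrow> f \<in> borel_measurable M"
  by (simp add: bounded_meas_def)

lemma bounded_meas_const [intro, simp]: "bounded_meas M (\<lambda>_. c)"
  by (rule bounded_measI[where c="\<bar>c\<bar>"]) auto

lemma bounded_meas_add [intro]:
  assumes "bounded_meas M f" "bounded_meas M g"
  shows "bounded_meas M (\<lambda>x. f x + g x)"
proof -
  obtain c where c: "\<And>x. \<bar>f x\<bar> \<le> c" using assms(1) unfolding bounded_meas_def by blast
  obtain d where d: "\<And>x. \<bar>g x\<bar> \<le> d" using assms(2) unfolding bounded_meas_def by blast
  show ?thesis
  proof (rule bounded_measI[where c="c + d"])
    show "(\<lambda>x. f x + g x) \<in> borel_measurable M"
      using assms unfolding bounded_meas_def by auto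
    show "\<bar>f x + g x\<bar> \<le> c + d" for x using c[of x] d[of x] by linarith
  qed
qed

lemma bounded_meas_mult [intro]:
  assumes "bounded_meas M f" "bounded_meas M g"
  shows "bounded_meas M (\<lambda>x. f x * g x)"
proof -
  obtain c where c: "\<And>x. \<bar>f x\<bar> \<le> c" using assms(1) unfolding bounded_meas_def by blast
  obtain d where d: "\<And>x. \<bar>g x\<bar> \<le> d" using assms(2) unfolding bounded_meas_def by blast
  show ?thesis
  proof (rule bounded_measI[where c="c * d"])
    show "(\<lambda>x. f x * g x) \<in> borel_measurable M"
      using assms unfolding bounded_meas_def by auto
    show "\<bar>f x * g x\<bar> \<le> c * d" for x
      unfolding abs_mult by (intro mult_mono c d) (use c[of x] in auto)
  qed
qed

lemma bounded_meas_cmult [intro]: "bounded_meas M f \<Longrightarrow> bounded_meas M (\<lambda>x. c * f x)"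
  by (intro bounded_meas_mult bounded_meas_const)

lemma bounded_meas_minus [intro]: "bounded_meas M f \<Longrightarrow> bounded_meas M (\<lambda>x. - f x)"
  using bounded_meas_cmult[of M f "-1"] by simp

lemma bounded_meas_diff [intro]:
  "bounded_meas M f \<Longrightarrow> bounded_meas M g \<Longrightarrow> bounded_meas M (\<lambda>x. f x - g x)"
  using bounded_meas_add[of M f "\<lambda>x. - g x"] by auto

lemma bounded_meas_power [intro]: "bounded_meas M f \<Longrightarrow> bounded_meas M (\<lambda>x. f x ^ k)"
  by (induction k) auto

lemma bounded_meas_abs [intro]: "bounded_meas M f \<Longrightarrow> bounded_meas M (\<lambda>x. \<bar>f x\<bar>)"
  unfolding bounded_meas_def by auto

lemma bounded_meas_sum [intro]:
  "(\<And>i. i \<in> I \<Longrightarrow> bounded_meas M (f i)) \<Longrightarrow> bounded_meas M (\<lambda>x. \<Sum>i\<in>I. f i x)"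
  by (induction I rule: infinite_finite_induct) auto

lemma bounded_meas_comp:
  assumes "bounded_meas N f" "g \<in> M \<rightarrow>\<^sub>M N"
  shows "bounded_meas M (\<lambda>x. f (g x))"
  using assms unfolding bounded_meas_def by (auto intro: measurable_compose)

lemma bounded_meas_indicator [intro]:
  "A \<in> sets M \<Longrightarrow> bounded_meas M (indicator A)"
  by (rule bounded_measI[where c=1]) (auto simp: indicator_def)

lemmas bounded_meas_intros =
  bounded_meas_const bounded_meas_add bounded_meas_mult bounded_meas_diff bounded_meas_minus
  bounded_meas_power bounded_meas_abs bounded_meas_sum bounded_meas_indicator

lemma (in finite_measure) bounded_meas_integrable:
  assumes "bounded_meas M f"
  shows "integrable M f"
proof -
  obtain c where "\<And>x. \<bar>f x\<bar> \<le> c" using assms unfolding bounded_meas_def by blast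
  then show ?thesis
    using assms by (intro integrable_const_bound[where B=c] bounded_meas_measurable) auto
qed

lemma (in prob_space) abs_integral_le:
  fixes f :: "'a \<Rightarrow> real"
  assumes "f \<in> borel_measurable M" "\<And>x. \<bar>f x\<bar> \<le> c"
  shows "\<bar>\<integral>x. f x \<partial>M\<bar> \<le> c"
proof -
  have i: "integrable M f" using assms by (auto intro!: integrable_const_bound[where B=c])
  have "(\<integral>x. f x \<partial>M) \<le> c"
    by (intro integral_le_const i AE_I2) (meson abs_le_D1 assms(2))
  moreover have "- c \<le> (\<integral>x. f x \<partial>M)"
    by (intro integral_ge_const i AE_I2) (meson abs_le_D2 assms(2) minus_le_iff)
  ultimately show ?thesis by linarith
qed

section \<open>Growth of moments along a martingale\<close>

text \<open>
  Here \<open>A\<close> stands for the squared length of a vector \<open>S\<close>, \<open>e\<close> for that of an increment \<open>d\<close>, and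
  \<open>c\<close> for their inner product. The term linear in \<open>c\<close> is kept exactly because its expectation
  vanishes for a martingale; the remaining terms of the expansion are dominated by the extreme
  ones \<open>A\<^sup>3 e\<close> and \<open>e\<^sup>4\<close>.
\<close>

lemma fourth_power_increment:
  fixes A c e :: real
  assumes A: "0 \<le> A" and e: "0 \<le> e" and c: "c\<^sup>2 \<le> A * e"
  shows "(A + 2 * c + e) ^ 4 \<le> A ^ 4 + 8 * (A ^ 3 * c) + 500 * (A ^ 3 * e + e ^ 4)"
proof -
  define x where "x = 2 * c + e"
  have mono: "A\<^sup>2 * e\<^sup>2 \<le> A ^ 3 * e + e ^ 4"
  proof (cases "e \<le> A")
    case True
    have "A\<^sup>2 * e\<^sup>2 = (A\<^sup>2 * e) * e" by (simp add: power2_eq_square)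
    also have "\<dots> \<le> (A\<^sup>2 * e) * A" using True A e by (intro mult_left_mono) auto
    also have "\<dots> = A ^ 3 * e" by (simp add: power2_eq_square power3_eq_cube)
    finally show ?thesis using e by (simp add: add_increasing2)
  next
    case False
    have "A\<^sup>2 * e\<^sup>2 \<le> e\<^sup>2 * e\<^sup>2" using False A by (intro mult_right_mono power_mono) auto
    also have "\<dots> = e ^ 4" by (simp flip: power_add)
    finally show ?thesis using A e by (simp add: add_increasing)
  qed
  have x2: "x\<^sup>2 \<le> 8 * (A * e) + 2 * e\<^sup>2"
  proof -
    have "x\<^sup>2 \<le> 2 * (2 * c)\<^sup>2 + 2 * e\<^sup>2"
      unfolding x_def using sum_squares_bound[of "2*c" e] by (simp add: power2_sum)
    then show ?thesis using c by (simp add: power_mult_distrib)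
  qed
  have Ax2: "A\<^sup>2 * x\<^sup>2 \<le> 8 * (A ^ 3 * e) + 2 * (A\<^sup>2 * e\<^sup>2)"
    using mult_left_mono[OF x2, of "A\<^sup>2"] by (simp add: algebra_simps power2_eq_square power3_eq_cube)
  have x4: "x ^ 4 \<le> 128 * (A\<^sup>2 * e\<^sup>2) + 8 * e ^ 4"
  proof -
    have "x ^ 4 = (x\<^sup>2)\<^sup>2" by simp
    also have "\<dots> \<le> (8 * (A * e) + 2 * e\<^sup>2)\<^sup>2" by (intro power_mono x2) auto
    also have "\<dots> \<le> 2 * (8 * (A * e))\<^sup>2 + 2 * (2 * e\<^sup>2)\<^sup>2"
      using sum_squares_bound[of "8 * (A * e)" "2 * e\<^sup>2"] by (simp add: power2_sum)
    also have "\<dots> = 128 * (A\<^sup>2 * e\<^sup>2) + 8 * e ^ 4" by (simp add: power_mult_distrib)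
    finally show ?thesis .
  qed
  have Ax3: "2 * (A * x ^ 3) \<le> A\<^sup>2 * x\<^sup>2 + x ^ 4"
    using sum_squares_bound[of "A * x" "x\<^sup>2"]
    by (simp add: power_mult_distrib power2_eq_square power3_eq_cube power4_eq_xxxx algebra_simps)
  have "(A + 2 * c + e) ^ 4 = (A + x) ^ 4" by (simp add: x_def add.assoc)
  also have "\<dots> = A ^ 4 + 4 * (A ^ 3 * x) + 6 * (A\<^sup>2 * x\<^sup>2) + 4 * (A * x ^ 3) + x ^ 4"
    by (simp add: power2_eq_square power3_eq_cube power4_eq_xxxx algebra_simps)
  also have "4 * (A ^ 3 * x) = 8 * (A ^ 3 * c) + 4 * (A ^ 3 * e)"
    by (simp add: x_def algebra_simps)
  finally show ?thesis using Ax2 x4 Ax3 mono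
    by (smt (verit) A e mult_nonneg_nonneg zero_le_power)
qed

lemma cube_times_le_young:
  fixes A v :: real
  assumes "0 \<le> A" "0 \<le> v" "0 < N"
  shows "A ^ 3 * v \<le> A ^ 4 / N + N ^ 3 * v ^ 4"
proof (cases "N * v \<le> A")
  case True
  then have "v \<le> A / N" using assms by (simp add: field_simps)
  then have "A ^ 3 * v \<le> A ^ 3 * (A / N)" using assms by (intro mult_left_mono) auto
  also have "\<dots> = A ^ 4 / N" by (simp add: power3_eq_cube power4_eq_xxxx)
  finally show ?thesis using assms by (simp add: add_increasing2)
next
  case False
  then have "A ^ 3 * v \<le> (N * v) ^ 3 * v" using assms by (intro mult_right_mono power_mono) auto
  also have "\<dots> = N ^ 3 * v ^ 4" by (simp add: power3_eq_cube power4_eq_xxxx algebra_simps)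
  finally show ?thesis using assms by (simp add: add_increasing)
qed

lemma discrete_gronwall:
  fixes a :: "nat \<Rightarrow> real"
  assumes "a 0 = 0" "0 \<le> \<alpha>" "0 \<le> \<beta>"
    and "\<And>i. i < N \<Longrightarrow> a (Suc i) \<le> (1 + \<alpha>) * a i + \<beta>"
    and "i \<le> N"
  shows "a i \<le> real i * \<beta> * exp (\<alpha> * real i)"
  using assms(5)
proof (induction i)
  case (Suc i)
  have e: "(1 + \<alpha>) * exp (\<alpha> * real i) \<le> exp (\<alpha> * real (Suc i))"
    using mult_right_mono[OF exp_ge_add_one_self[of \<alpha>], of "exp (\<alpha> * real i)"]
    by (simp add: distrib_left exp_add)
  have "a (Suc i) \<le> (1 + \<alpha>) * a i + \<beta>" using assms(4)[of i] Suc.prems by simp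
  also have "\<dots> \<le> (1 + \<alpha>) * (real i * \<beta> * exp (\<alpha> * real i)) + \<beta>"
    using Suc assms by (intro add_mono mult_left_mono) auto
  also have "\<dots> = real i * \<beta> * ((1 + \<alpha>) * exp (\<alpha> * real i)) + \<beta> * 1" by simp
  also have "\<dots> \<le> real i * \<beta> * exp (\<alpha> * real (Suc i)) + \<beta> * exp (\<alpha> * real (Suc i))"
    using assms e by (intro add_mono mult_left_mono) auto
  finally show ?case by (simp add: algebra_simps)
qed (use assms in simp)

text \<open>
  The recursion behind every moment bound below, for vector martingales (\<open>A\<close> is a squared
  length) and for the real martingale \<open>Q\<close> (\<open>A\<close> is its square) alike. The variable \<open>v\<close> is a bound
  for the conditional expectation of \<open>e\<close>. Young's inequality is applied with weight \<open>N\<close>, so that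
  one step multiplies the moment by \<open>1 + 500 / N\<close> and \<open>N\<close> steps multiply it by no more than
  \<open>exp 500\<close>.
\<close>

lemma (in prob_space) moment_growth:
  fixes A c e v :: "nat \<Rightarrow> 'a \<Rightarrow> real" and N :: nat
  assumes init: "\<And>\<omega>. A 0 \<omega> = 0"
    and step: "\<And>i \<omega>. i < N \<Longrightarrow> A (Suc i) \<omega> = A i \<omega> + 2 * c i \<omega> + e i \<omega>"
    and nonneg: "\<And>i \<omega>. 0 \<le> A i \<omega>" "\<And>i \<omega>. 0 \<le> e i \<omega>" "\<And>i \<omega>. 0 \<le> v i \<omega>"
    and cs: "\<And>i \<omega>. (c i \<omega>)\<^sup>2 \<le> A i \<omega> * e i \<omega>"
    and bm: "\<And>i. bounded_meas M (A i)" "\<And>i. bounded_meas M (c i)"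
      "\<And>i. bounded_meas M (e i)" "\<And>i. bounded_meas M (v i)"
    and orth: "\<And>i. i < N \<Longrightarrow> (\<integral>\<omega>. A i \<omega> ^ 3 * c i \<omega> \<partial>M) = 0"
    and var: "\<And>i. i < N \<Longrightarrow> (\<integral>\<omega>. A i \<omega> ^ 3 * e i \<omega> \<partial>M) \<le> (\<integral>\<omega>. A i \<omega> ^ 3 * v i \<omega> \<partial>M)"
    and V: "\<And>i. i < N \<Longrightarrow> (\<integral>\<omega>. v i \<omega> ^ 4 \<partial>M) \<le> V"
    and W: "\<And>i. i < N \<Longrightarrow> (\<integral>\<omega>. e i \<omega> ^ 4 \<partial>M) \<le> W"
    and VW: "0 \<le> V" "0 \<le> W"
    and j: "j \<le> N"
  shows "(\<integral>\<omega>. A j \<omega> ^ 4 \<partial>M) \<le> 500 * exp 500 * (real N ^ 4 * V + real N * W)"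
proof (cases "N = 0")
  case True
  then show ?thesis using j init by simp
next
  case False
  then have N: "0 < real N" by simp
  define a where "a i = (\<integral>\<omega>. A i \<omega> ^ 4 \<partial>M)" for i
  have rec: "a (Suc i) \<le> (1 + 500 / real N) * a i + 500 * (real N ^ 3 * V + W)" if "i < N" for i
  proof -
    have "a (Suc i) \<le> (\<integral>\<omega>. A i \<omega> ^ 4 + 8 * (A i \<omega> ^ 3 * c i \<omega>) + 500 * (A i \<omega> ^ 3 * e i \<omega> + e i \<omega> ^ 4) \<partial>M)"
      unfolding a_def
      by (intro integral_mono bounded_meas_integrable bounded_meas_intros bm)
         (unfold step[OF that], rule fourth_power_increment[OF nonneg(1,2) cs])
    also have "\<dots> = a i + 8 * (\<integral>\<omega>. A i \<omega> ^ 3 * c i \<omega> \<partial>M)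
        + 500 * ((\<integral>\<omega>. A i \<omega> ^ 3 * e i \<omega> \<partial>M) + (\<integral>\<omega>. e i \<omega> ^ 4 \<partial>M))"
    proof -
      have "integrable M (\<lambda>\<omega>. A i \<omega> ^ 4)" "integrable M (\<lambda>\<omega>. A i \<omega> ^ 3 * c i \<omega>)"
        "integrable M (\<lambda>\<omega>. A i \<omega> ^ 3 * e i \<omega>)" "integrable M (\<lambda>\<omega>. e i \<omega> ^ 4)"
        by (intro bounded_meas_integrable bounded_meas_intros bm)+
      then show ?thesis by (simp add: a_def distrib_left)
    qed
    also have "\<dots> \<le> a i + 500 * ((\<integral>\<omega>. A i \<omega> ^ 3 * v i \<omega> \<partial>M) + W)"
      using orth[OF that] var[OF that] W[OF that] by simp
    also have "(\<integral>\<omega>. A i \<omega> ^ 3 * v i \<omega> \<partial>M) \<le> (\<integral>\<omega>. A i \<omega> ^ 4 * (1 / real N) + real N ^ 3 * v i \<omega> ^ 4 \<partial>M)"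
      by (intro integral_mono bounded_meas_integrable bounded_meas_intros bm)
         (use cube_times_le_young[OF nonneg(1,3) N] in simp)
    also have "\<dots> = a i * (1 / real N) + real N ^ 3 * (\<integral>\<omega>. v i \<omega> ^ 4 \<partial>M)"
      unfolding a_def
      by (subst Bochner_Integration.integral_add,
          (intro bounded_meas_integrable bounded_meas_intros bm)+) simp
    also have "\<dots> \<le> a i / real N + real N ^ 3 * V"
      using V[OF that] N by (simp add: mult_left_mono)
    finally show ?thesis by (simp add: algebra_simps)
  qed
  have "a j \<le> real j * (500 * (real N ^ 3 * V + W)) * exp (500 / real N * real j)"
    by (rule discrete_gronwall[where a=a and N=N, OF _ _ _ rec j])
       (use init VW in \<open>auto simp: a_def\<close>)
  also have "\<dots> \<le> real N * (500 * (real N ^ 3 * V + W)) * exp 500"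
  proof -
    have "500 / real N * real j \<le> 500" using j N by (simp add: field_simps)
    then show ?thesis using VW j by (intro mult_mono) auto
  qed
  also have "\<dots> = 500 * exp 500 * (real N ^ 4 * V + real N * W)"
    by (simp add: algebra_simps power3_eq_cube power4_eq_xxxx)
  finally show ?thesis unfolding a_def .
qed

section \<open>Geometric tails from a geometric renewal theorem\<close>

text \<open>
  The differences \<open>a\<close> of \<open>u\<close> decay geometrically, and their convolution with \<open>t\<close> is the unit
  sequence. Hence \<open>A(z) T(z) = 1\<close> for the two power series on the closed unit disc, so \<open>A\<close> has
  no zero there. As \<open>A\<close> is holomorphic on a larger disc, \<open>1/A\<close> is holomorphic on a disc of
  radius greater than 1, and its coefficients \<open>t\<close> decay geometrically. At \<open>z = 1\<close> the identity
  says that the limit of \<open>u\<close> is the inverse of the mean return time.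
\<close>

lemma convolution_inverse_geometric:
  fixes u t :: "nat \<Rightarrow> real"
  assumes conv: "\<And>n. (\<Sum>i\<le>n. u i * t (n - i)) = 1"
    and u: "\<And>n. \<bar>u n - m\<bar> \<le> c * \<rho> ^ n" and \<rho>: "0 < \<rho>" "\<rho> < 1" and m: "0 < m"
    and u0: "\<And>n. 0 \<le> u n" and t0: "\<And>n. 0 \<le> t n"
  shows "summable t" "m * suminf t = 1" "\<exists>r C. 1 < r \<and> (\<forall>n. t n \<le> C / r ^ n)"
proof -
  have lim: "u \<longlonglongrightarrow> m"
  proof (rule Lim_null_comparison[THEN LIM_zero_cancel])
    show "\<forall>\<^sub>F n in sequentially. norm (u n - m) \<le> c * \<rho> ^ n" using u by simp
    show "(\<lambda>n. c * \<rho> ^ n) \<longlonglongrightarrow> 0"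
      using \<rho> by (intro tendsto_mult_right_zero LIMSEQ_realpow_zero) auto
  qed
  then have "\<forall>\<^sub>F n in sequentially. m / 2 < u n"
    using m by (intro order_tendstoD) auto
  then obtain n0 where n0: "\<And>n. n \<ge> n0 \<Longrightarrow> m / 2 < u n"
    by (auto simp: eventually_sequentially)
  show st: "summable t"
  proof (rule summableI_nonneg_bounded[OF t0])
    fix n
    have "m / 2 * (\<Sum>j<n. t j) = (\<Sum>j<n. m / 2 * t j)" by (simp add: sum_distrib_left)
    also have "\<dots> \<le> (\<Sum>j<n. u (n0 + n - j) * t j)"
      by (intro sum_mono mult_right_mono t0 less_imp_le n0) auto
    also have "\<dots> \<le> (\<Sum>j\<le>n0 + n. u (n0 + n - j) * t j)"
      by (intro sum_mono2) (auto simp: u0 t0)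
    also have "\<dots> = (\<Sum>j\<le>n0 + n. u j * t (n0 + n - j))"
      by (rule sum.reindex_bij_witness[of _ "\<lambda>j. n0 + n - j" "\<lambda>j. n0 + n - j"]) auto
    also have "\<dots> = 1" by (rule conv)
    finally show "(\<Sum>j<n. t j) \<le> 2 / m" using m by (simp add: field_simps)
  qed
  \<comment> \<open>The series of \<open>u\<close> itself has a pole at 1; passing to differences removes it.\<close>
  define a where "a n = (if n = 0 then u 0 else u n - u (n - 1))" for n
  have a_sums: "a sums m"
  proof -
    have "(\<Sum>i<Suc n. a i) = u n" for n by (induction n) (auto simp: a_def)
    then have "(\<lambda>n. \<Sum>i<Suc n. a i) \<longlonglongrightarrow> m" using lim by simp
    then show ?thesis unfolding sums_def by (rule filterlim_sequentially_Suc[THEN iffD1])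
  qed
  have "\<bar>u 0 - m\<bar> \<le> c" using u[of 0] by simp
  then have c: "0 \<le> c" by linarith
  define c' where "c' = \<bar>u 0\<bar> + c * (1 + 1 / \<rho>)"
  have a_bound: "\<bar>a n\<bar> \<le> c' * \<rho> ^ n" for n
  proof (cases n)
    case 0
    then show ?thesis using c \<rho> by (simp add: a_def c'_def)
  next
    case (Suc k)
    have "\<bar>a n\<bar> \<le> \<bar>u n - m\<bar> + \<bar>u k - m\<bar>" by (simp add: a_def Suc)
    also have "\<dots> \<le> c * \<rho> ^ n + c * \<rho> ^ k" by (intro add_mono u)
    also have "\<dots> = c * (1 + 1 / \<rho>) * \<rho> ^ n" using \<rho> by (simp add: Suc field_simps)
    also have "\<dots> \<le> c' * \<rho> ^ n" using \<rho> by (intro mult_right_mono) (auto simp: c'_def)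
    finally show ?thesis .
  qed
  have conv_a: "(\<Sum>i\<le>n. a i * t (n - i)) = (if n = 0 then 1 else 0)" for n
  proof (cases n)
    case 0
    then show ?thesis using conv[of 0] by (simp add: a_def)
  next
    case (Suc k)
    have "(\<Sum>i\<le>n. a i * t (n - i)) = u 0 * t (Suc k) + (\<Sum>i\<le>k. (u (Suc i) - u i) * t (k - i))"
      unfolding Suc sum.atMost_Suc_shift by (simp add: a_def)
    also have "\<dots> = (\<Sum>i\<le>Suc k. u i * t (Suc k - i)) - (\<Sum>i\<le>k. u i * t (k - i))"
      unfolding sum.atMost_Suc_shift by (simp add: left_diff_distrib sum_subtractf)
    finally show ?thesis using conv by (simp add: Suc)
  qed
  have sum_az: "summable (\<lambda>n. norm (of_real (a n) * z ^ n))" if "norm z < 1 / \<rho>" for z :: complex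
  proof (rule summable_comparison_test')
    show "summable (\<lambda>n. c' * (\<rho> * norm z) ^ n)"
      using that \<rho> by (intro summable_mult summable_geometric) (auto simp: field_simps)
    show "norm (norm (of_real (a n) * z ^ n)) \<le> c' * (\<rho> * norm z) ^ n" for n
      using mult_right_mono[OF a_bound[of n], of "norm z ^ n"]
      by (simp add: norm_mult norm_power power_mult_distrib mult.assoc)
  qed
  have sum_tz: "summable (\<lambda>n. norm (of_real (t n) * z ^ n))" if "norm z \<le> 1" for z :: complex
  proof (rule summable_comparison_test'[OF st])
    show "norm (norm (of_real (t n) * z ^ n)) \<le> t n" for n
      using that t0[of n] by (simp add: norm_mult norm_power mult_left_le power_le_one)
  qed
  define A where "A z = (\<Sum>n. of_real (a n) * z ^ n :: complex)" for z
  define T where "T z = (\<Sum>n. of_real (t n) * z ^ n :: complex)" for z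
  have AT: "A z * T z = 1" if z: "norm z \<le> 1" for z
  proof -
    have "norm z < 1 / \<rho>" using z \<rho> by (simp add: field_simps) (smt (verit) mult_left_le)
    then have "(\<lambda>k. \<Sum>i\<le>k. (of_real (a i) * z ^ i) * (of_real (t (k - i)) * z ^ (k - i))) sums (A z * T z)"
      unfolding A_def T_def by (intro Cauchy_product_sums sum_az sum_tz z)
    also have "(\<lambda>k. \<Sum>i\<le>k. (of_real (a i) * z ^ i) * (of_real (t (k - i)) * z ^ (k - i)))
        = (\<lambda>k. if k = 0 then 1 else 0 :: complex)"
    proof
      fix k
      have "(\<Sum>i\<le>k. (of_real (a i) * z ^ i) * (of_real (t (k - i)) * z ^ (k - i)))
          = (\<Sum>i\<le>k. of_real (a i * t (k - i)) * z ^ k)"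
        by (intro sum.cong) (auto simp: mult_ac simp flip: power_add)
      also have "\<dots> = of_real (\<Sum>i\<le>k. a i * t (k - i)) * z ^ k"
        by (simp add: sum_distrib_right)
      finally show "(\<Sum>i\<le>k. (of_real (a i) * z ^ i) * (of_real (t (k - i)) * z ^ (k - i)))
          = (if k = 0 then 1 else 0)" by (simp add: conv_a)
    qed
    finally show ?thesis using sums_unique2 sums_single[of 0 "\<lambda>_. 1::complex"] by fastforce
  qed
  show "m * suminf t = 1"
  proof -
    have "A 1 = of_real m"
      unfolding A_def using sums_of_real[OF a_sums, where 'a=complex] by (simp add: sums_unique[symmetric])
    moreover have "T 1 = of_real (suminf t)"
      unfolding T_def using sums_of_real[OF summable_sums[OF st], where 'a=complex] by (simp add: sums_unique[symmetric])
    ultimately have "of_real (m * suminf t) = (1::complex)" using AT[of 1] by simp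
    then show ?thesis using of_real_eq_1_iff by blast
  qed
  have holA: "A holomorphic_on ball 0 (1 / \<rho>)"
    by (rule power_series_holomorphic[where a="\<lambda>n. of_real (a n)"])
       (auto simp: A_def intro!: summable_sums summable_norm_cancel[OF sum_az])
  define U where "U = ball 0 (1 / \<rho>) \<inter> A -` (- {0})"
  have U: "open U" unfolding U_def
    by (intro continuous_open_preimage holomorphic_on_imp_continuous_on holA) auto
  have "cball 0 1 \<subseteq> U"
  proof
    fix z :: complex assume "z \<in> cball 0 1"
    then have z: "norm z \<le> 1" by simp
    then have "norm z < 1 / \<rho>" using \<rho> by (simp add: field_simps) (smt (verit) mult_left_le)
    then show "z \<in> U" using AT[OF z] by (auto simp: U_def)
  qed
  then obtain \<epsilon> where \<epsilon>: "0 < \<epsilon>" "(\<Union>x\<in>cball 0 1. ball x \<epsilon>) \<subseteq> U"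
    using compact_subset_open_imp_ball_epsilon_subset[OF compact_cball U] by metis
  have ballU: "ball 0 (1 + \<epsilon>) \<subseteq> U"
  proof
    fix z :: complex assume z: "z \<in> ball 0 (1 + \<epsilon>)"
    show "z \<in> U"
    proof (cases "norm z \<le> 1")
      case True
      then show ?thesis using \<open>cball 0 1 \<subseteq> U\<close> by auto
    next
      case False
      define w where "w = z / of_real (norm z)"
      have w1: "norm w = 1" using False by (auto simp: w_def norm_divide)
      have "of_real (norm z) * w = z" using False by (auto simp: w_def)
      then have "z - w = of_real (norm z - 1) * w" by (simp add: left_diff_distrib)
      then have "norm (z - w) = \<bar>norm z - 1\<bar>" by (simp only: norm_mult norm_of_real w1 mult_1_right)
      then have "norm (z - w) < \<epsilon>" using False z by simp
      with w1 have "z \<in> (\<Union>x\<in>cball 0 1. ball x \<epsilon>)"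
        by (intro UN_I[of w]) (auto simp: dist_norm norm_minus_commute)
      then show ?thesis by (rule subsetD[OF \<epsilon>(2)])
    qed
  qed
  define H where "H z = inverse (A z)" for z
  have holH: "H holomorphic_on ball 0 (1 + \<epsilon>)"
    unfolding H_def using ballU
    by (intro holomorphic_on_inverse holomorphic_on_subset[OF holA]) (auto simp: U_def)
  have HT: "H z = T z" if "norm z \<le> 1" for z
    using AT[OF that] by (simp add: H_def inverse_unique)
  define F where "F = Abs_fps (\<lambda>n. of_real (t n) :: complex)"
  have "H has_fps_expansion F"
    unfolding has_fps_expansion_def
  proof
    have "1 \<le> fps_conv_radius F"
      unfolding fps_conv_radius_def F_def fps_nth_Abs_fps
      using conv_radius_geI[OF summable_norm_cancel[OF sum_tz[of 1]]] by (simp add: one_ereal_def)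
    then show "0 < fps_conv_radius F" by (rule less_le_trans[rotated]) simp
    have "\<forall>\<^sub>F z in nhds 0. z \<in> ball (0::complex) 1"
      by (intro eventually_nhds_in_open) auto
    then show "\<forall>\<^sub>F z in nhds 0. eval_fps F z = H z"
      by eventually_elim (auto simp: HT T_def eval_fps_def F_def)
  qed
  then have "fps_conv_radius F \<ge> ereal (1 + \<epsilon>)"
    by (rule holomorphic_on_imp_fps_conv_radius_ge) (use \<epsilon> holH in auto)
  moreover define q where "q = 1 + \<epsilon> / 2"
  then have q: "1 < q" "q < 1 + \<epsilon>" using \<epsilon> by auto
  ultimately have "norm (of_real q :: complex) < fps_conv_radius F"
    by (auto intro: less_le_trans[of _ "ereal (1 + \<epsilon>)"])
  then have "summable (\<lambda>n. norm (fps_nth F n * of_real q ^ n))" by (rule norm_summable_fps)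
  then have S: "summable (\<lambda>n. t n * q ^ n)"
    using q t0 by (simp add: F_def norm_mult norm_power)
  have "t n \<le> (\<Sum>n. t n * q ^ n) / q ^ n" for n
  proof -
    have "t n * q ^ n \<le> (\<Sum>n. t n * q ^ n)"
      using sum_le_suminf[OF S, of "{n}"] t0 q by simp
    then show ?thesis using q by (simp add: field_simps)
  qed
  then show "\<exists>r C. 1 < r \<and> (\<forall>n. t n \<le> C / r ^ n)"
    using q by blast
qed

lemma bernoulli_one_minus:
  fixes \<theta> :: real
  assumes "0 \<le> \<theta>" "\<theta> < 1" "0 < p"
  shows "\<theta> \<le> (1 - (1 - \<theta>) / real p) ^ p"
proof -
  have "1 + real p * (- ((1 - \<theta>) / real p)) \<le> (1 + - ((1 - \<theta>) / real p)) ^ p"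
  proof (rule Bernoulli_inequality)
    have "(1 - \<theta>) / real p \<le> 1" using assms by (simp add: field_simps)
    then show "- 1 \<le> - ((1 - \<theta>) / real p)" by simp
  qed
  then show ?thesis using assms by simp
qed

lemma power_times_geometric_bounded:
  fixes \<theta> :: real
  assumes "0 \<le> \<theta>" "\<theta> < 1"
  shows "\<exists>K. \<forall>n. real n ^ p * \<theta> ^ n \<le> K"
proof (cases "p = 0")
  case True
  then show ?thesis using assms by (intro exI[of _ 1]) (auto simp: power_le_one)
next
  case False
  define s where "s = 1 - (1 - \<theta>) / real p"
  have s: "0 \<le> s" "s < 1" using assms False by (auto simp: s_def field_simps)
  have "(\<lambda>n. of_nat n * s ^ n) \<longlonglongrightarrow> 0" using s by (intro powser_times_n_limit_0) auto
  then have "Bseq (\<lambda>n. real n * s ^ n)" by (intro convergent_imp_Bseq convergentI)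
  then obtain K where K: "\<And>n. real n * s ^ n \<le> K" using s
    by (auto simp: Bseq_def abs_mult)
  have "real n ^ p * \<theta> ^ n \<le> K ^ p" for n
  proof -
    have "\<theta> ^ n \<le> (s ^ p) ^ n"
      using bernoulli_one_minus[OF assms, of p] False assms by (intro power_mono) (auto simp: s_def)
    then have "real n ^ p * \<theta> ^ n \<le> real n ^ p * (s ^ p) ^ n" by (intro mult_left_mono) auto
    also have "\<dots> = (real n * s ^ n) ^ p" by (simp add: power_mult_distrib mult.commute flip: power_mult)
    also have "\<dots> \<le> K ^ p" using s K by (intro power_mono) auto
    finally show ?thesis .
  qed
  then show ?thesis by blast
qed

section \<open>Markov kernels as operators on bounded functions\<close>

text \<open>
  Kernels are treated as operators on bounded functions. The kernel left after subtracting the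
  regeneration part is then just another operator, and no sub-probability kernel has to be
  constructed for it.
\<close>

definition linear_on_bounded :: "((real \<Rightarrow> real) \<Rightarrow> real \<Rightarrow> real) \<Rightarrow> bool" where
  "linear_on_bounded T \<longleftrightarrow>
     (\<forall>u. bounded_meas borel u \<longrightarrow> bounded_meas borel (T u)) \<and>
     (\<forall>u v a. bounded_meas borel u \<longrightarrow> bounded_meas borel v \<longrightarrow>
        T (\<lambda>x. a * u x + v x) = (\<lambda>x. a * T u x + T v x))"

lemma linear_on_boundedD:
  assumes "linear_on_bounded T" "bounded_meas borel u"
  shows "bounded_meas borel (T u)"
    "bounded_meas borel v \<Longrightarrow> T (\<lambda>x. a * u x + v x) = (\<lambda>x. a * T u x + T v x)"
  using assms unfolding linear_on_bounded_def by blast+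

lemma linear_on_bounded_cmult:
  assumes "linear_on_bounded T" "bounded_meas borel u"
  shows "T (\<lambda>x. a * u x) = (\<lambda>x. a * T u x)"
proof -
  have z: "T (\<lambda>x. 0) = (\<lambda>x. 0)"
  proof -
    have "T (\<lambda>x. 0) x = 0" for x
      using linear_on_boundedD(2)[OF assms(1), of "\<lambda>_. 0" "\<lambda>_. 0" 1] by (simp add: fun_eq_iff)
    then show ?thesis by blast
  qed
  show ?thesis
    using linear_on_boundedD(2)[OF assms, of "\<lambda>_. 0" a] z by simp
qed

lemma linear_on_bounded_add:
  assumes "linear_on_bounded T" "bounded_meas borel u" "bounded_meas borel v"
  shows "T (\<lambda>x. u x + v x) = (\<lambda>x. T u x + T v x)"
  using linear_on_boundedD(2)[OF assms, of 1] by simp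

lemma linear_on_bounded_diff:
  assumes "linear_on_bounded T" "bounded_meas borel u" "bounded_meas borel v"
  shows "T (\<lambda>x. u x - v x) = (\<lambda>x. T u x - T v x)"
  using linear_on_boundedD(2)[OF assms(1,3,2), of "-1"] by (simp add: fun_eq_iff)

lemma linear_on_bounded_sum:
  assumes "linear_on_bounded T" "\<And>k. k \<in> K \<Longrightarrow> bounded_meas borel (v k)" "finite K"
  shows "T (\<lambda>x. \<Sum>k\<in>K. v k x * c k) = (\<lambda>x. \<Sum>k\<in>K. T (v k) x * c k)"
  using assms(3,2)
proof (induction K rule: finite_induct)
  case empty
  show ?case using linear_on_bounded_cmult[OF assms(1), of "\<lambda>_. 0" 0] by simp
next
  case (insert k K)
  have "T (\<lambda>x. c k * v k x + (\<Sum>k\<in>K. v k x * c k)) = (\<lambda>x. c k * T (v k) x + T (\<lambda>x. \<Sum>k\<in>K. v k x * c k) x)"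
    using insert by (intro linear_on_boundedD(2) assms(1) bounded_meas_intros) auto
  then show ?case using insert by (simp add: mult.commute)
qed

lemma linear_on_bounded_funpow:
  assumes "linear_on_bounded T"
  shows "linear_on_bounded (T ^^ n)"
proof (induction n)
  case (Suc n)
  show ?case
    unfolding linear_on_bounded_def
    using linear_on_boundedD[OF assms] linear_on_boundedD[OF Suc] by simp
qed (simp add: linear_on_bounded_def)

definition kernel_op :: "(real \<Rightarrow> real measure) \<Rightarrow> (real \<Rightarrow> real) \<Rightarrow> real \<Rightarrow> real" where
  "kernel_op P u x = (\<integral>y. u y \<partial>P x)"

locale markov_kernel =
  fixes P :: "real \<Rightarrow> real measure"
  assumes kernel: "P \<in> borel \<rightarrow>\<^sub>M prob_algebra borel"
begin

lemma sets_P [simp, measurable_cong]: "sets (P x) = sets borel"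
  using measurable_space[OF kernel, of x] by (simp add: space_prob_algebra)

lemma space_P [simp]: "space (P x) = UNIV"
  using sets_eq_imp_space_eq[OF sets_P] by simp

lemma prob_P: "prob_space (P x)"
  using measurable_space[OF kernel, of x] by (simp add: space_prob_algebra)

lemma kernel_sub [measurable]: "P \<in> borel \<rightarrow>\<^sub>M subprob_algebra borel"
  by (rule measurable_prob_algebraD[OF kernel])

lemma bounded_meas_P: "bounded_meas borel u \<Longrightarrow> bounded_meas (P x) u"
  by (simp add: bounded_meas_def measurable_cong_sets[OF sets_P refl])

lemma integrable_P: "bounded_meas borel u \<Longrightarrow> integrable (P x) u"
  using prob_P bounded_meas_P
  by (intro finite_measure.bounded_meas_integrable prob_space.finite_measure) auto

lemma kernel_op_bounded:
  assumes "bounded_meas borel u" "\<And>x. \<bar>u x\<bar> \<le> c"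
  shows "\<bar>kernel_op P u x\<bar> \<le> c"
  unfolding kernel_op_def
  using assms bounded_meas_P[OF assms(1)]
  by (intro prob_space.abs_integral_le prob_P) (auto simp: bounded_meas_def)

lemma linear_kernel_op: "linear_on_bounded (kernel_op P)"
  unfolding linear_on_bounded_def
proof (intro conjI allI impI)
  fix u :: "real \<Rightarrow> real" assume u: "bounded_meas borel u"
  then obtain c where c: "\<And>x. \<bar>u x\<bar> \<le> c" unfolding bounded_meas_def by blast
  have [measurable]: "u \<in> borel_measurable borel" using u by (rule bounded_meas_measurable)
  have "(\<lambda>x. integral\<^sup>L (P x) u) \<in> borel_measurable borel"
    by (rule measurable_compose[OF kernel_sub integral_measurable_subprob_algebra]) simp
  then show "bounded_meas borel (kernel_op P u)"
    by (intro bounded_measI[where c=c] kernel_op_bounded u c) (simp add: kernel_op_def[abs_def])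
next
  fix u v :: "real \<Rightarrow> real" and a assume "bounded_meas borel u" "bounded_meas borel v"
  then show "kernel_op P (\<lambda>x. a * u x + v x) = (\<lambda>x. a * kernel_op P u x + kernel_op P v x)"
    by (auto simp: kernel_op_def integrable_P fun_eq_iff)
qed

lemma kernel_op_const: "(kernel_op P ^^ n) (\<lambda>_. c) = (\<lambda>_. c)"
proof (induction n)
  case (Suc n)
  have "kernel_op P (\<lambda>_. c) = (\<lambda>_. c)"
    using prob_space.prob_space[OF prob_P] by (simp add: kernel_op_def fun_eq_iff)
  then show ?case using Suc by simp
qed simp

lemma kernel_op_pow_bounded:
  assumes "bounded_meas borel u" "\<And>x. \<bar>u x\<bar> \<le> c"
  shows "\<bar>(kernel_op P ^^ n) u x\<bar> \<le> c"
proof (induction n arbitrary: x)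
  case (Suc n)
  show ?case
    using linear_on_boundedD(1)[OF linear_on_bounded_funpow[OF linear_kernel_op] assms(1)] Suc
    by (auto intro: kernel_op_bounded)
qed (use assms in simp)

end

section \<open>Geometric mixing from regeneration\<close>

text \<open>
  A chain that regenerates: at \<open>x\<close>, with probability \<open>h x\<close>, the next state is drawn from \<open>\<nu>\<close>.
  The last assumption says that the probability of a regeneration at time \<open>n\<close> converges
  geometrically when the chain is started from \<open>\<nu>\<close>.
\<close>

locale regenerative_kernel = markov_kernel P for P +
  fixes h :: "real \<Rightarrow> real" and \<nu> \<mu> :: "real measure" and c \<rho> :: real
  assumes h_meas: "h \<in> borel_measurable borel" and h01: "\<And>x. 0 \<le> h x" "\<And>x. h x \<le> 1"
    and \<nu>: "prob_space \<nu>" and sets_\<nu> [simp, measurable_cong]: "sets \<nu> = sets borel"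
    and \<mu>: "prob_space \<mu>" and sets_\<mu> [simp, measurable_cong]: "sets \<mu> = sets borel"
    and minor: "\<And>x A. A \<in> sets borel \<Longrightarrow> h x * measure \<nu> A \<le> measure (P x) A"
    and invariant: "\<And>u. bounded_meas borel u \<Longrightarrow> (\<integral>x. kernel_op P u x \<partial>\<mu>) = (\<integral>x. u x \<partial>\<mu>)"
    and h_pos: "0 < (\<integral>x. h x \<partial>\<mu>)"
    and \<rho>: "0 < \<rho>" "\<rho> < 1"
    and renewal_rate: "\<And>n. \<bar>(\<integral>x. (kernel_op P ^^ n) h x \<partial>\<nu>) - (\<integral>x. h x \<partial>\<mu>)\<bar> \<le> c * \<rho> ^ Suc n"
begin

lemma bounded_h: "bounded_meas borel h"
  using h_meas h01 by (intro bounded_measI[where c=1]) auto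

lemma integrable_\<nu>: "bounded_meas borel u \<Longrightarrow> integrable \<nu> u"
  using \<nu> by (intro finite_measure.bounded_meas_integrable prob_space.finite_measure)
    (auto simp: bounded_meas_def measurable_cong_sets[OF sets_\<nu> refl])

lemma integrable_\<mu>: "bounded_meas borel u \<Longrightarrow> integrable \<mu> u"
  using \<mu> by (intro finite_measure.bounded_meas_integrable prob_space.finite_measure)
    (auto simp: bounded_meas_def measurable_cong_sets[OF sets_\<mu> refl])

text \<open>
  One step of the chain on the event that it does not regenerate. Accordingly \<open>surv n x\<close> below
  is the probability that the chain started at \<open>x\<close> has not regenerated during the first \<open>n\<close>
  steps.
\<close>

definition resid :: "(real \<Rightarrow> real) \<Rightarrow> real \<Rightarrow> real" where
  "resid u x = kernel_op P u x - h x * (\<integral>y. u y \<partial>\<nu>)"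

lemma linear_resid: "linear_on_bounded resid"
  unfolding linear_on_bounded_def resid_def[abs_def]
proof (intro conjI allI impI)
  fix u v :: "real \<Rightarrow> real" and a assume u: "bounded_meas borel u" and v: "bounded_meas borel v"
  have "(\<integral>y. a * u y + v y \<partial>\<nu>) = a * (\<integral>y. u y \<partial>\<nu>) + (\<integral>y. v y \<partial>\<nu>)"
    using integrable_\<nu>[OF u] integrable_\<nu>[OF v] by simp
  then show "(\<lambda>x. kernel_op P (\<lambda>x. a * u x + v x) x - h x * (\<integral>y. a * u y + v y \<partial>\<nu>)) =
      (\<lambda>x. a * (kernel_op P u x - h x * (\<integral>y. u y \<partial>\<nu>)) + (kernel_op P v x - h x * (\<integral>y. v y \<partial>\<nu>)))"
    unfolding linear_on_boundedD(2)[OF linear_kernel_op u v] by (simp add: algebra_simps)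
qed (intro bounded_meas_intros bounded_h linear_on_boundedD(1)[OF linear_kernel_op])

lemmas linear_resid_pow = linear_on_bounded_funpow[OF linear_resid]
lemmas linear_kernel_pow = linear_on_bounded_funpow[OF linear_kernel_op]

lemma resid_nonneg:
  assumes u: "bounded_meas borel u" and pos: "\<And>x. 0 \<le> u x"
  shows "0 \<le> resid u x"
proof -
  have [measurable]: "u \<in> borel_measurable borel" using u by (rule bounded_meas_measurable)
  interpret P: prob_space "P x" by (rule prob_P)
  interpret N: prob_space \<nu> by (rule \<nu>)
  have "scale_measure (ennreal (h x)) \<nu> \<le> P x"
    using minor[of _ x] h01
    by (subst le_measure)
       (auto simp: P.emeasure_eq_measure N.emeasure_eq_measure simp flip: ennreal_mult)
  then have "(\<integral>\<^sup>+y. ennreal (u y) \<partial>scale_measure (ennreal (h x)) \<nu>) \<le> (\<integral>\<^sup>+y. ennreal (u y) \<partial>P x)"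
    by (intro nn_integral_mono_measure) auto
  also have "(\<integral>\<^sup>+y. ennreal (u y) \<partial>scale_measure (ennreal (h x)) \<nu>) = ennreal (h x) * (\<integral>\<^sup>+y. ennreal (u y) \<partial>\<nu>)"
    by (intro nn_integral_scale_measure) measurable
  finally have "ennreal (h x * (\<integral>y. u y \<partial>\<nu>)) \<le> ennreal (\<integral>y. u y \<partial>P x)"
    using pos h01 by (simp add: nn_integral_eq_integral integrable_\<nu>[OF u] integrable_P[OF u] ennreal_mult)
  then show ?thesis
    using pos by (simp add: resid_def kernel_op_def ennreal_le_iff integral_nonneg_AE)
qed

lemma resid_pow_nonneg:
  assumes u: "bounded_meas borel u" and pos: "\<And>x. 0 \<le> u x"
  shows "0 \<le> (resid ^^ n) u x"
proof (induction n arbitrary: x)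
  case (Suc n)
  then show ?case by (auto intro!: resid_nonneg linear_on_boundedD(1)[OF linear_resid_pow u])
qed (use pos in simp)

lemma resid_pow_mono:
  assumes u: "bounded_meas borel u" "bounded_meas borel v" and le: "\<And>x. u x \<le> v x"
  shows "(resid ^^ n) u x \<le> (resid ^^ n) v x"
  using resid_pow_nonneg[of "\<lambda>x. v x - u x" n x] le u
  by (auto simp: linear_on_bounded_diff[OF linear_resid_pow u(2,1)])

definition surv :: "nat \<Rightarrow> real \<Rightarrow> real" where
  "surv n = (resid ^^ n) (\<lambda>_. 1)"

lemma bounded_surv: "bounded_meas borel (surv n)"
  unfolding surv_def by (intro linear_on_boundedD(1)[OF linear_resid_pow]) simp

lemma surv_nonneg: "0 \<le> surv n x"
  unfolding surv_def by (rule resid_pow_nonneg) auto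

lemma resid_pow_abs_le:
  assumes u: "bounded_meas borel u" and le: "\<And>x. \<bar>u x\<bar> \<le> b"
  shows "\<bar>(resid ^^ n) u x\<bar> \<le> b * surv n x"
proof -
  have b: "(resid ^^ n) (\<lambda>_. b') x = b' * surv n x" for b'
    using linear_on_bounded_cmult[OF linear_resid_pow, of "\<lambda>_. 1" n b'] by (simp add: surv_def)
  have "(resid ^^ n) u x \<le> (resid ^^ n) (\<lambda>_. b) x"
    using le by (intro resid_pow_mono u) (auto simp: abs_le_iff)
  moreover have "(resid ^^ n) (\<lambda>_. - b) x \<le> (resid ^^ n) u x"
    using le by (intro resid_pow_mono u) (auto simp: abs_le_iff minus_le_iff)
  ultimately show ?thesis unfolding b by (simp add: abs_le_iff)
qed

lemma bounded_resid_pow_h: "bounded_meas borel ((resid ^^ k) h)"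
  by (rule linear_on_boundedD(1)[OF linear_resid_pow bounded_h])

lemma first_regeneration:
  assumes v: "bounded_meas borel v"
  shows "(kernel_op P ^^ n) v x =
    (resid ^^ n) v x + (\<Sum>k<n. (resid ^^ k) h x * (\<integral>y. (kernel_op P ^^ (n - 1 - k)) v y \<partial>\<nu>))"
proof (induction n arbitrary: x)
  case (Suc n)
  define I where "I k = (\<integral>y. (kernel_op P ^^ k) v y \<partial>\<nu>)" for k
  have eq: "(kernel_op P ^^ n) v = (\<lambda>x. (resid ^^ n) v x + (\<Sum>k<n. (resid ^^ k) h x * I (n - 1 - k)))"
    using Suc by (auto simp: I_def)
  have "(kernel_op P ^^ Suc n) v x = resid ((kernel_op P ^^ n) v) x + h x * I n"
    by (simp add: resid_def I_def)
  also have "resid ((kernel_op P ^^ n) v) x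
      = (resid ^^ Suc n) v x + (\<Sum>k<n. (resid ^^ Suc k) h x * I (n - 1 - k))"
    unfolding eq
    by (subst linear_on_bounded_add[OF linear_resid])
       (auto intro!: linear_on_boundedD(1)[OF linear_resid_pow] v bounded_meas_intros bounded_h
         simp: linear_on_bounded_sum[OF linear_resid bounded_resid_pow_h])
  also have "\<dots> + h x * I n = (resid ^^ Suc n) v x + (\<Sum>k<Suc n. (resid ^^ k) h x * I (n - k))"
    unfolding sum.lessThan_Suc_shift by simp
  finally show ?case by (simp add: I_def)
qed simp

lemma last_regeneration:
  assumes v: "bounded_meas borel v"
  shows "(kernel_op P ^^ n) v x =
    (resid ^^ n) v x + (\<Sum>k<n. (kernel_op P ^^ k) h x * (\<integral>y. (resid ^^ (n - 1 - k)) v y \<partial>\<nu>))"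
  using v
proof (induction n arbitrary: v)
  case (Suc n)
  define I where "I = (\<integral>y. v y \<partial>\<nu>)"
  have rv: "bounded_meas borel (resid v)" by (rule linear_on_boundedD(1)[OF linear_resid Suc.prems])
  have eq: "kernel_op P v = (\<lambda>x. I * h x + resid v x)" by (auto simp: resid_def I_def)
  have "(kernel_op P ^^ Suc n) v x = (kernel_op P ^^ n) (kernel_op P v) x"
    by (simp add: funpow_swap1)
  also have "\<dots> = I * (kernel_op P ^^ n) h x + (kernel_op P ^^ n) (resid v) x"
    unfolding eq by (subst linear_on_boundedD(2)[OF linear_kernel_pow bounded_h rv]) simp
  also have "(kernel_op P ^^ n) (resid v) x = (resid ^^ Suc n) v x
      + (\<Sum>k<n. (kernel_op P ^^ k) h x * (\<integral>y. (resid ^^ (n - k)) v y \<partial>\<nu>))"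
  proof -
    have sw: "(resid ^^ k) (resid v) = (resid ^^ Suc k) v" for k by (simp add: funpow_swap1)
    have "(\<Sum>k<n. (kernel_op P ^^ k) h x * (\<integral>y. (resid ^^ (n - 1 - k)) (resid v) y \<partial>\<nu>))
        = (\<Sum>k<n. (kernel_op P ^^ k) h x * (\<integral>y. (resid ^^ (n - k)) v y \<partial>\<nu>))"
      unfolding sw by (intro sum.cong refl) (simp add: Suc_diff_Suc del: funpow.simps)
    then show ?thesis unfolding Suc.IH[OF rv] sw by simp
  qed
  finally show ?case by (simp add: I_def)
qed simp

text \<open>
  For the stationary chain the decomposition at the last regeneration has the constant weight
  \<open>\<integral> h d\<mu>\<close>. With \<open>u = 1\<close> it expresses the tail of the delay under \<open>\<mu>\<close> by the tails under \<open>\<nu>\<close>.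
\<close>

lemma stationary_regeneration:
  assumes u: "bounded_meas borel u"
  shows "(\<integral>x. (resid ^^ n) u x \<partial>\<mu>) = (\<integral>x. u x \<partial>\<mu>) - (\<integral>x. h x \<partial>\<mu>) * (\<Sum>k<n. \<integral>x. (resid ^^ k) u x \<partial>\<nu>)"
proof (induction n)
  case (Suc n)
  define v where "v = (resid ^^ n) u"
  have v: "bounded_meas borel v" unfolding v_def by (rule linear_on_boundedD(1)[OF linear_resid_pow u])
  have "(\<integral>x. (resid ^^ Suc n) u x \<partial>\<mu>) = (\<integral>x. kernel_op P v x - h x * (\<integral>y. v y \<partial>\<nu>) \<partial>\<mu>)"
    by (simp add: resid_def v_def)
  also have "\<dots> = (\<integral>x. v x \<partial>\<mu>) - (\<integral>x. h x \<partial>\<mu>) * (\<integral>y. v y \<partial>\<nu>)"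
    by (subst Bochner_Integration.integral_diff)
       (auto intro!: integrable_\<mu> bounded_meas_intros bounded_h linear_on_boundedD(1)[OF linear_kernel_op v]
         simp: invariant[OF v])
  finally show ?case using Suc by (simp add: v_def algebra_simps)
qed simp

end

lemma square_times_geometric:
  fixes \<theta> :: real
  assumes "0 < \<theta>" "\<theta> < 1"
  shows "\<exists>K \<theta>'. 0 < \<theta>' \<and> \<theta>' < 1 \<and> (\<forall>n. (real n + 1)\<^sup>2 * \<theta> ^ n \<le> K * \<theta>' ^ n)"
proof -
  define \<theta>' where "\<theta>' = (1 + \<theta>) / 2"
  have \<theta>': "0 < \<theta>'" "\<theta>' < 1" "\<theta> < \<theta>'" using assms by (auto simp: \<theta>'_def)
  obtain K where K: "\<And>n. real n ^ 2 * (\<theta> / \<theta>') ^ n \<le> K"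
    using power_times_geometric_bounded[of "\<theta> / \<theta>'" 2] assms \<theta>' by auto
  have "(real n + 1)\<^sup>2 * \<theta> ^ n \<le> (2 * K + 2) * \<theta>' ^ n" for n
  proof -
    have q: "(\<theta> / \<theta>') ^ n \<le> 1" using assms \<theta>' by (intro power_le_one) auto
    have "(real n + 1)\<^sup>2 * (\<theta> / \<theta>') ^ n \<le> (2 * (real n)\<^sup>2 + 2) * (\<theta> / \<theta>') ^ n"
      using sum_squares_bound[of "real n" 1] assms \<theta>'
      by (intro mult_right_mono) (auto simp: power2_sum)
    also have "\<dots> \<le> 2 * K + 2" using K[of n] q by (simp add: algebra_simps)
    finally have "(real n + 1)\<^sup>2 * (\<theta> / \<theta>') ^ n * \<theta>' ^ n \<le> (2 * K + 2) * \<theta>' ^ n"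
      using \<theta>' by (intro mult_right_mono) auto
    then show ?thesis using \<theta>' by (simp add: power_divide)
  qed
  then show ?thesis using \<theta>' by blast
qed

text \<open>
  Mixing in mean: the distance of the law at time \<open>n\<close> from \<open>\<mu>\<close> is bounded by a function of the
  starting point with geometrically small integral. Since this function is at most 2, all its
  moments are geometrically small as well.
\<close>

definition geometric_mixing :: "(real \<Rightarrow> real measure) \<Rightarrow> real measure \<Rightarrow> bool" where
  "geometric_mixing P \<mu> \<longleftrightarrow>
     (\<exists>T K \<theta>. 0 < \<theta> \<and> \<theta> < 1 \<and>
       (\<forall>n. T n \<in> borel_measurable borel) \<and> (\<forall>n x. 0 \<le> T n x \<and> T n x \<le> 2) \<and>
       (\<forall>n. (\<integral>x. T n x \<partial>\<mu>) \<le> K * \<theta> ^ n) \<and>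
       (\<forall>u n x. bounded_meas borel u \<longrightarrow> (\<forall>y. \<bar>u y\<bar> \<le> 1) \<longrightarrow>
          \<bar>(kernel_op P ^^ n) u x - (\<integral>y. u y \<partial>\<mu>)\<bar> \<le> T n x))"

context regenerative_kernel
begin

text \<open>
  The probability of a regeneration at time \<open>n\<close> for the chain started from \<open>\<nu>\<close>; time 0 counts
  as one, whence the shift of the index.
\<close>

definition renew :: "nat \<Rightarrow> real" where
  "renew n = (case n of 0 \<Rightarrow> 1 | Suc k \<Rightarrow> (\<integral>x. (kernel_op P ^^ k) h x \<partial>\<nu>))"

lemma integral_last_regeneration:
  assumes v: "bounded_meas borel v"
  shows "(\<integral>x. (kernel_op P ^^ n) v x \<partial>\<nu>) = (\<Sum>i\<le>n. renew i * (\<integral>x. (resid ^^ (n - i)) v x \<partial>\<nu>))"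
proof -
  note b = linear_on_boundedD(1)[OF linear_resid_pow] linear_on_boundedD(1)[OF linear_kernel_pow]
  have "(\<integral>x. (kernel_op P ^^ n) v x \<partial>\<nu>) = (\<integral>x. (resid ^^ n) v x \<partial>\<nu>)
     + (\<Sum>k<n. (\<integral>x. (kernel_op P ^^ k) h x \<partial>\<nu>) * (\<integral>y. (resid ^^ (n - 1 - k)) v y \<partial>\<nu>))"
    unfolding last_regeneration[OF v]
    by (subst Bochner_Integration.integral_add, (intro integrable_\<nu> b v bounded_h bounded_meas_intros)+,
        subst Bochner_Integration.integral_sum, intro integrable_\<nu> b v bounded_h bounded_meas_intros)
       simp
  also have "\<dots> = (\<Sum>i\<in>insert 0 (Suc ` {..<n}). renew i * (\<integral>x. (resid ^^ (n - i)) v x \<partial>\<nu>))"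
    by (subst sum.insert) (auto simp: renew_def sum.reindex)
  also have "insert 0 (Suc ` {..<n}) = {..n}"
    by (metis lessThan_Suc_atMost lessThan_Suc_eq_insert_0)
  finally show ?thesis .
qed

text \<open>
  For a centred test function \<open>v\<close> the decomposition at the last regeneration writes the mean of
  \<open>P\<^sup>j v\<close> under \<open>\<nu>\<close> as a convolution of \<open>renew\<close> with a sequence \<open>b\<close> whose total sum is zero by
  stationarity. Replacing \<open>renew\<close> by its limit leaves a tail of the sum of \<open>b\<close>, so that mean is
  at most \<open>\<delta> j\<close>, uniformly in \<open>v\<close>. The decomposition at the first regeneration then bounds
  \<open>P\<^sup>n v\<close> at \<open>x\<close> by \<open>S n x\<close>: either no regeneration has occurred, or \<open>\<delta>\<close> applies from the first
  one on.
\<close>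

lemma regeneration_imp_mixing: "geometric_mixing P \<mu>"
proof -
  interpret N: prob_space \<nu> by (rule \<nu>)
  interpret U: prob_space \<mu> by (rule \<mu>)
  define m where "m = (\<integral>x. h x \<partial>\<mu>)"
  define t where "t n = (\<integral>x. surv n x \<partial>\<nu>)" for n
  define p where "p n = (\<integral>x. surv n x \<partial>\<mu>)" for n
  have m: "0 < m" using h_pos by (simp add: m_def)
  have t0: "0 \<le> t n" for n unfolding t_def by (intro integral_nonneg_AE) (auto simp: surv_nonneg)
  have p0: "0 \<le> p n" for n unfolding p_def by (intro integral_nonneg_AE) (auto simp: surv_nonneg)
  have conv: "(\<Sum>i\<le>n. renew i * t (n - i)) = 1" for n
    using integral_last_regeneration[of "\<lambda>_. 1" n] N.prob_space
    by (simp add: kernel_op_const t_def surv_def)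
  have h_pow_nonneg: "0 \<le> (kernel_op P ^^ n) h x" for n x
  proof (induction n arbitrary: x)
    case (Suc n) then show ?case by (simp add: kernel_op_def integral_nonneg_AE)
  qed (simp add: h01)
  have ren0: "0 \<le> renew n" for n
    unfolding renew_def by (cases n) (auto intro!: integral_nonneg_AE h_pow_nonneg)
  define c' where "c' = max c (\<bar>1 - m\<bar>)"
  have c': "0 \<le> c'" by (simp add: c'_def)
  have ren: "\<bar>renew n - m\<bar> \<le> c' * \<rho> ^ n" for n
  proof (cases n)
    case 0 then show ?thesis by (simp add: renew_def c'_def)
  next
    case (Suc k)
    have "\<bar>renew n - m\<bar> \<le> c * \<rho> ^ n" using renewal_rate[of k] by (simp add: Suc renew_def m_def)
    also have "\<dots> \<le> c' * \<rho> ^ n" using \<rho> by (intro mult_right_mono) (auto simp: c'_def)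
    finally show ?thesis .
  qed
  note kendall = convolution_inverse_geometric[OF conv ren \<rho> m ren0 t0]
  obtain r C where r: "1 < r" and C: "\<And>n. t n \<le> C / r ^ n" using kendall(3) by blast
  have C0: "0 \<le> C" using C[of 0] t0[of 0] by simp
  define \<theta> where "\<theta> = max \<rho> (1 / r)"
  have \<theta>: "0 < \<theta>" "\<theta> < 1" using \<rho> r by (auto simp: \<theta>_def)
  have t: "t n \<le> C * \<theta> ^ n" for n
  proof -
    have "(1 / r) ^ n \<le> \<theta> ^ n" using r by (intro power_mono) (auto simp: \<theta>_def)
    then show ?thesis using C[of n] C0 mult_left_mono[of "(1 / r) ^ n" "\<theta> ^ n" C]
      by (simp add: divide_inverse power_inverse)
  qed
  have ren': "\<bar>renew n - m\<bar> \<le> c' * \<theta> ^ n" for n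
  proof -
    have "\<rho> ^ n \<le> \<theta> ^ n" using \<rho> by (intro power_mono) (auto simp: \<theta>_def)
    then show ?thesis using ren[of n] mult_left_mono[OF _ c'] by (meson order_trans)
  qed
  define D where "D = m * C / (1 - \<theta>)"
  have D0: "0 \<le> D" using m C0 \<theta> by (simp add: D_def)
  have p: "p n \<le> D * \<theta> ^ n" for n
  proof -
    have "p n = 1 - m * (\<Sum>k<n. t k)"
      using stationary_regeneration[of "\<lambda>_. 1" n] U.prob_space
      by (simp add: p_def t_def surv_def m_def)
    also have "\<dots> = m * (suminf t - (\<Sum>k<n. t k))" using kendall(2) by (simp add: right_diff_distrib)
    also have "\<dots> = m * (\<Sum>k. t (k + n))"
      using suminf_minus_initial_segment[OF kendall(1), of n] by simp
    also have "\<dots> \<le> m * (\<Sum>k. C * \<theta> ^ n * \<theta> ^ k)"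
      using m \<theta> t kendall(1)
      by (intro mult_left_mono suminf_le summable_ignore_initial_segment summable_mult summable_geometric)
         (auto simp: mult.assoc add.commute simp flip: power_add)
    also have "\<dots> = D * \<theta> ^ n" using \<theta> by (simp add: suminf_mult suminf_geometric D_def)
    finally show ?thesis .
  qed
  define \<delta> where "\<delta> j = (2 * D + 2 * c' * C) * ((real j + 1) * \<theta> ^ j)" for j
  have \<delta>0: "0 \<le> \<delta> j" for j using D0 c' C0 \<theta> by (simp add: \<delta>_def)
  have \<delta>: "\<bar>\<integral>x. (kernel_op P ^^ j) v x \<partial>\<nu>\<bar> \<le> \<delta> j"
    if v: "bounded_meas borel v" "\<And>x. \<bar>v x\<bar> \<le> 2" "(\<integral>x. v x \<partial>\<mu>) = 0" for v j
  proof -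
    note bv = linear_on_boundedD(1)[OF linear_resid_pow v(1)]
    define b where "b i = (\<integral>x. (resid ^^ i) v x \<partial>\<nu>)" for i
    have b: "\<bar>b i\<bar> \<le> 2 * t i" for i
    proof -
      have "\<bar>b i\<bar> \<le> (\<integral>x. \<bar>(resid ^^ i) v x\<bar> \<partial>\<nu>)" unfolding b_def by (rule integral_abs_bound)
      also have "\<dots> \<le> (\<integral>x. 2 * surv i x \<partial>\<nu>)"
        by (intro integral_mono integrable_\<nu> bounded_meas_intros bv bounded_surv resid_pow_abs_le v)
      finally show ?thesis by (simp add: t_def)
    qed
    have "\<bar>m * (\<Sum>k<n. b k)\<bar> \<le> 2 * p n" for n
    proof -
      have "m * (\<Sum>k<n. b k) = - (\<integral>x. (resid ^^ n) v x \<partial>\<mu>)"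
        using stationary_regeneration[OF v(1), of n] v(3) by (simp add: m_def b_def)
      then have "\<bar>m * (\<Sum>k<n. b k)\<bar> \<le> (\<integral>x. \<bar>(resid ^^ n) v x\<bar> \<partial>\<mu>)" 
        using integral_abs_bound[of \<mu> "(resid ^^ n) v"] by simp
      also have "\<dots> \<le> (\<integral>x. 2 * surv n x \<partial>\<mu>)"
        by (intro integral_mono integrable_\<mu> bounded_meas_intros bv bounded_surv resid_pow_abs_le v)
      finally show ?thesis by (simp add: p_def)
    qed
    moreover have "(\<Sum>k<Suc j. b k) = (\<Sum>i\<le>j. b (j - i))"
      by (rule sum.reindex_bij_witness[of _ "\<lambda>i. j - i" "\<lambda>i. j - i"]) auto
    ultimately have 1: "\<bar>m * (\<Sum>i\<le>j. b (j - i))\<bar> \<le> 2 * p (Suc j)" by metis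
    have 2: "\<bar>\<Sum>i\<le>j. (renew i - m) * b (j - i)\<bar> \<le> (\<Sum>i\<le>j. 2 * c' * C * \<theta> ^ j)"
    proof (rule order_trans[OF sum_abs sum_mono])
      fix i assume i: "i \<in> {..j}"
      have "\<bar>(renew i - m) * b (j - i)\<bar> \<le> (c' * \<theta> ^ i) * (2 * (C * \<theta> ^ (j - i)))"
        unfolding abs_mult using b[of "j - i"] t[of "j - i"] c' \<theta>
        by (intro mult_mono ren') auto
      also have "\<dots> = 2 * c' * C * \<theta> ^ j" using i by (simp flip: power_add)
      finally show "\<bar>(renew i - m) * b (j - i)\<bar> \<le> 2 * c' * C * \<theta> ^ j" .
    qed
    have split: "(\<integral>x. (kernel_op P ^^ j) v x \<partial>\<nu>) = m * (\<Sum>i\<le>j. b (j - i)) + (\<Sum>i\<le>j. (renew i - m) * b (j - i))"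
      unfolding integral_last_regeneration[OF v(1)] b_def[symmetric]
      by (simp add: sum_distrib_left left_diff_distrib sum_subtractf)
    have "\<bar>\<integral>x. (kernel_op P ^^ j) v x \<partial>\<nu>\<bar> \<le> 2 * p (Suc j) + (\<Sum>i\<le>j. 2 * c' * C * \<theta> ^ j)"
      unfolding split by (rule order_trans[OF abs_triangle_ineq add_mono[OF 1 2]])
    also have "(\<Sum>i\<le>j. 2 * c' * C * \<theta> ^ j) = (real j + 1) * (2 * c' * C * \<theta> ^ j)" by simp
    also have "2 * p (Suc j) + (real j + 1) * (2 * c' * C * \<theta> ^ j)
        \<le> 2 * (D * ((real j + 1) * \<theta> ^ j)) + (real j + 1) * (2 * c' * C * \<theta> ^ j)"
    proof -
      have "\<theta> ^ Suc j \<le> 1 * \<theta> ^ j" using \<theta> by (simp add: mult_left_le_one_le)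
      also have "\<dots> \<le> (real j + 1) * \<theta> ^ j" using \<theta> by (intro mult_right_mono) auto
      finally have "D * \<theta> ^ Suc j \<le> D * ((real j + 1) * \<theta> ^ j)" using D0 by (rule mult_left_mono)
      with p[of "Suc j"] have "p (Suc j) \<le> D * ((real j + 1) * \<theta> ^ j)" by (rule order_trans)
      then show ?thesis by (intro add_right_mono mult_left_mono) auto
    qed
    also have "\<dots> = \<delta> j" by (simp add: \<delta>_def algebra_simps)
    finally show ?thesis .
  qed
  define S where "S n x = 2 * surv n x + (\<Sum>k<n. (resid ^^ k) h x * \<delta> (n - 1 - k))" for n x
  have S_bm: "bounded_meas borel (S n)" for n
    unfolding S_def[abs_def] by (intro bounded_meas_intros bounded_surv bounded_resid_pow_h)
  have rh: "0 \<le> (resid ^^ k) h x" for k x by (rule resid_pow_nonneg[OF bounded_h h01(1)])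
  have S0: "0 \<le> S n x" for n x
    unfolding S_def by (intro add_nonneg_nonneg mult_nonneg_nonneg sum_nonneg surv_nonneg rh \<delta>0) simp
  define L where "L = 2 * D * (\<theta> + D + c' * C) / \<theta>"
  have L: "(\<integral>x. S n x \<partial>\<mu>) \<le> L * ((real n + 1)\<^sup>2 * \<theta> ^ n)" for n
  proof -
    have "(\<integral>x. S n x \<partial>\<mu>) = 2 * p n + (\<Sum>k<n. (\<integral>x. (resid ^^ k) h x \<partial>\<mu>) * \<delta> (n - 1 - k))"
      unfolding S_def p_def
      by (subst Bochner_Integration.integral_add,
          (intro integrable_\<mu> bounded_surv bounded_resid_pow_h bounded_meas_intros)+,
          subst Bochner_Integration.integral_sum,
          intro integrable_\<mu> bounded_resid_pow_h bounded_meas_intros) simp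
    also have "\<dots> \<le> 2 * (D * \<theta> ^ n) + (\<Sum>k<n. (D * \<theta> ^ k) * ((2 * D + 2 * c' * C) * ((real n + 1) * \<theta> ^ (n - 1 - k))))"
    proof (intro add_mono mult_left_mono p sum_mono mult_mono \<delta>0)
      fix k assume k: "k \<in> {..<n}"
      have "(\<integral>x. (resid ^^ k) h x \<partial>\<mu>) \<le> p k"
        unfolding p_def surv_def
        by (intro integral_mono integrable_\<mu> bounded_resid_pow_h resid_pow_mono bounded_h
            bounded_surv[unfolded surv_def]) (auto simp: h01)
      then show "(\<integral>x. (resid ^^ k) h x \<partial>\<mu>) \<le> D * \<theta> ^ k" using p[of k] by simp
      show "\<delta> (n - 1 - k) \<le> (2 * D + 2 * c' * C) * ((real n + 1) * \<theta> ^ (n - 1 - k))"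
        unfolding \<delta>_def using D0 c' C0 \<theta> by (intro mult_left_mono mult_right_mono) auto
    qed (use D0 \<theta> in auto)
    also have "(\<Sum>k<n. (D * \<theta> ^ k) * ((2 * D + 2 * c' * C) * ((real n + 1) * \<theta> ^ (n - 1 - k))))
        = (\<Sum>k<n. D * (2 * D + 2 * c' * C) * (real n + 1) * \<theta> ^ (n - 1))"
      by (intro sum.cong) (auto simp flip: power_add)
    also have "\<dots> = D * (2 * D + 2 * c' * C) * (real n * (real n + 1)) * (\<theta> ^ n / \<theta>)"
      using \<theta> by (cases n) auto
    also have "\<dots> \<le> D * (2 * D + 2 * c' * C) * (real n + 1)\<^sup>2 * (\<theta> ^ n / \<theta>)"
      using D0 c' C0 \<theta>
      by (intro mult_right_mono mult_left_mono) (auto simp: power2_eq_square)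
    also have "2 * (D * \<theta> ^ n) \<le> 2 * D * ((real n + 1)\<^sup>2 * \<theta> ^ n)"
      using D0 \<theta> mult_right_mono[of 1 "(real n + 1)\<^sup>2" "\<theta> ^ n"] by (simp add: mult_left_mono)
    finally show ?thesis using \<theta> by (simp add: L_def field_simps)
  qed
  have L0: "0 \<le> L" using D0 c' C0 \<theta> by (simp add: L_def)
  obtain K \<theta>' where K: "0 < \<theta>'" "\<theta>' < 1" "\<And>n. (real n + 1)\<^sup>2 * \<theta> ^ n \<le> K * \<theta>' ^ n"
    using square_times_geometric[OF \<theta>] by blast
  define T where "T n x = min 2 (S n x)" for n x
  have T_meas: "T n \<in> borel_measurable borel" for n
    using bounded_meas_measurable[OF S_bm[of n]] unfolding T_def[abs_def] by measurable
  have T_bm: "bounded_meas borel (T n)" for n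
  proof (rule bounded_measI[where c=2, OF T_meas])
    show "\<bar>T n x\<bar> \<le> 2" for x using S0[of n x] by (simp add: T_def abs_le_iff)
  qed
  have T_int: "(\<integral>x. T n x \<partial>\<mu>) \<le> (L * K) * \<theta>' ^ n" for n
  proof -
    have "(\<integral>x. T n x \<partial>\<mu>) \<le> (\<integral>x. S n x \<partial>\<mu>)"
      by (intro integral_mono integrable_\<mu> T_bm S_bm) (simp add: T_def)
    also have "\<dots> \<le> L * (K * \<theta>' ^ n)" using L[of n] mult_left_mono[OF K(3) L0] by (meson order_trans)
    finally show ?thesis by simp
  qed
  have mix: "\<bar>(kernel_op P ^^ n) u x - (\<integral>y. u y \<partial>\<mu>)\<bar> \<le> T n x"
    if u: "bounded_meas borel u" "\<And>y. \<bar>u y\<bar> \<le> 1" for u n x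
  proof -
    define a where "a = (\<integral>y. u y \<partial>\<mu>)"
    define v where "v y = u y - a" for y
    have a: "\<bar>a\<bar> \<le> 1"
      unfolding a_def using u bounded_meas_measurable[OF u(1)]
      by (intro U.abs_integral_le) (auto simp: measurable_cong_sets[OF sets_\<mu> refl])
    have v: "bounded_meas borel v" "\<And>x. \<bar>v x\<bar> \<le> 2" "(\<integral>x. v x \<partial>\<mu>) = 0"
    proof -
      show "bounded_meas borel v" unfolding v_def[abs_def] by (intro bounded_meas_intros u)
      show "\<bar>v x\<bar> \<le> 2" for x using u(2)[of x] a by (simp add: v_def abs_le_iff)
      show "(\<integral>x. v x \<partial>\<mu>) = 0"
        using integrable_\<mu>[OF u(1)] U.prob_space by (simp add: v_def a_def)
    qed
    have "(kernel_op P ^^ n) v x = (kernel_op P ^^ n) u x - a"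
      unfolding v_def[abs_def]
      by (subst linear_on_bounded_diff[OF linear_kernel_pow u(1)]) (auto simp: kernel_op_const)
    moreover have "\<bar>(kernel_op P ^^ n) v x\<bar> \<le> 2" by (rule kernel_op_pow_bounded[OF v(1,2)])
    moreover have "\<bar>(kernel_op P ^^ n) v x\<bar> \<le> S n x"
    proof -
      have "\<bar>(kernel_op P ^^ n) v x\<bar> \<le> \<bar>(resid ^^ n) v x\<bar>
          + (\<Sum>k<n. \<bar>(resid ^^ k) h x * (\<integral>y. (kernel_op P ^^ (n - 1 - k)) v y \<partial>\<nu>)\<bar>)"
        by (subst first_regeneration[OF v(1)])
           (rule order_trans[OF abs_triangle_ineq add_left_mono[OF sum_abs]])
      also have "\<dots> \<le> S n x"
        unfolding S_def abs_mult
        by (intro add_mono resid_pow_abs_le sum_mono mult_mono \<delta> v) (auto simp: rh)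
      finally show ?thesis .
    qed
    ultimately show ?thesis by (simp add: T_def a_def)
  qed
  have T02: "0 \<le> T n x \<and> T n x \<le> 2" for n x using S0[of n x] by (simp add: T_def)
  show ?thesis
    unfolding geometric_mixing_def
    by (rule exI[of _ T], rule exI[of _ "L * K"], rule exI[of _ \<theta>'])
       (use K(1,2) T_meas T_int mix T02 in blast)
qed

end


subsection \<open>Regeneration in a geometrically ergodic chain\<close>

context markov_kernel
begin

lemma kernel_pow_kernel: "kernel_pow P n \<in> borel \<rightarrow>\<^sub>M prob_algebra borel"
proof (induction n)
  case 0
  have "kernel_pow P 0 = return borel" by (simp add: fun_eq_iff)
  then show ?case by simp
next
  case (Suc n)
  have "kernel_pow P (Suc n) = (\<lambda>x. P x \<bind> kernel_pow P n)" by (simp add: fun_eq_iff)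
  then show ?case by (simp only: measurable_bind_prob_space[OF kernel Suc])
qed

lemma integral_bind_kernel:
  assumes "prob_space M" "Q \<in> borel \<rightarrow>\<^sub>M prob_algebra borel" "sets M = sets borel" "bounded_meas borel u"
  shows "(\<integral>x. u x \<partial>(M \<bind> Q)) = (\<integral>x. (\<integral>y. u y \<partial>Q x) \<partial>M)"
proof -
  obtain c where c: "\<And>x. \<bar>u x\<bar> \<le> c" using assms(4) unfolding bounded_meas_def by blast
  show ?thesis
  proof (rule integral_bind[where K=borel and B=c and B'=1])
    show "Q \<in> M \<rightarrow>\<^sub>M subprob_algebra borel"
      using measurable_prob_algebraD[OF assms(2)] by (simp add: measurable_cong_sets[OF assms(3) refl])
    have "prob_space (Q x)" for x
      using measurable_space[OF assms(2), of x] by (simp add: space_prob_algebra)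
    then show "AE x in M. emeasure (Q x) (space (Q x)) \<le> ennreal 1"
      by (simp add: prob_space.emeasure_space_1)
  qed (use assms c in \<open>auto simp: bounded_meas_measurable prob_space.finite_measure\<close>)
qed

lemma integral_kernel_pow:
  assumes "bounded_meas borel u"
  shows "(\<integral>y. u y \<partial>kernel_pow P n x) = (kernel_op P ^^ n) u x"
proof (induction n arbitrary: x)
  case 0
  show ?case using assms by (simp add: integral_return bounded_meas_measurable)
next
  case (Suc n)
  have "(\<integral>y. u y \<partial>kernel_pow P (Suc n) x) = (\<integral>z. (\<integral>y. u y \<partial>kernel_pow P n z) \<partial>P x)"
    by (simp add: integral_bind_kernel[OF prob_P kernel_pow_kernel sets_P assms])
  then show ?case by (simp add: Suc kernel_op_def)
qed

end

lemma abs_measure_diff_le_tv: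
  assumes "prob_space M" "prob_space N" "A \<in> sets borel"
  shows "\<bar>measure M A - measure N A\<bar> \<le> tv_norm_diff M N"
proof -
  let ?d = "\<lambda>A. measure M A - measure N A"
  have b: "\<bar>?d A\<bar> \<le> 1" for A
    using prob_space.prob_le_1[OF assms(1), of A] prob_space.prob_le_1[OF assms(2), of A]
      measure_nonneg[of M A] measure_nonneg[of N A]
    by linarith
  have bb: "- 1 \<le> ?d A" "?d A \<le> 1" for A using b[of A] by (auto simp: abs_le_iff)
  have bu: "bdd_above (?d ` sets borel)" and bl: "bdd_below (?d ` sets borel)"
    by (auto intro!: bdd_aboveI2[where M=1] bdd_belowI2[where m="-1"] bb)
  have "?d B \<le> (SUP A\<in>sets borel. ?d A)" "(INF A\<in>sets borel. ?d A) \<le> ?d B" if "B \<in> sets borel" for B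
    using that by (auto intro!: cSUP_upper cINF_lower bu bl)
  from this[OF assms(3)] this[of "{}"] show ?thesis
    unfolding tv_norm_diff_def by auto
qed

text \<open>
  Replacing \<open>h\<close> by a multiple of an indicator makes the renewal probabilities values of the
  iterated kernel at a fixed set, to which the total variation bound applies directly.
\<close>

lemma exists_level_set_pos:
  fixes h :: "'a \<Rightarrow> real"
  assumes "prob_space \<mu>" "h \<in> borel_measurable \<mu>" "\<And>x. h x \<le> 1" "0 < (\<integral>x. h x \<partial>\<mu>)"
  shows "\<exists>\<epsilon>>0. 0 < measure \<mu> {x\<in>space \<mu>. \<epsilon> \<le> h x}"
proof (rule ccontr)
  interpret prob_space \<mu> by fact
  assume no: "\<not> ?thesis"
  have z: "measure \<mu> {x\<in>space \<mu>. \<epsilon> \<le> h x} = 0" if "0 < \<epsilon>" for \<epsilon>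
  proof -
    have "\<not> 0 < measure \<mu> {x\<in>space \<mu>. \<epsilon> \<le> h x}" using no that by blast
    then show ?thesis by (simp add: zero_less_measure_iff)
  qed
  have "AE x in \<mu>. h x < 1 / real (Suc k)" for k
    using z[of "1 / real (Suc k)"] assms(2)
    by (subst AE_iff_measurable[OF _ refl]) (auto simp: emeasure_eq_measure not_less)
  then have "AE x in \<mu>. \<forall>k. h x < 1 / real (Suc k)" by (subst AE_all_countable) blast
  then have "AE x in \<mu>. h x \<le> 0"
  proof eventually_elim
    case (elim x)
    show ?case
    proof (rule ccontr)
      assume "\<not> h x \<le> 0"
      then obtain k where "inverse (real (Suc k)) < h x" using reals_Archimedean[of "h x"] by auto
      then show False using elim[rule_format, of k] by (simp add: inverse_eq_divide)
    qed
  qed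
  then have "AE x in \<mu>. 0 \<le> - h x" by eventually_elim simp
  then have "0 \<le> (\<integral>x. - h x \<partial>\<mu>)" by (rule integral_nonneg_AE)
  then show False using assms(4) by simp
qed

text \<open>
  The function \<open>V\<close> need not be measurable or integrable. The sets \<open>G k\<close> on which the
  convergence of the probabilities of the single set \<open>C\<close> has rate \<open>k \<rho>\<^sup>n\<close> are measurable and
  exhaust the line, because \<open>V\<close> is finite. Some \<open>G k\<close> is charged by the minorising measure, and
  conditioning that measure on it preserves the minorisation up to a factor and makes the rate
  uniform.
\<close>

lemma (in markov_kernel) exists_regenerative_structure:
  assumes st: "stationary_distribution P \<mu>" and mi: "minorization P \<mu>"
    and ge: "geometrically_ergodic P \<mu>"
  shows "\<exists>h \<nu> c \<rho>. regenerative_kernel P h \<nu> \<mu> c \<rho>"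
proof -
  have \<mu>: "prob_space \<mu>" "sets \<mu> = sets borel" "\<mu> \<bind> P = \<mu>"
    using st by (auto simp: stationary_distribution_def)
  interpret U: prob_space \<mu> by fact
  note [measurable_cong] = \<mu>(2)
  have sp: "space \<mu> = UNIV" using sets_eq_imp_space_eq[OF \<mu>(2)] by simp
  obtain h \<nu> where h: "h \<in> borel_measurable borel" "\<And>x. 0 \<le> h x" "\<And>x. h x \<le> 1" "0 < (\<integral>x. h x \<partial>\<mu>)"
    and \<nu>: "prob_space \<nu>" "sets \<nu> = sets borel"
    and minor: "\<And>x A. A \<in> sets borel \<Longrightarrow> h x * measure \<nu> A \<le> measure (P x) A"
    using mi unfolding minorization_def by blast
  interpret N: prob_space \<nu> by fact
  note [measurable_cong] = \<nu>(2)
  have sp\<nu>: "space \<nu> = UNIV" using sets_eq_imp_space_eq[OF \<nu>(2)] by simp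
  obtain V \<rho> where \<rho>: "0 < \<rho>" "\<rho> < 1" and V: "\<And>x. 0 < V x"
    and erg: "\<And>n x. 1 \<le> n \<Longrightarrow> tv_norm_diff (kernel_pow P n x) \<mu> \<le> V x * \<rho> ^ n"
    using ge unfolding geometrically_ergodic_def by blast
  have hm: "h \<in> borel_measurable \<mu>" using h(1) by simp
  obtain \<epsilon> where \<epsilon>: "0 < \<epsilon>" "0 < measure \<mu> {x\<in>space \<mu>. \<epsilon> \<le> h x}"
    using exists_level_set_pos[OF \<mu>(1) hm h(3,4)] by blast
  define C where "C = {x. \<epsilon> \<le> h x}"
  have C[measurable]: "C \<in> sets borel" using h(1) unfolding C_def by measurable
  have \<mu>C: "0 < measure \<mu> C" using \<epsilon> by (simp add: C_def sp)
  have "C \<noteq> {}" using \<mu>C by auto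
  then have \<epsilon>1: "\<epsilon> \<le> 1" using h(3) by (auto simp: C_def intro: order_trans)
  let ?I = "indicator C :: real \<Rightarrow> real"
  have bI: "bounded_meas borel ?I" by (rule bounded_meas_indicator[OF C])
  note bn = linear_on_boundedD(1)[OF linear_on_bounded_funpow[OF linear_kernel_op] bI]
  define r where "r n x = \<bar>(kernel_op P ^^ n) ?I x - measure \<mu> C\<bar>" for n x
  have r_meas: "r n \<in> borel_measurable borel" for n
    unfolding r_def[abs_def] using bounded_meas_measurable[OF bn[of n]] by measurable
  have rV: "r n x \<le> V x * \<rho> ^ n" if "1 \<le> n" for n x
  proof -
    have pk: "prob_space (kernel_pow P n x)" "sets (kernel_pow P n x) = sets borel"
      using measurable_space[OF kernel_pow_kernel, of x n] by (auto simp: space_prob_algebra)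
    have "(kernel_op P ^^ n) ?I x = measure (kernel_pow P n x) C"
      using C pk(2) sets_eq_imp_space_eq[OF pk(2)] by (simp flip: integral_kernel_pow[OF bI])
    then show ?thesis
      unfolding r_def using abs_measure_diff_le_tv[OF pk(1) \<mu>(1) C] erg[OF that, of x] by simp
  qed
  define G where "G k = {x. \<forall>n\<ge>1. r n x \<le> real k * \<rho> ^ n}" for k :: nat
  have G[measurable]: "G k \<in> sets borel" for k
    unfolding G_def using r_meas by measurable
  have "(\<Union>k. G k) = UNIV"
  proof (intro set_eqI iffI UNIV_I)
    fix x
    obtain k where k: "V x \<le> real k" using real_arch_simple by blast
    have "x \<in> G k" unfolding G_def
    proof (intro CollectI allI impI)
      fix n :: nat assume "1 \<le> n"
      then have "r n x \<le> V x * \<rho> ^ n" by (rule rV)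
      also have "\<dots> \<le> real k * \<rho> ^ n" using k \<rho> by (intro mult_right_mono) auto
      finally show "r n x \<le> real k * \<rho> ^ n" .
    qed
    then show "x \<in> (\<Union>k. G k)" by blast
  qed
  moreover have "\<exists>k. 0 < measure \<nu> (G k)"
  proof (rule ccontr)
    assume "\<nexists>k. 0 < measure \<nu> (G k)"
    then have "emeasure \<nu> (G k) = 0" for k
      by (simp add: N.emeasure_eq_measure) (meson measure_nonneg less_eq_real_def not_less)
    then have "emeasure \<nu> (\<Union>k. G k) = 0" by (intro emeasure_UN_eq_0) auto
    then show False using N.emeasure_space_1 \<open>(\<Union>k. G k) = UNIV\<close> sp\<nu> by simp
  qed
  then obtain k where k: "0 < measure \<nu> (G k)" by blast
  define \<nu>' where "\<nu>' = uniform_measure \<nu> (G k)"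
  have Gk: "emeasure \<nu> (G k) \<noteq> 0" "emeasure \<nu> (G k) \<noteq> \<infinity>"
    using k by (auto simp: N.emeasure_eq_measure)
  have \<nu>': "prob_space \<nu>'" "sets \<nu>' = sets borel"
    using Gk \<nu>(2) by (auto simp: \<nu>'_def intro!: prob_space_uniform_measure)
  interpret N': prob_space \<nu>' by fact
  note [measurable_cong] = \<nu>'(2)
  define s where "s = \<epsilon> * measure \<nu> (G k)"
  have s: "0 < s" "s \<le> 1"
    using \<epsilon> \<epsilon>1 k N.prob_le_1[of "G k"] by (auto simp: s_def mult_le_one)
  define h' where "h' x = s * ?I x" for x
  have pow_h': "(kernel_op P ^^ n) h' = (\<lambda>x. s * (kernel_op P ^^ n) ?I x)" for n
    unfolding h'_def[abs_def]
    by (rule linear_on_bounded_cmult[OF linear_on_bounded_funpow[OF linear_kernel_op] bI])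
  have iI: "(\<integral>x. h' x \<partial>\<mu>) = s * measure \<mu> C" using C by (simp add: h'_def sp)
  have int\<nu>': "integrable \<nu>' u" if "bounded_meas borel u" for u
    using that by (intro N'.bounded_meas_integrable) (auto simp: bounded_meas_def measurable_cong_sets[OF \<nu>'(2) refl])
  have rate: "\<bar>(\<integral>x. (kernel_op P ^^ n) h' x \<partial>\<nu>') - (\<integral>x. h' x \<partial>\<mu>)\<bar> \<le> (max (real k) 1 / \<rho>) * \<rho> ^ Suc n" for n
  proof -
    have "(\<integral>x. (kernel_op P ^^ n) h' x \<partial>\<nu>') - (\<integral>x. h' x \<partial>\<mu>)
        = s * (\<integral>x. (kernel_op P ^^ n) ?I x - measure \<mu> C \<partial>\<nu>')"
      using N'.prob_space int\<nu>'[OF bn[of n]] by (simp add: pow_h' iI right_diff_distrib)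
    also have "\<bar>\<dots>\<bar> \<le> 1 * (\<integral>x. r n x \<partial>\<nu>')"
      unfolding abs_mult r_def using s by (intro mult_mono integral_abs_bound) auto
    also have "(\<integral>x. r n x \<partial>\<nu>') \<le> max (real k) 1 * \<rho> ^ n"
    proof (rule N'.integral_le_const)
      show "integrable \<nu>' (r n)"
        unfolding r_def[abs_def] by (intro int\<nu>' bounded_meas_intros bn)
      show "AE x in \<nu>'. r n x \<le> max (real k) 1 * \<rho> ^ n"
        unfolding \<nu>'_def
      proof (rule AE_uniform_measureI)
        show "AE x in \<nu>. x \<in> G k \<longrightarrow> r n x \<le> max (real k) 1 * \<rho> ^ n"
        proof (rule AE_I2, rule impI)
          fix x assume x: "x \<in> G k"
          show "r n x \<le> max (real k) 1 * \<rho> ^ n"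
          proof (cases "n = 0")
            case True
            have "r 0 x \<le> 1" using U.prob_le_1[of C] measure_nonneg[of \<mu> C]
              by (cases "x \<in> C") (simp_all add: r_def)
            then show ?thesis using True by simp
          next
            case False
            then have "r n x \<le> real k * \<rho> ^ n" using x by (auto simp: G_def)
            also have "\<dots> \<le> max (real k) 1 * \<rho> ^ n" using \<rho> by (intro mult_right_mono) auto
            finally show ?thesis .
          qed
        qed
      qed (use \<nu>(2) in simp)
    qed
    finally show ?thesis using \<rho> by simp
  qed
  have "regenerative_kernel P h' \<nu>' \<mu> (max (real k) 1 / \<rho>) \<rho>"
  proof (unfold_locales)
    show "h' \<in> borel_measurable borel" unfolding h'_def[abs_def] by measurable
    show "0 \<le> h' x" "h' x \<le> 1" for x using s by (auto simp: h'_def indicator_def)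
    show "h' x * measure \<nu>' A \<le> measure (P x) A" if A: "A \<in> sets borel" for x A
    proof (cases "x \<in> C")
      case True
      have "h' x * measure \<nu>' A = \<epsilon> * measure \<nu> (G k \<inter> A)"
        using True k A \<nu>(2) Gk by (simp add: h'_def s_def \<nu>'_def measure_uniform_measure)
      also have "\<dots> \<le> h x * measure \<nu> A"
        using True A \<epsilon> h(2) \<nu>(2) by (intro mult_mono N.finite_measure_mono) (auto simp: C_def)
      finally show ?thesis using minor[OF A, of x] by simp
    qed (simp add: h'_def)
    show "(\<integral>x. kernel_op P u x \<partial>\<mu>) = (\<integral>x. u x \<partial>\<mu>)" if "bounded_meas borel u" for u
      using integral_bind_kernel[OF \<mu>(1) kernel \<mu>(2) that] by (simp add: \<mu>(3) kernel_op_def)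
    show "0 < (\<integral>x. h' x \<partial>\<mu>)" using s \<mu>C by (simp add: iI)
  qed (rule rate \<rho> \<nu>'(2) \<mu>(2))+
  then show ?thesis by blast
qed

lemma (in markov_kernel) geometrically_ergodic_imp_mixing:
  assumes "stationary_distribution P \<mu>" "minorization P \<mu>" "geometrically_ergodic P \<mu>"
  shows "geometric_mixing P \<mu>"
  using exists_regenerative_structure[OF assms] regenerative_kernel.regeneration_imp_mixing by blast

section \<open>One step of a stationary chain\<close>

text \<open>
  The conditional expectation of \<open>\<psi>(X\<^sub>n, X\<^sub>n\<^sub>+\<^sub>1)\<close> as a function of \<open>X\<^sub>n\<close>.
\<close>

definition step_op :: "(real \<Rightarrow> real measure) \<Rightarrow> (real \<times> real \<Rightarrow> real) \<Rightarrow> real \<Rightarrow> real" where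
  "step_op P \<psi> x = (\<integral>y. \<psi> (x, y) \<partial>P x)"

lemma bounded_meas_Pair:
  "bounded_meas borel \<psi> \<Longrightarrow> bounded_meas borel (\<lambda>y. \<psi> (x, y))" for \<psi> :: "real \<times> real \<Rightarrow> real"
  by (rule bounded_meas_comp[where N=borel]) (simp_all add: borel_prod[symmetric])

lemma (in markov_kernel) bounded_step_op:
  assumes \<psi>: "bounded_meas borel \<psi>"
  shows "bounded_meas borel (step_op P \<psi>)"
proof -
  obtain c where c: "\<And>z. \<bar>\<psi> z\<bar> \<le> c" using \<psi> unfolding bounded_meas_def by blast
  have [measurable]: "\<psi> \<in> borel_measurable borel" using \<psi> by (rule bounded_meas_measurable)
  show ?thesis
  proof (rule bounded_measI[where c=c])
    have "(\<lambda>x. distr (P x) (borel \<Otimes>\<^sub>M borel) (Pair x)) \<in> borel \<rightarrow>\<^sub>M subprob_algebra (borel \<Otimes>\<^sub>M borel)"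
      by (rule measurable_distr2[where M=borel, OF _ kernel_sub]) measurable
    from measurable_compose[OF this integral_measurable_subprob_algebra, of \<psi>]
    have "(\<lambda>x. \<integral>z. \<psi> z \<partial>distr (P x) (borel \<Otimes>\<^sub>M borel) (Pair x)) \<in> borel_measurable borel"
      by (simp add: borel_prod)
    also have "(\<lambda>x. \<integral>z. \<psi> z \<partial>distr (P x) (borel \<Otimes>\<^sub>M borel) (Pair x)) = step_op P \<psi>"
      unfolding step_op_def by (intro ext integral_distr) (simp_all add: borel_prod)
    finally show "step_op P \<psi> \<in> borel_measurable borel" .
    show "\<bar>step_op P \<psi> x\<bar> \<le> c" for x
      using kernel_op_bounded[OF bounded_meas_Pair[OF \<psi>], of x c x] c
      by (simp add: kernel_op_def step_op_def)
  qed
qed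

locale stationary_chain = prob_space M + markov_kernel P
  for M :: "'w measure" and P :: "real \<Rightarrow> real measure" +
  fixes X :: "nat \<Rightarrow> 'w \<Rightarrow> real" and \<mu> :: "real measure"
  assumes X_meas [measurable]: "\<And>n. X n \<in> borel_measurable M"
    and cond_law: "\<And>n A. A \<in> sets borel \<Longrightarrow>
      AE \<omega> in M. real_cond_exp M (past M X n) (\<lambda>\<omega>'. indicator A (X (Suc n) \<omega>')) \<omega>
          = measure (P (X n \<omega>)) A"
    and initial_law: "distr M borel (X 0) = \<mu>"
    and invariant_law: "\<mu> \<bind> P = \<mu>"
begin

lemma space_past [simp]: "space (past M X n) = space M"
  by (simp add: past_def)

lemma subalgebra_past: "subalgebra M (past M X n)"
  unfolding subalgebra_def past_def
  by (intro conjI sets_image_in_sets) (auto intro!: measurable_restrict)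

lemma X_past: "i \<le> n \<Longrightarrow> X i \<in> borel_measurable (past M X n)"
proof -
  assume i: "i \<le> n"
  have "(\<lambda>\<omega>. \<lambda>i\<in>{..n}. X i \<omega>) \<in> past M X n \<rightarrow>\<^sub>M PiM {..n} (\<lambda>_. borel)"
    unfolding past_def by (intro measurable_vimage_algebra1) (auto simp: space_PiM)
  from measurable_compose[OF this measurable_component_singleton[of i]] i
  show ?thesis by simp
qed

lemma bounded_meas_past: "bounded_meas (past M X n) Z \<Longrightarrow> bounded_meas M Z"
  using measurable_from_subalg[OF subalgebra_past] unfolding bounded_meas_def by blast

lemma fin_sub: "finite_measure_subalgebra M (past M X n)"
  by (simp add: finite_measure_subalgebra_def finite_measure_subalgebra_axioms_def
      subalgebra_past finite_measure_axioms)

lemma bounded_pair: 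
  assumes "bounded_meas borel \<psi>"
  shows "bounded_meas M (\<lambda>\<omega>. \<psi> (X i \<omega>, X j \<omega>))"
  by (rule bounded_meas_comp[OF assms]) (simp add: borel_prod[symmetric])

lemma bounded_pair_past:
  assumes "bounded_meas borel \<psi>" "i \<le> n" "j \<le> n"
  shows "bounded_meas (past M X n) (\<lambda>\<omega>. \<psi> (X i \<omega>, X j \<omega>))"
  using X_past[OF assms(2)] X_past[OF assms(3)]
  by (intro bounded_meas_comp[OF assms(1)]) (simp add: borel_prod[symmetric])

lemma bounded_X:
  assumes "bounded_meas borel u" shows "bounded_meas M (\<lambda>\<omega>. u (X i \<omega>))"
  by (rule bounded_meas_comp[OF assms]) simp

lemma one_step_rectangle:
  assumes "A \<in> sets (past M X n)" "B \<in> sets borel"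
  shows "(\<integral>\<omega>. indicator A \<omega> * indicator B (X (Suc n) \<omega>) \<partial>M)
    = (\<integral>\<omega>. indicator A \<omega> * measure (P (X n \<omega>)) B \<partial>M)"
proof -
  interpret finite_measure_subalgebra M "past M X n" by (rule fin_sub)
  have A: "A \<in> sets M" using assms(1) subalg by (auto simp: subalgebra_def)
  let ?g = "\<lambda>\<omega>. indicator B (X (Suc n) \<omega>) :: real"
  have g[measurable]: "?g \<in> borel_measurable M" using assms(2) by measurable
  have "bounded_meas M (\<lambda>\<omega>. indicator A \<omega> * ?g \<omega>)"
    using A by (intro bounded_meas_mult bounded_meas_indicator bounded_measI[where c=1] g) auto
  then have "(\<integral>\<omega>. indicator A \<omega> * ?g \<omega> \<partial>M) = (\<integral>\<omega>. indicator A \<omega> * real_cond_exp M (past M X n) ?g \<omega> \<partial>M)"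
    using assms(1)
    by (intro real_cond_exp_intg(2)[symmetric] bounded_meas_integrable borel_measurable_indicator g)
  also have "\<dots> = (\<integral>\<omega>. indicator A \<omega> * measure (P (X n \<omega>)) B \<partial>M)"
  proof (rule integral_cong_AE)
    show "(\<lambda>\<omega>. indicator A \<omega> * measure (P (X n \<omega>)) B) \<in> borel_measurable M"
      using A assms(2) measurable_compose[OF X_meas[of n] measurable_compose[OF kernel_sub measurable_measure_subprob_algebra[OF assms(2)]]]
      by measurable
    show "AE \<omega> in M. indicator A \<omega> * real_cond_exp M (past M X n) ?g \<omega> = indicator A \<omega> * measure (P (X n \<omega>)) B"
      using cond_law[OF assms(2), of n] by eventually_elim simp
    show "(\<lambda>\<omega>. indicator A \<omega> * real_cond_exp M (past M X n) ?g \<omega>) \<in> borel_measurable M"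
      using A by (intro borel_measurable_times borel_measurable_indicator borel_measurable_cond_exp2)
  qed
  finally show ?thesis .
qed

text \<open>
  The chain is given by the conditional law of \<open>X\<^sub>n\<^sub>+\<^sub>1\<close> only. Restricted to an event of the
  past, the law of the pair agrees with the one built from the kernel on rectangles, hence on
  all Borel sets of the plane.
\<close>

lemma one_step_indicator:
  assumes A: "A \<in> sets (past M X n)" and \<psi>: "bounded_meas borel \<psi>"
  shows "(\<integral>\<omega>. indicator A \<omega> * \<psi> (X n \<omega>, X (Suc n) \<omega>) \<partial>M) = (\<integral>\<omega>. indicator A \<omega> * step_op P \<psi> (X n \<omega>) \<partial>M)"
proof -
  have AM[measurable]: "A \<in> sets M" using A subalgebra_past by (auto simp: subalgebra_def)
  define D where "D = density M (indicator A)"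
  have [measurable_cong, simp]: "sets D = sets M" by (simp add: D_def)
  have [simp]: "space D = space M" by (simp add: D_def)
  have emD: "emeasure D S = emeasure M (A \<inter> S)" if "S \<in> sets M" for S
    unfolding D_def using AM that by (subst emeasure_density) (auto simp: indicator_inter_arith[symmetric])
  have intD: "(\<integral>\<omega>. f \<omega> \<partial>D) = (\<integral>\<omega>. indicator A \<omega> * f \<omega> \<partial>M)"
    if f: "bounded_meas M f" for f :: "'w \<Rightarrow> real"
  proof -
    have "D = density M (\<lambda>\<omega>. ennreal (indicator A \<omega>))" by (simp add: D_def ennreal_indicator)
    then show ?thesis
      using integral_real_density[of "indicator A" M f] f by (simp add: bounded_meas_measurable)
  qed
  have finD: "finite_measure D"
    by (rule finite_measureI) (use AM in \<open>simp add: emD\<close>)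
  define J where "J = distr D borel (\<lambda>\<omega>. (X n \<omega>, X (Suc n) \<omega>))"
  define k where "k x = distr (P x) borel (Pair x)" for x :: real
  have pair_meas: "Pair x \<in> P x \<rightarrow>\<^sub>M borel" for x :: real
    by (simp add: borel_prod[symmetric])
  have kk: "k \<in> borel \<rightarrow>\<^sub>M subprob_algebra borel"
    unfolding k_def[abs_def] by (rule measurable_distr2[where M=borel, OF _ kernel_sub]) (simp add: borel_prod)
  have kX[measurable]: "(\<lambda>\<omega>. k (X n \<omega>)) \<in> D \<rightarrow>\<^sub>M subprob_algebra borel"
    by (rule measurable_compose[OF _ kk]) simp
  have neD: "space D \<noteq> {}" using not_empty by simp
  define J' where "J' = D \<bind> (\<lambda>\<omega>. k (X n \<omega>))"
  have XX[measurable]: "(\<lambda>\<omega>. (X n \<omega>, X (Suc n) \<omega>)) \<in> D \<rightarrow>\<^sub>M borel" by (simp add: borel_prod[symmetric])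
  have sJ': "sets J' = sets borel" unfolding J'_def
    by (rule sets_bind[OF _ neD]) (simp add: k_def)
  have "J = J'"
  proof (rule measure_eqI_generator_eq[where E="{a \<times> b |a b. a \<in> sets borel \<and> b \<in> sets borel}" and \<Omega>=UNIV and A="\<lambda>_. UNIV"])
    show "Int_stable {a \<times> b |a b. a \<in> sets (borel :: real measure) \<and> b \<in> sets (borel :: real measure)}"
      using Int_stable_pair_measure_generator[of "borel :: real measure" "borel :: real measure"] .
    have sb: "sets (borel :: (real \<times> real) measure) = sigma_sets UNIV {a \<times> b |a b. a \<in> sets borel \<and> b \<in> sets borel}"
      unfolding borel_prod[symmetric] sets_pair_measure by simp
    show "sets J = sigma_sets UNIV {a \<times> b |a b. a \<in> sets borel \<and> b \<in> sets borel}"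
      "sets J' = sigma_sets UNIV {a \<times> b |a b. a \<in> sets borel \<and> b \<in> sets borel}"
      using sb sJ' by (auto simp: J_def)
    show "emeasure J U = emeasure J' U" if U: "U \<in> {a \<times> b |a b. a \<in> sets borel \<and> b \<in> sets borel}" for U
    proof -
      obtain a b where ab: "U = a \<times> b" "a \<in> sets borel" "b \<in> sets borel" using U by blast
      note [measurable] = ab(2,3)
      have Ub: "U \<in> sets borel" using ab by (simp add: borel_prod[symmetric])
      define A' where "A' = A \<inter> (X n -` a \<inter> space M)"
      have A'p: "A' \<in> sets (past M X n)"
        unfolding A'_def using A measurable_sets[OF X_past[of n n] ab(2)] by auto
      have A'[measurable]: "A' \<in> sets M" using A'p subalgebra_past by (auto simp: subalgebra_def)
      have mP[measurable]: "(\<lambda>\<omega>. measure (P (X n \<omega>)) b) \<in> borel_measurable M"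
        by (rule measurable_compose[OF X_meas[of n] measurable_compose[OF kernel_sub measurable_measure_subprob_algebra[OF ab(3)]]])
      have le1: "measure (P x) b \<le> 1" for x by (rule prob_space.prob_le_1[OF prob_P])
      have "emeasure J U = emeasure M (A' \<inter> (X (Suc n) -` b \<inter> space M))"
        unfolding J_def using Ub XX
        by (subst emeasure_distr) (auto simp: emD measurable_sets[OF XX] A'_def ab intro!: arg_cong[where f="emeasure M"])
      also have "\<dots> = ennreal (\<integral>\<omega>. indicator A' \<omega> * indicator b (X (Suc n) \<omega>) \<partial>M)"
      proof -
        have "(\<integral>\<omega>. indicator A' \<omega> * indicator b (X (Suc n) \<omega>) \<partial>M :: real)
          = (\<integral>\<omega>. indicator (A' \<inter> (X (Suc n) -` b \<inter> space M)) \<omega> \<partial>M)"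
          by (intro Bochner_Integration.integral_cong) (auto simp: indicator_def)
        then show ?thesis by (simp add: emeasure_eq_measure)
      qed
      also have "\<dots> = ennreal (\<integral>\<omega>. indicator A' \<omega> * measure (P (X n \<omega>)) b \<partial>M)"
        by (simp only: one_step_rectangle[OF A'p ab(3)])
      also have "\<dots> = (\<integral>\<^sup>+\<omega>. ennreal (indicator A' \<omega> * measure (P (X n \<omega>)) b) \<partial>M)"
        using le1 by (intro nn_integral_eq_integral[symmetric] integrable_const_bound[where B=1])
          (auto simp: indicator_def)
      also have "\<dots> = (\<integral>\<^sup>+\<omega>. indicator A \<omega> * emeasure (k (X n \<omega>)) U \<partial>M)"
      proof (intro nn_integral_cong)
        fix \<omega> assume \<omega>: "\<omega> \<in> space M"
        have "emeasure (k (X n \<omega>)) U = emeasure (P (X n \<omega>)) (Pair (X n \<omega>) -` U)"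
          unfolding k_def using Ub pair_meas by (subst emeasure_distr) auto
        also have "\<dots> = ennreal (indicator a (X n \<omega>) * measure (P (X n \<omega>)) b)"
          using prob_space.finite_measure[OF prob_P]
          by (auto simp: ab finite_measure.emeasure_eq_measure indicator_def)
        finally show "ennreal (indicator A' \<omega> * measure (P (X n \<omega>)) b) = indicator A \<omega> * emeasure (k (X n \<omega>)) U"
          using \<omega> by (auto simp: A'_def indicator_def)
      qed
      also have "\<dots> = (\<integral>\<^sup>+\<omega>. emeasure (k (X n \<omega>)) U \<partial>D)"
      proof -
        have "(\<lambda>\<omega>. emeasure (k (X n \<omega>)) U) \<in> borel_measurable M"
          by (rule measurable_emeasure_kernel[OF measurable_compose[OF X_meas kk] Ub])
        then show ?thesis unfolding D_def using AM by (subst nn_integral_density) auto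
      qed
      also have "\<dots> = emeasure J' U"
        unfolding J'_def by (rule emeasure_bind[OF neD kX Ub, symmetric])
      finally show ?thesis .
    qed
    show "emeasure J (UNIV :: (real \<times> real) set) \<noteq> \<infinity>"
      unfolding J_def using finD by (subst emeasure_distr) (auto simp: finite_measure.emeasure_finite)
  qed (auto intro!: exI[of _ UNIV])
  moreover have "(\<integral>z. \<psi> z \<partial>J) = (\<integral>\<omega>. indicator A \<omega> * \<psi> (X n \<omega>, X (Suc n) \<omega>) \<partial>M)"
    unfolding J_def intD[OF bounded_pair[OF \<psi>], symmetric]
    by (rule integral_distr[OF XX bounded_meas_measurable[OF \<psi>]])
  moreover have "(\<integral>z. \<psi> z \<partial>J') = (\<integral>\<omega>. (\<integral>z. \<psi> z \<partial>k (X n \<omega>)) \<partial>D)"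
  proof -
    obtain c where c: "\<And>x. \<bar>\<psi> x\<bar> \<le> c" using \<psi> unfolding bounded_meas_def by blast
    show ?thesis unfolding J'_def
    proof (rule integral_bind[where K=borel and B=c and B'=1])
      have "prob_space (k x)" for x
        unfolding k_def by (rule prob_space.prob_space_distr[OF prob_P pair_meas])
      then show "AE x in D. emeasure (k (X n x)) (space (k (X n x))) \<le> ennreal 1"
        by (simp add: prob_space.emeasure_space_1)
    qed (use c \<psi> finD in \<open>auto simp: bounded_meas_measurable\<close>)
  qed
  moreover have "(\<integral>z. \<psi> z \<partial>k x) = step_op P \<psi> x" for x
    unfolding k_def step_op_def by (rule integral_distr[OF pair_meas bounded_meas_measurable[OF \<psi>]])
  moreover have "(\<integral>\<omega>. step_op P \<psi> (X n \<omega>) \<partial>D) = (\<integral>\<omega>. indicator A \<omega> * step_op P \<psi> (X n \<omega>) \<partial>M)"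
    by (rule intD[OF bounded_X[OF bounded_step_op[OF \<psi>]]])
  ultimately show ?thesis by simp
qed

lemma one_step:
  assumes Z: "bounded_meas (past M X n) Z" and \<psi>: "bounded_meas borel \<psi>"
  shows "(\<integral>\<omega>. Z \<omega> * \<psi> (X n \<omega>, X (Suc n) \<omega>) \<partial>M) = (\<integral>\<omega>. Z \<omega> * step_op P \<psi> (X n \<omega>) \<partial>M)"
proof -
  interpret S: finite_measure_subalgebra M "past M X n" by (rule fin_sub)
  let ?f = "\<lambda>\<omega>. \<psi> (X n \<omega>, X (Suc n) \<omega>)"
  have "AE \<omega> in M. real_cond_exp M (past M X n) ?f \<omega> = step_op P \<psi> (X n \<omega>)"
  proof (rule S.real_cond_exp_charact)
    show "(\<integral>\<omega>\<in>A. ?f \<omega> \<partial>M) = (\<integral>\<omega>\<in>A. step_op P \<psi> (X n \<omega>) \<partial>M)" if "A \<in> sets (past M X n)" for A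
      using one_step_indicator[OF that \<psi>] by (simp add: set_lebesgue_integral_def)
    show "integrable M ?f" by (intro bounded_meas_integrable bounded_pair \<psi>)
    show "integrable M (\<lambda>\<omega>. step_op P \<psi> (X n \<omega>))" by (intro bounded_meas_integrable bounded_X bounded_step_op \<psi>)
    show "(\<lambda>\<omega>. step_op P \<psi> (X n \<omega>)) \<in> borel_measurable (past M X n)"
      by (rule measurable_compose[OF X_past bounded_meas_measurable[OF bounded_step_op[OF \<psi>]]]) simp
  qed
  note ae = this
  have "(\<integral>\<omega>. Z \<omega> * ?f \<omega> \<partial>M) = (\<integral>\<omega>. Z \<omega> * real_cond_exp M (past M X n) ?f \<omega> \<partial>M)"
    by (intro S.real_cond_exp_intg(2)[symmetric] bounded_meas_integrable bounded_meas_intros bounded_meas_measurable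
        bounded_pair \<psi> bounded_meas_past[OF Z] Z)
  also have "\<dots> = (\<integral>\<omega>. Z \<omega> * step_op P \<psi> (X n \<omega>) \<partial>M)"
  proof (rule integral_cong_AE)
    show "AE \<omega> in M. Z \<omega> * real_cond_exp M (past M X n) ?f \<omega> = Z \<omega> * step_op P \<psi> (X n \<omega>)"
      using ae by eventually_elim simp
    show "(\<lambda>\<omega>. Z \<omega> * real_cond_exp M (past M X n) ?f \<omega>) \<in> borel_measurable M"
      using bounded_meas_measurable[OF bounded_meas_past[OF Z]] by measurable
    show "(\<lambda>\<omega>. Z \<omega> * step_op P \<psi> (X n \<omega>)) \<in> borel_measurable M"
      by (intro bounded_meas_measurable bounded_meas_intros bounded_meas_past[OF Z] bounded_X bounded_step_op \<psi>)
  qed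
  finally show ?thesis .
qed

lemma prob_\<mu>: "prob_space \<mu>"
  unfolding initial_law[symmetric] by (rule prob_space_distr) simp

lemma sets_law: "sets \<mu> = sets borel"
  unfolding initial_law[symmetric] by simp

lemma expectation_X:
  assumes u: "bounded_meas borel u"
  shows "(\<integral>\<omega>. u (X n \<omega>) \<partial>M) = (\<integral>x. u x \<partial>\<mu>)"
  using u
proof (induction n arbitrary: u)
  case 0
  then show ?case unfolding initial_law[symmetric]
    by (subst integral_distr) (auto simp: bounded_meas_measurable)
next
  case (Suc n)
  define \<psi> where "\<psi> = (\<lambda>z :: real \<times> real. u (snd z))"
  have \<psi>: "bounded_meas borel \<psi>"
    unfolding \<psi>_def by (rule bounded_meas_comp[OF Suc.prems]) (simp add: borel_prod[symmetric])
  have k: "bounded_meas borel (kernel_op P u)" by (rule linear_on_boundedD(1)[OF linear_kernel_op Suc.prems])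
  have "(\<integral>\<omega>. u (X (Suc n) \<omega>) \<partial>M) = (\<integral>\<omega>. kernel_op P u (X n \<omega>) \<partial>M)"
    using one_step[of n "\<lambda>_. 1" \<psi>] \<psi> by (simp add: \<psi>_def step_op_def[abs_def] kernel_op_def[abs_def])
  also have "\<dots> = (\<integral>x. kernel_op P u x \<partial>\<mu>)" by (rule Suc.IH[OF k])
  also have "\<dots> = (\<integral>x. u x \<partial>\<mu>)"
    using integral_bind_kernel[OF prob_\<mu> kernel sets_law Suc.prems] by (simp add: invariant_law kernel_op_def)
  finally show ?case .
qed

end

section \<open>Eighth moments of martingales driven by the chain\<close>

context stationary_chain
begin

text \<open>
  The sums start at \<open>X 1\<close>, as the contrast does. The first \<open>k\<close> terms depend on
  \<open>X 1, \<dots>, X (k + 1)\<close>, so \<open>path_sum \<psi> k\<close> is known when the term of index \<open>k\<close> is about to be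
  added.
\<close>

definition path_sum :: "(real \<times> real \<Rightarrow> real) \<Rightarrow> nat \<Rightarrow> 'w \<Rightarrow> real" where
  "path_sum \<psi> k \<omega> = (\<Sum>i<k. \<psi> (X (Suc i) \<omega>, X (Suc (Suc i)) \<omega>))"

lemma path_sum_0 [simp]: "path_sum \<psi> 0 \<omega> = 0"
  and path_sum_Suc: "path_sum \<psi> (Suc k) \<omega> = path_sum \<psi> k \<omega> + \<psi> (X (Suc k) \<omega>, X (Suc (Suc k)) \<omega>)"
  by (simp_all add: path_sum_def)

lemma bounded_path_sum_past:
  "bounded_meas borel \<psi> \<Longrightarrow> bounded_meas (past M X (Suc k)) (path_sum \<psi> k)"
  unfolding path_sum_def[abs_def] by (intro bounded_meas_intros bounded_pair_past) auto

lemma bounded_path_sum: "bounded_meas borel \<psi> \<Longrightarrow> bounded_meas M (path_sum \<psi> k)"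
  by (rule bounded_meas_past[OF bounded_path_sum_past])

lemma martingale_difference_orthogonal:
  assumes "bounded_meas (past M X n) Z" "bounded_meas borel \<psi>" "\<And>x. step_op P \<psi> x = 0"
  shows "(\<integral>\<omega>. Z \<omega> * \<psi> (X n \<omega>, X (Suc n) \<omega>) \<partial>M) = 0"
  using one_step[OF assms(1,2)] assms(3) by simp

lemma martingale_eighth_moment:
  fixes \<psi> :: "'i \<Rightarrow> real \<times> real \<Rightarrow> real"
  assumes bm: "\<And>j. j \<in> I \<Longrightarrow> bounded_meas borel (\<psi> j)"
    and mart: "\<And>j x. j \<in> I \<Longrightarrow> step_op P (\<psi> j) x = 0"
    and V: "\<And>i. (\<integral>\<omega>. (\<Sum>j\<in>I. (\<psi> j (X (Suc i) \<omega>, X (Suc (Suc i)) \<omega>))\<^sup>2) ^ 4 \<partial>M) \<le> V"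
    and k: "k \<le> N"
  shows "(\<integral>\<omega>. (\<Sum>j\<in>I. (path_sum (\<psi> j) k \<omega>)\<^sup>2) ^ 4 \<partial>M) \<le> 1000 * exp 500 * (real N ^ 4 * V)"
proof -
  define d where "d j i \<omega> = \<psi> j (X (Suc i) \<omega>, X (Suc (Suc i)) \<omega>)" for j i \<omega>
  define S where "S j = path_sum (\<psi> j)" for j
  define A where "A i \<omega> = (\<Sum>j\<in>I. (S j i \<omega>)\<^sup>2)" for i \<omega>
  define c where "c i \<omega> = (\<Sum>j\<in>I. S j i \<omega> * d j i \<omega>)" for i \<omega>
  define e where "e i \<omega> = (\<Sum>j\<in>I. (d j i \<omega>)\<^sup>2)" for i \<omega>
  have bd: "bounded_meas M (d j i)" if "j \<in> I" for j i
    unfolding d_def[abs_def] by (rule bounded_pair[OF bm[OF that]])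
  have bS: "bounded_meas M (S j i)" if "j \<in> I" for j i
    unfolding S_def by (rule bounded_path_sum[OF bm[OF that]])
  have bSp: "bounded_meas (past M X (Suc i)) (S j i)" if "j \<in> I" for j i
    unfolding S_def by (rule bounded_path_sum_past[OF bm[OF that]])
  have V0: "0 \<le> V"
    by (rule order_trans[OF _ V[of 0]]) (intro integral_nonneg_AE AE_I2 zero_le_power sum_nonneg zero_le_power2)
  have "(\<integral>\<omega>. A k \<omega> ^ 4 \<partial>M) \<le> 500 * exp 500 * (real N ^ 4 * V + real N * V)"
  proof (rule moment_growth[where c=c and e=e and v=e])
    show "A 0 \<omega> = 0" for \<omega> by (simp add: A_def S_def)
    show "A (Suc i) \<omega> = A i \<omega> + 2 * c i \<omega> + e i \<omega>" for i \<omega>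
      unfolding A_def c_def e_def d_def S_def path_sum_Suc
      by (simp add: power2_sum sum.distrib sum_distrib_left algebra_simps)
    show "0 \<le> A i \<omega>" "0 \<le> e i \<omega>" "0 \<le> e i \<omega>" for i \<omega>
      by (auto simp: A_def e_def intro!: sum_nonneg)
    show "(c i \<omega>)\<^sup>2 \<le> A i \<omega> * e i \<omega>" for i \<omega>
      unfolding c_def A_def e_def by (rule Cauchy_Schwarz_ineq_sum)
    show "bounded_meas M (A i)" "bounded_meas M (c i)" "bounded_meas M (e i)" "bounded_meas M (e i)" for i
      unfolding A_def[abs_def] c_def[abs_def] e_def[abs_def]
      by (intro bounded_meas_intros bS bd; assumption)+
    show "(\<integral>\<omega>. A i \<omega> ^ 3 * c i \<omega> \<partial>M) = 0" for i
    proof -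
      have "(\<integral>\<omega>. A i \<omega> ^ 3 * c i \<omega> \<partial>M) = (\<integral>\<omega>. (\<Sum>j\<in>I. (A i \<omega> ^ 3 * S j i \<omega>) * d j i \<omega>) \<partial>M)"
        by (simp add: c_def sum_distrib_left mult.assoc)
      also have "\<dots> = (\<Sum>j\<in>I. \<integral>\<omega>. (A i \<omega> ^ 3 * S j i \<omega>) * d j i \<omega> \<partial>M)"
        unfolding A_def
        by (intro Bochner_Integration.integral_sum bounded_meas_integrable bounded_meas_intros bS bd)
      also have "\<dots> = 0"
        unfolding d_def A_def
        by (intro sum.neutral ballI martingale_difference_orthogonal bounded_meas_intros bSp bm mart)
      finally show ?thesis .
    qed
    show "(\<integral>\<omega>. e i \<omega> ^ 4 \<partial>M) \<le> V" "(\<integral>\<omega>. e i \<omega> ^ 4 \<partial>M) \<le> V" for i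
      using V[of i] by (simp_all add: e_def d_def)
  qed (use V0 k in auto)
  also have "\<dots> \<le> 500 * exp 500 * (2 * (real N ^ 4 * V))"
  proof -
    have "real N \<le> real N ^ 4"
    proof (cases "N = 0")
      case False
      then show ?thesis using power_increasing[of 1 4 "real N"] by simp
    qed simp
    then have "real N * V \<le> real N ^ 4 * V" using V0 by (rule mult_right_mono)
    then show ?thesis unfolding mult_2 by (intro mult_left_mono add_left_mono) auto
  qed
  finally show ?thesis by (simp add: A_def S_def)
qed

text \<open>
  The martingale \<open>Q\<close> in the expansion of the squared length of a vector martingale, obtained by
  pairing each increment with the sum of the preceding ones.
\<close>

definition square_mart :: "'i set \<Rightarrow> ('i \<Rightarrow> real \<times> real \<Rightarrow> real) \<Rightarrow> nat \<Rightarrow> 'w \<Rightarrow> real" where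
  "square_mart I \<psi> k \<omega> =
     (\<Sum>i<k. \<Sum>j\<in>I. path_sum (\<psi> j) i \<omega> * \<psi> j (X (Suc i) \<omega>, X (Suc (Suc i)) \<omega>))"

lemma square_path_sum:
  "(\<Sum>j\<in>I. (path_sum (\<psi> j) k \<omega>)\<^sup>2) = 2 * square_mart I \<psi> k \<omega>
     + (\<Sum>i<k. \<Sum>j\<in>I. (\<psi> j (X (Suc i) \<omega>, X (Suc (Suc i)) \<omega>))\<^sup>2)"
proof (induction k)
  case (Suc k)
  then show ?case
    by (simp add: square_mart_def path_sum_Suc power2_sum sum.distrib sum_distrib_left algebra_simps)
qed (simp add: square_mart_def)

lemma bounded_square_mart_past:
  assumes "\<And>j. j \<in> I \<Longrightarrow> bounded_meas borel (\<psi> j)"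
  shows "bounded_meas (past M X (Suc k)) (square_mart I \<psi> k)"
proof -
  have "bounded_meas (past M X (Suc k)) (path_sum (\<psi> j) i)" if "j \<in> I" "i < k" for i j
    unfolding path_sum_def[abs_def] using that assms
    by (intro bounded_meas_intros bounded_pair_past) auto
  then show ?thesis
    unfolding square_mart_def[abs_def]
    by (intro bounded_meas_intros bounded_pair_past assms) auto
qed

text \<open>
  The increment of \<open>Q\<close> is a linear form in \<open>\<psi>\<close> with coefficients from the past, so its
  conditional second moment is at most \<open>w\<close> times the squared length of the vector martingale.
  Taking this as \<open>v\<close> in \<open>moment_growth\<close> replaces half of the factors \<open>b\<close> in the leading term by
  the weak variance \<open>w\<close>; the power \<open>b\<^sup>8\<close> occurs with \<open>N\<^sup>5\<close> only.
\<close>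

lemma square_mart_eighth_moment:
  fixes \<psi> :: "'i \<Rightarrow> real \<times> real \<Rightarrow> real"
  assumes bm: "\<And>j. j \<in> I \<Longrightarrow> bounded_meas borel (\<psi> j)"
    and mart: "\<And>j x. j \<in> I \<Longrightarrow> step_op P (\<psi> j) x = 0"
    and bd: "\<And>z. (\<Sum>j\<in>I. (\<psi> j z)\<^sup>2) \<le> b"
    and cond: "\<And>t x. step_op P (\<lambda>z. (\<Sum>j\<in>I. t j * \<psi> j z)\<^sup>2) x \<le> w * (\<Sum>j\<in>I. (t j)\<^sup>2)"
    and w: "0 \<le> w"
  shows "(\<integral>\<omega>. (square_mart I \<psi> N \<omega>) ^ 8 \<partial>M)
    \<le> 500 * exp 500 * (1000 * exp 500) * (real N ^ 8 * w ^ 4 * b ^ 4 + real N ^ 5 * b ^ 8)"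
proof -
  define d where "d j i \<omega> = \<psi> j (X (Suc i) \<omega>, X (Suc (Suc i)) \<omega>)" for j i \<omega>
  define S where "S j = path_sum (\<psi> j)" for j
  define Q where "Q = square_mart I \<psi>"
  define x where "x i \<omega> = (\<Sum>j\<in>I. S j i \<omega> * d j i \<omega>)" for i \<omega>
  define R where "R i \<omega> = (\<Sum>j\<in>I. (S j i \<omega>)\<^sup>2)" for i \<omega>
  have b: "0 \<le> b" by (rule order_trans[OF _ bd[of undefined]]) (auto intro: sum_nonneg)
  have bmd: "bounded_meas M (d j i)" if "j \<in> I" for j i
    unfolding d_def[abs_def] by (rule bounded_pair[OF bm[OF that]])
  have bS: "bounded_meas M (S j i)" if "j \<in> I" for j i
    unfolding S_def by (rule bounded_path_sum[OF bm[OF that]])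
  have bSp: "bounded_meas (past M X (Suc i)) (S j i)" if "j \<in> I" for j i
    unfolding S_def by (rule bounded_path_sum_past[OF bm[OF that]])
  have bQp: "bounded_meas (past M X (Suc i)) (Q i)" for i
    unfolding Q_def by (rule bounded_square_mart_past[OF bm])
  have bQ: "bounded_meas M (Q i)" for i by (rule bounded_meas_past[OF bQp])
  have bx: "bounded_meas M (x i)" for i
    unfolding x_def[abs_def] by (intro bounded_meas_intros bS bmd)
  have bR: "bounded_meas M (R i)" for i
    unfolding R_def[abs_def] by (intro bounded_meas_intros bS)
  have R0: "0 \<le> R i \<omega>" for i \<omega> by (simp add: R_def sum_nonneg)
  define C where "C = 1000 * exp (500::real)"
  have R4: "(\<integral>\<omega>. R i \<omega> ^ 4 \<partial>M) \<le> C * (real N ^ 4 * b ^ 4)" if "i < N" for i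
    unfolding R_def S_def C_def
  proof (rule martingale_eighth_moment[OF bm mart])
    show "(\<integral>\<omega>. (\<Sum>j\<in>I. (\<psi> j (X (Suc i) \<omega>, X (Suc (Suc i)) \<omega>))\<^sup>2) ^ 4 \<partial>M) \<le> b ^ 4" for i
      by (intro integral_le_const bounded_meas_integrable bounded_meas_intros bounded_pair bm AE_I2
          power_mono bd sum_nonneg; simp)
  qed (use that in auto)
  have "(\<integral>\<omega>. ((Q N \<omega>)\<^sup>2) ^ 4 \<partial>M)
    \<le> 500 * exp 500 * (real N ^ 4 * (w ^ 4 * (C * (real N ^ 4 * b ^ 4))) + real N * (b ^ 4 * (C * (real N ^ 4 * b ^ 4))))"
  proof (rule moment_growth[where A="\<lambda>i \<omega>. (Q i \<omega>)\<^sup>2" and c="\<lambda>i \<omega>. Q i \<omega> * x i \<omega>" and e="\<lambda>i \<omega>. (x i \<omega>)\<^sup>2" and v="\<lambda>i \<omega>. w * R i \<omega>"])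
    show "(Q 0 \<omega>)\<^sup>2 = 0" for \<omega> by (simp add: Q_def square_mart_def)
    show "(Q (Suc i) \<omega>)\<^sup>2 = (Q i \<omega>)\<^sup>2 + 2 * (Q i \<omega> * x i \<omega>) + (x i \<omega>)\<^sup>2" for i \<omega>
    proof -
      have "Q (Suc i) \<omega> = Q i \<omega> + x i \<omega>"
        by (simp add: Q_def square_mart_def x_def S_def d_def)
      then show ?thesis by (simp add: power2_sum)
    qed
    show "(Q i \<omega> * x i \<omega>)\<^sup>2 \<le> (Q i \<omega>)\<^sup>2 * (x i \<omega>)\<^sup>2" for i \<omega> by (simp add: power_mult_distrib)
    show "bounded_meas M (\<lambda>\<omega>. (Q i \<omega>)\<^sup>2)" "bounded_meas M (\<lambda>\<omega>. Q i \<omega> * x i \<omega>)"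
      "bounded_meas M (\<lambda>\<omega>. (x i \<omega>)\<^sup>2)" "bounded_meas M (\<lambda>\<omega>. w * R i \<omega>)" for i
      by (intro bounded_meas_intros bQ bx bR)+
    show "(\<integral>\<omega>. (Q i \<omega>)\<^sup>2 ^ 3 * (Q i \<omega> * x i \<omega>) \<partial>M) = 0" for i
    proof -
      have "(\<integral>\<omega>. (Q i \<omega>)\<^sup>2 ^ 3 * (Q i \<omega> * x i \<omega>) \<partial>M)
          = (\<integral>\<omega>. (\<Sum>j\<in>I. ((Q i \<omega>)\<^sup>2 ^ 3 * Q i \<omega> * S j i \<omega>) * d j i \<omega>) \<partial>M)"
        by (simp add: x_def sum_distrib_left mult.assoc)
      also have "\<dots> = (\<Sum>j\<in>I. \<integral>\<omega>. ((Q i \<omega>)\<^sup>2 ^ 3 * Q i \<omega> * S j i \<omega>) * d j i \<omega> \<partial>M)"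
        by (intro Bochner_Integration.integral_sum bounded_meas_integrable bounded_meas_intros bS bmd bQ)
      also have "\<dots> = 0"
        unfolding d_def
        by (intro sum.neutral ballI martingale_difference_orthogonal bounded_meas_intros bSp bQp bm mart)
      finally show ?thesis .
    qed
    show "(\<integral>\<omega>. (Q i \<omega>)\<^sup>2 ^ 3 * (x i \<omega>)\<^sup>2 \<partial>M) \<le> (\<integral>\<omega>. (Q i \<omega>)\<^sup>2 ^ 3 * (w * R i \<omega>) \<partial>M)" for i
    proof -
      define q where "q \<omega> = (Q i \<omega>)\<^sup>2 ^ 3" for \<omega>
      define G where "G j l = step_op P (\<lambda>z. \<psi> j z * \<psi> l z)" for j l
      have bq: "bounded_meas M q" and bqp: "bounded_meas (past M X (Suc i)) q"
        unfolding q_def[abs_def] by (intro bounded_meas_intros bQ bQp)+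
      have bpp: "bounded_meas borel (\<lambda>z. \<psi> j z * \<psi> l z)" if "j \<in> I" "l \<in> I" for j l
        using that by (intro bounded_meas_intros bm)
      have bG: "bounded_meas M (\<lambda>\<omega>. G j l (X (Suc i) \<omega>))" if "j \<in> I" "l \<in> I" for j l
        unfolding G_def by (intro bounded_X bounded_step_op bpp that)
      have "(\<integral>\<omega>. q \<omega> * (x i \<omega>)\<^sup>2 \<partial>M)
          = (\<integral>\<omega>. (\<Sum>j\<in>I. \<Sum>l\<in>I. (q \<omega> * S j i \<omega> * S l i \<omega>) * (d j i \<omega> * d l i \<omega>)) \<partial>M)"
        by (intro Bochner_Integration.integral_cong refl)
           (simp add: x_def power2_eq_square sum_product sum_distrib_left mult_ac)
      also have "\<dots> = (\<Sum>j\<in>I. \<Sum>l\<in>I. \<integral>\<omega>. (q \<omega> * S j i \<omega> * S l i \<omega>) * (d j i \<omega> * d l i \<omega>) \<partial>M)"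
        by (subst Bochner_Integration.integral_sum,
            (intro bounded_meas_integrable bounded_meas_intros bS bmd bq)[1], assumption+,
            intro sum.cong refl Bochner_Integration.integral_sum bounded_meas_integrable bounded_meas_intros bS bmd bq)
      also have "\<dots> = (\<Sum>j\<in>I. \<Sum>l\<in>I. \<integral>\<omega>. (q \<omega> * S j i \<omega> * S l i \<omega>) * G j l (X (Suc i) \<omega>) \<partial>M)"
        unfolding d_def G_def
        by (intro sum.cong refl one_step bounded_meas_intros bqp bSp bpp) 
      also have "\<dots> = (\<integral>\<omega>. (\<Sum>j\<in>I. \<Sum>l\<in>I. (q \<omega> * S j i \<omega> * S l i \<omega>) * G j l (X (Suc i) \<omega>)) \<partial>M)"
        by (subst Bochner_Integration.integral_sum,
            (intro bounded_meas_integrable bounded_meas_intros bS bG bq)[1], assumption+,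
            intro sum.cong refl Bochner_Integration.integral_sum[symmetric] bounded_meas_integrable bounded_meas_intros bS bG bq)
      also have "\<dots> \<le> (\<integral>\<omega>. q \<omega> * (w * R i \<omega>) \<partial>M)"
      proof (intro integral_mono bounded_meas_integrable bounded_meas_intros bS bG bq bR)
        fix \<omega>
        define t where "t j = S j i \<omega>" for j
        let ?x = "X (Suc i) \<omega>"
        have "(\<Sum>j\<in>I. \<Sum>l\<in>I. (q \<omega> * S j i \<omega> * S l i \<omega>) * G j l ?x) = q \<omega> * (\<Sum>j\<in>I. \<Sum>l\<in>I. t j * t l * G j l ?x)"
          by (simp add: t_def sum_distrib_left mult_ac)
        also have "(\<Sum>j\<in>I. \<Sum>l\<in>I. t j * t l * G j l ?x) = step_op P (\<lambda>z. (\<Sum>j\<in>I. t j * \<psi> j z)\<^sup>2) ?x"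
        proof -
          have "step_op P (\<lambda>z. (\<Sum>j\<in>I. t j * \<psi> j z)\<^sup>2) ?x
              = (\<integral>y. (\<Sum>j\<in>I. \<Sum>l\<in>I. t j * t l * (\<psi> j (?x, y) * \<psi> l (?x, y))) \<partial>P ?x)"
            unfolding step_op_def
            by (intro Bochner_Integration.integral_cong refl)
               (simp add: power2_eq_square sum_product mult_ac)
          also have "\<dots> = (\<Sum>j\<in>I. \<Sum>l\<in>I. t j * t l * G j l ?x)"
            unfolding G_def step_op_def
            by (subst Bochner_Integration.integral_sum,
                (intro integrable_P bounded_meas_intros bounded_meas_Pair bm)[1], assumption+,
                intro sum.cong refl, subst Bochner_Integration.integral_sum,
                (intro integrable_P bounded_meas_intros bounded_meas_Pair bm)[1], assumption+, simp)
          finally show ?thesis by simp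
        qed
        also have "q \<omega> * \<dots> \<le> q \<omega> * (w * R i \<omega>)"
          using cond[of t ?x] by (intro mult_left_mono) (simp_all add: t_def R_def q_def)
        finally show "(\<Sum>j\<in>I. \<Sum>l\<in>I. (q \<omega> * S j i \<omega> * S l i \<omega>) * G j l ?x) \<le> q \<omega> * (w * R i \<omega>)" .
      qed
      finally show ?thesis by (simp add: q_def)
    qed
    show "(\<integral>\<omega>. (w * R i \<omega>) ^ 4 \<partial>M) \<le> w ^ 4 * (C * (real N ^ 4 * b ^ 4))" if "i < N" for i
      using R4[OF that] w by (simp add: power_mult_distrib mult_left_mono)
    show "(\<integral>\<omega>. ((x i \<omega>)\<^sup>2) ^ 4 \<partial>M) \<le> b ^ 4 * (C * (real N ^ 4 * b ^ 4))" if "i < N" for i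
    proof -
      have xb: "(x i \<omega>)\<^sup>2 \<le> b * R i \<omega>" for \<omega>
      proof -
        have "(x i \<omega>)\<^sup>2 \<le> R i \<omega> * (\<Sum>j\<in>I. (d j i \<omega>)\<^sup>2)"
          unfolding x_def R_def by (rule Cauchy_Schwarz_ineq_sum)
        also have "\<dots> \<le> R i \<omega> * b" unfolding d_def by (intro mult_left_mono bd R0)
        finally show ?thesis by (simp add: mult.commute)
      qed
      have "(\<integral>\<omega>. ((x i \<omega>)\<^sup>2) ^ 4 \<partial>M) \<le> (\<integral>\<omega>. (b * R i \<omega>) ^ 4 \<partial>M)"
        by (intro integral_mono bounded_meas_integrable bounded_meas_intros bx bR power_mono xb) simp
      also have "\<dots> = b ^ 4 * (\<integral>\<omega>. R i \<omega> ^ 4 \<partial>M)" by (simp add: power_mult_distrib)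
      also have "\<dots> \<le> b ^ 4 * (C * (real N ^ 4 * b ^ 4))"
        using R4[OF that] b by (intro mult_left_mono) auto
      finally show ?thesis .
    qed
    show "0 \<le> w * R i \<omega>" for i \<omega> using w R0 by simp
    show "0 \<le> w ^ 4 * (C * (real N ^ 4 * b ^ 4))" "0 \<le> b ^ 4 * (C * (real N ^ 4 * b ^ 4))"
      using w b by (simp_all add: C_def)
  qed auto
  also have "\<dots> = 500 * exp 500 * C * (real N ^ 8 * w ^ 4 * b ^ 4 + real N ^ 5 * b ^ 8)"
  proof -
    have n8: "real N ^ 8 = real N ^ 4 * real N ^ 4" and n5: "real N ^ 5 = real N * real N ^ 4"
      and b8: "b ^ 8 = b ^ 4 * b ^ 4" by (simp_all flip: power_add power_Suc)
    show ?thesis unfolding n8 n5 b8 by (simp add: algebra_simps)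
  qed
  finally show ?thesis by (simp add: Q_def C_def flip: power_mult)
qed

end

section \<open>Eighth moments of additive functionals\<close>

text \<open>
  The power mean inequality, from the convexity of the eighth power and the weights
  \<open>w k / \<Sum> w\<close>.
\<close>

lemma eighth_power_sum_le:
  fixes a w :: "nat \<Rightarrow> real"
  assumes "\<And>k. k \<in> K \<Longrightarrow> 0 < w k" "finite K"
  shows "(\<Sum>k\<in>K. a k) ^ 8 \<le> (\<Sum>k\<in>K. w k) ^ 7 * (\<Sum>k\<in>K. w k * (a k / w k) ^ 8)"
proof (cases "K = {}")
  case False
  define \<sigma> where "\<sigma> = (\<Sum>k\<in>K. w k)"
  have \<sigma>: "0 < \<sigma>" unfolding \<sigma>_def using assms False by (intro sum_pos) auto
  have "(\<Sum>k\<in>K. (w k / \<sigma>) *\<^sub>R (a k / w k)) ^ 8 \<le> (\<Sum>k\<in>K. (w k / \<sigma>) * (a k / w k) ^ 8)"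
    using assms False \<sigma>
    by (intro convex_on_sum[where f="\<lambda>x::real. x ^ 8" and C=UNIV] convex_power_even)
       (auto simp: \<sigma>_def less_imp_le simp flip: sum_divide_distrib)
  also have "(\<Sum>k\<in>K. (w k / \<sigma>) *\<^sub>R (a k / w k)) = (\<Sum>k\<in>K. a k) / \<sigma>"
    unfolding sum_divide_distrib using assms by (intro sum.cong) (auto simp: less_imp_neq[symmetric])
  also have "(\<Sum>k\<in>K. (w k / \<sigma>) * (a k / w k) ^ 8) = (\<Sum>k\<in>K. w k * (a k / w k) ^ 8) / \<sigma>"
    unfolding sum_divide_distrib by (intro sum.cong) auto
  finally have "(\<Sum>k\<in>K. a k) ^ 8 / \<sigma> ^ 8 \<le> (\<Sum>k\<in>K. w k * (a k / w k) ^ 8) / \<sigma>"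
    by (simp add: power_divide)
  moreover have "\<sigma> ^ 8 = \<sigma> ^ 7 * \<sigma>" by (simp flip: power_Suc2)
  ultimately show ?thesis using \<sigma> unfolding \<sigma>_def[symmetric] by (simp add: field_simps)
qed simp

text \<open>
  Moments of a sum with geometrically decreasing terms: the power mean inequality with weights
  \<open>s\<^sup>k\<close>, where \<open>s\<^sup>8 \<ge> \<theta>\<close>, costs \<open>s\<^bsup>-7k\<^esup>\<close> against the mean \<open>\<theta>\<^sup>k\<close> and leaves \<open>s\<^sup>k\<close>.
\<close>

lemma geometric_mixing_moments:
  assumes mix: "geometric_mixing P \<mu>" and \<mu>: "prob_space \<mu>" and sets_\<mu>: "sets \<mu> = sets borel"
  shows "\<exists>T K. (\<forall>n. bounded_meas borel (T n)) \<and> (\<forall>n x. 0 \<le> T n x) \<and>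
    (\<forall>N. (\<integral>x. (\<Sum>k<N. T k x) ^ 8 \<partial>\<mu>) \<le> K) \<and> (\<forall>N. real N ^ 8 * (\<integral>x. T N x ^ 8 \<partial>\<mu>) \<le> K) \<and>
    (\<forall>u n x. bounded_meas borel u \<longrightarrow> (\<forall>y. \<bar>u y\<bar> \<le> 1) \<longrightarrow>
          \<bar>(kernel_op P ^^ n) u x - (\<integral>y. u y \<partial>\<mu>)\<bar> \<le> T n x)"
proof -
  interpret prob_space \<mu> by fact
  obtain T K \<theta> where \<theta>: "0 < \<theta>" "\<theta> < 1" and Tm: "\<And>n. T n \<in> borel_measurable borel"
    and T02: "\<And>n x. 0 \<le> T n x \<and> T n x \<le> 2"
    and TK: "\<And>n. (\<integral>x. T n x \<partial>\<mu>) \<le> K * \<theta> ^ n"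
    and T: "\<And>u n x. bounded_meas borel u \<Longrightarrow> \<forall>y. \<bar>u y\<bar> \<le> 1 \<Longrightarrow>
          \<bar>(kernel_op P ^^ n) u x - (\<integral>y. u y \<partial>\<mu>)\<bar> \<le> T n x"
    using mix unfolding geometric_mixing_def by blast
  have bT: "bounded_meas borel (T n)" for n
    using T02 by (intro bounded_measI[where c=2] Tm) (simp add: abs_le_iff)
  have bT\<mu>: "bounded_meas \<mu> (T n)" for n
    using bT[of n] by (simp add: bounded_meas_def measurable_cong_sets[OF sets_\<mu> refl])
  have T8: "T n x ^ 8 \<le> 128 * T n x" for n x
  proof -
    have "T n x ^ 7 \<le> 2 ^ 7" using T02[of n x] by (intro power_mono) auto
    then have "T n x ^ 7 * T n x \<le> 2 ^ 7 * T n x" using T02[of n x] by (intro mult_right_mono) auto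
    then show ?thesis by (simp flip: power_Suc2)
  qed
  have ET8: "(\<integral>x. T n x ^ 8 \<partial>\<mu>) \<le> 128 * (K * \<theta> ^ n)" for n
  proof -
    have "(\<integral>x. T n x ^ 8 \<partial>\<mu>) \<le> (\<integral>x. 128 * T n x \<partial>\<mu>)"
      by (intro integral_mono bounded_meas_integrable bounded_meas_intros bT\<mu> T8)
    then show ?thesis using TK[of n] by simp
  qed
  have "0 \<le> (\<integral>x. T 0 x \<partial>\<mu>)" using T02 by (intro integral_nonneg_AE) auto
  then have K0: "0 \<le> K" using TK[of 0] by simp
  define s where "s = 1 - (1 - \<theta>) / 8"
  have s: "0 < s" "s < 1" using \<theta> by (auto simp: s_def)
  have s8: "\<theta> \<le> s ^ 8" using bernoulli_one_minus[of \<theta> 8] \<theta> by (simp add: s_def)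
  define K1 where "K1 = (1 / (1 - s)) ^ 7 * (128 * K * (1 / (1 - s)))"
  have geo: "(\<Sum>k<N. s ^ k) \<le> 1 / (1 - s)" for N
    using s sum_le_suminf[OF summable_geometric[of s], of "{..<N}"] by (simp add: suminf_geometric)
  have "(\<integral>x. (\<Sum>k<N. T k x) ^ 8 \<partial>\<mu>) \<le> K1" for N
  proof -
    have "(\<integral>x. (\<Sum>k<N. T k x) ^ 8 \<partial>\<mu>)
      \<le> (\<integral>x. (\<Sum>k<N. s ^ k) ^ 7 * (\<Sum>k<N. s ^ k * (1 / s ^ k) ^ 8 * T k x ^ 8) \<partial>\<mu>)"
    proof (intro integral_mono bounded_meas_integrable bounded_meas_intros bT\<mu>)
      fix x
      show "(\<Sum>k<N. T k x) ^ 8 \<le> (\<Sum>k<N. s ^ k) ^ 7 * (\<Sum>k<N. s ^ k * (1 / s ^ k) ^ 8 * T k x ^ 8)"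
        using eighth_power_sum_le[of "{..<N}" "\<lambda>k. s ^ k" "\<lambda>k. T k x"] s by (simp add: power_divide)
    qed
    also have "\<dots> = (\<Sum>k<N. s ^ k) ^ 7 * (\<Sum>k<N. s ^ k * (1 / s ^ k) ^ 8 * (\<integral>x. T k x ^ 8 \<partial>\<mu>))"
      by (subst integral_mult_right_zero, subst Bochner_Integration.integral_sum,
          intro bounded_meas_integrable bounded_meas_intros bT\<mu>) simp
    also have "\<dots> \<le> (1 / (1 - s)) ^ 7 * (\<Sum>k<N. 128 * K * s ^ k)"
    proof (rule mult_mono[OF power_mono[OF geo] sum_mono])
      fix k
      have "\<theta> ^ k \<le> (s ^ 8) ^ k" using s8 \<theta> by (intro power_mono) auto
      also have "(s ^ 8) ^ k = (s ^ k) ^ 8" by (simp add: mult.commute flip: power_mult)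
      finally have tk: "\<theta> ^ k \<le> (s ^ k) ^ 8" .
      have "s ^ k * (1 / s ^ k) ^ 8 * (\<integral>x. T k x ^ 8 \<partial>\<mu>) \<le> s ^ k * (1 / s ^ k) ^ 8 * (128 * (K * (s ^ k) ^ 8))"
        using s K0 order_trans[OF ET8[of k] mult_left_mono[OF mult_left_mono[OF tk K0]]]
        by (intro mult_left_mono) auto
      also have "\<dots> = 128 * K * s ^ k" using s by (simp add: power_divide)
      finally show "s ^ k * (1 / s ^ k) ^ 8 * (\<integral>x. T k x ^ 8 \<partial>\<mu>) \<le> 128 * K * s ^ k" .
    qed (use s K0 T02 in \<open>auto intro!: sum_nonneg mult_nonneg_nonneg integral_nonneg_AE\<close>)
    also have "\<dots> \<le> K1"
      unfolding K1_def sum_distrib_left[symmetric] using s K0 by (intro mult_left_mono geo) auto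
    finally show ?thesis .
  qed
  moreover obtain K2 where K2: "\<And>n. real n ^ 8 * \<theta> ^ n \<le> K2"
    using power_times_geometric_bounded[of \<theta> 8] \<theta> by auto
  have "real N ^ 8 * (\<integral>x. T N x ^ 8 \<partial>\<mu>) \<le> 128 * K * K2" for N
  proof -
    have "real N ^ 8 * (\<integral>x. T N x ^ 8 \<partial>\<mu>) \<le> real N ^ 8 * (128 * (K * \<theta> ^ N))"
      by (intro mult_left_mono ET8) auto
    also have "\<dots> = 128 * K * (real N ^ 8 * \<theta> ^ N)" by simp
    also have "\<dots> \<le> 128 * K * K2" using K0 by (intro mult_left_mono K2) auto
    finally show ?thesis .
  qed
  ultimately have "(\<integral>x. (\<Sum>k<N. T k x) ^ 8 \<partial>\<mu>) \<le> max K1 (128 * K * K2)"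
    "real N ^ 8 * (\<integral>x. T N x ^ 8 \<partial>\<mu>) \<le> max K1 (128 * K * K2)" for N
    by (auto simp: le_max_iff_disj)
  then show ?thesis using bT T02 T by (intro exI[of _ T] exI[of _ "max K1 (128 * K * K2)"]) blast
qed

lemma L2_set_sum_le: "L2_set (\<lambda>j. \<Sum>k\<in>K. f k j) I \<le> (\<Sum>k\<in>K. L2_set (f k) I)"
proof (induction K rule: infinite_finite_induct)
  case (insert k K)
  have "L2_set (\<lambda>j. f k j + (\<Sum>k\<in>K. f k j)) I \<le> L2_set (f k) I + L2_set (\<lambda>j. \<Sum>k\<in>K. f k j) I"
    by (rule L2_set_triangle_ineq)
  with insert show ?case by simp
qed (auto simp: L2_set_def)

lemma L2_set_eighth: "(L2_set f I) ^ 8 = (\<Sum>j\<in>I. (f j)\<^sup>2) ^ 4"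
proof -
  have "(L2_set f I) ^ 8 = ((L2_set f I)\<^sup>2) ^ 4" by (simp flip: power_mult)
  then show ?thesis by (simp add: L2_set_def sum_nonneg)
qed

lemma eighth_power_sum4:
  fixes a b c d :: real
  shows "(a + b + c + d) ^ 8 \<le> 4 ^ 7 * (a ^ 8 + b ^ 8 + c ^ 8 + d ^ 8)"
  using eighth_power_sum_le[of "{..<4}" "\<lambda>_. 1" "\<lambda>k. [a, b, c, d] ! k"]
  by (simp add: numeral_eq_Suc lessThan_Suc add_ac)

lemma eighth_power_sum2:
  fixes a b :: real
  shows "(a + b) ^ 8 \<le> 2 ^ 7 * (a ^ 8 + b ^ 8)"
  using eighth_power_sum_le[of "{..<2}" "\<lambda>_. 1" "\<lambda>k. [a, b] ! k"]
  by (simp add: numeral_eq_Suc lessThan_Suc add_ac)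

context stationary_chain
begin

text \<open>
  By duality a vector of test functions converges as fast as a scalar one, with no dependence
  on the number of coordinates: the mixing bound is applied to the combination of the
  coordinates in the direction of the vector \<open>v\<close> itself.
\<close>

lemma kernel_op_pow_vector_bound:
  fixes F :: "'i \<Rightarrow> real \<Rightarrow> real"
  assumes fin: "finite I" and bm: "\<And>j. j \<in> I \<Longrightarrow> bounded_meas borel (F j)"
    and bd: "\<And>x. L2_set (\<lambda>j. F j x) I \<le> \<beta>" and \<beta>: "0 < \<beta>"
    and T: "\<And>u n x. bounded_meas borel u \<Longrightarrow> \<forall>y. \<bar>u y\<bar> \<le> 1 \<Longrightarrow>
          \<bar>(kernel_op P ^^ n) u x - (\<integral>y. u y \<partial>\<mu>)\<bar> \<le> T n x"
  shows "L2_set (\<lambda>j. (kernel_op P ^^ n) (F j) x - (\<integral>y. F j y \<partial>\<mu>)) I \<le> \<beta> * T n x"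
proof -
  define v where "v j = (kernel_op P ^^ n) (F j) x - (\<integral>y. F j y \<partial>\<mu>)" for j
  define s where "s = L2_set v I"
  have int\<mu>: "integrable \<mu> u" if "bounded_meas borel u" for u
    using that prob_\<mu> by (intro finite_measure.bounded_meas_integrable prob_space.finite_measure)
      (auto simp: bounded_meas_def measurable_cong_sets[OF sets_law refl])
  show ?thesis
  proof (cases "s = 0")
    case True
    have "0 \<le> T n x" using T[of "\<lambda>_. 0" n x] order_trans[OF abs_ge_zero] by auto
    then show ?thesis using True \<beta> by (simp add: s_def v_def[abs_def])
  next
    case False
    then have s: "0 < s" unfolding s_def by (simp add: less_le)
    define u where "u y = (\<Sum>j\<in>I. F j y * (v j / (s * \<beta>)))" for y
    have bu: "bounded_meas borel u" unfolding u_def[abs_def] by (intro bounded_meas_intros bm)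
    have u1: "\<bar>u y\<bar> \<le> 1" for y
    proof -
      have "\<bar>u y\<bar> \<le> (\<Sum>j\<in>I. \<bar>F j y\<bar> * \<bar>v j / (s * \<beta>)\<bar>)"
        unfolding u_def abs_mult[symmetric] by (rule sum_abs)
      also have "\<dots> \<le> L2_set (\<lambda>j. F j y) I * L2_set (\<lambda>j. v j / (s * \<beta>)) I" by (rule L2_set_mult_ineq)
      also have "L2_set (\<lambda>j. v j / (s * \<beta>)) I = s * (1 / (s * \<beta>))"
        using s \<beta> L2_set_left_distrib[of "1 / (s * \<beta>)" v I] by (simp add: s_def)
      also have "\<dots> = 1 / \<beta>" using s by simp
      also have "L2_set (\<lambda>j. F j y) I * (1 / \<beta>) \<le> \<beta> * (1 / \<beta>)" using \<beta> by (intro mult_right_mono bd) auto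
      finally show ?thesis using \<beta> by simp
    qed
    have "(kernel_op P ^^ n) u x - (\<integral>y. u y \<partial>\<mu>) = (\<Sum>j\<in>I. v j * (v j / (s * \<beta>)))"
    proof -
      have "(kernel_op P ^^ n) u x = (\<Sum>j\<in>I. (kernel_op P ^^ n) (F j) x * (v j / (s * \<beta>)))"
        unfolding u_def[abs_def]
        by (subst linear_on_bounded_sum[OF linear_on_bounded_funpow[OF linear_kernel_op] bm fin]) simp_all
      moreover have "(\<integral>y. u y \<partial>\<mu>) = (\<Sum>j\<in>I. (\<integral>y. F j y \<partial>\<mu>) * (v j / (s * \<beta>)))"
        unfolding u_def by (subst Bochner_Integration.integral_sum, intro int\<mu> bounded_meas_intros bm) simp_all
      ultimately have "(kernel_op P ^^ n) u x - (\<integral>y. u y \<partial>\<mu>)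
          = (\<Sum>j\<in>I. (kernel_op P ^^ n) (F j) x * (v j / (s * \<beta>)) - (\<integral>y. F j y \<partial>\<mu>) * (v j / (s * \<beta>)))"
        by (simp only: sum_subtractf)
      also have "\<dots> = (\<Sum>j\<in>I. ((kernel_op P ^^ n) (F j) x - (\<integral>y. F j y \<partial>\<mu>)) * (v j / (s * \<beta>)))"
        by (simp only: left_diff_distrib)
      finally show ?thesis by (simp only: v_def[symmetric])
    qed
    also have "\<dots> = (\<Sum>j\<in>I. (v j)\<^sup>2) / (s * \<beta>)"
      by (simp add: power2_eq_square sum_divide_distrib)
    also have "(\<Sum>j\<in>I. (v j)\<^sup>2) = s * s"
      using sum_nonneg[of I "\<lambda>j. (v j)\<^sup>2"] by (simp add: s_def L2_set_def)
    finally have "s / \<beta> \<le> T n x" using T[OF bu, of n x] u1 s \<beta> by simp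
    then show ?thesis using \<beta> by (simp add: s_def v_def[abs_def] field_simps)
  qed
qed

text \<open>
  The Poisson equation is solved only approximately, with \<open>G = \<Sum>k<N. (P\<^sup>k F - \<mu> F)\<close>. So \<open>G\<close> is
  a finite sum of bounded functions and no convergence has to be discussed; the price is the
  remainder \<open>P\<^sup>N F - \<mu> F\<close> in each of the \<open>N\<close> steps, which is exponentially small in \<open>N\<close>. The
  constant depends neither on the index set nor on the functions.
\<close>

lemma additive_functional_eighth_moment:
  assumes mix: "geometric_mixing P \<mu>"
  shows "\<exists>K. \<forall>(I :: 'i set) F \<beta> N. finite I \<longrightarrow> (\<forall>j\<in>I. bounded_meas borel (F j)) \<longrightarrow>
     (\<forall>x. L2_set (\<lambda>j. F j x) I \<le> \<beta>) \<longrightarrow> 0 < \<beta> \<longrightarrow> 1 \<le> N \<longrightarrow>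
     (\<integral>\<omega>. (L2_set (\<lambda>j. \<Sum>i<N. F j (X (Suc i) \<omega>) - (\<integral>y. F j y \<partial>\<mu>)) I) ^ 8 \<partial>M) \<le> K * (real N ^ 4 * \<beta> ^ 8)"
proof -
  obtain T K1 where bT: "\<And>n. bounded_meas borel (T n)" and T0: "\<And>n x. 0 \<le> T n x"
    and K1: "\<And>N. (\<integral>x. (\<Sum>k<N. T k x) ^ 8 \<partial>\<mu>) \<le> K1" "\<And>N. real N ^ 8 * (\<integral>x. T N x ^ 8 \<partial>\<mu>) \<le> K1"
    and T: "\<And>u n x. bounded_meas borel u \<Longrightarrow> \<forall>y. \<bar>u y\<bar> \<le> 1 \<Longrightarrow>
          \<bar>(kernel_op P ^^ n) u x - (\<integral>y. u y \<partial>\<mu>)\<bar> \<le> T n x"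
    using geometric_mixing_moments[OF mix prob_\<mu> sets_law] by blast
  have K10: "0 \<le> K1" using K1(1)[of 0] by simp
  define K where "K = 4 ^ 7 * (1000 * exp 500 * (256 * K1) + 3 * K1)"
  have "(\<integral>\<omega>. (L2_set (\<lambda>j. \<Sum>i<N. F j (X (Suc i) \<omega>) - (\<integral>y. F j y \<partial>\<mu>)) I) ^ 8 \<partial>M) \<le> K * (real N ^ 4 * \<beta> ^ 8)"
    if fin: "finite I" and bm: "\<forall>j\<in>I. bounded_meas borel (F j)"
      and bd: "\<forall>x. L2_set (\<lambda>j. F j x) I \<le> \<beta>" and \<beta>: "0 < \<beta>" and N: "1 \<le> N"
    for I :: "'i set" and F \<beta> N
  proof -
    have bF: "bounded_meas borel (F j)" if "j \<in> I" for j using bm that by blast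
    define a where "a j = (\<integral>y. F j y \<partial>\<mu>)" for j
    define D where "D k j x = (kernel_op P ^^ k) (F j) x - a j" for k j x
    define G where "G j x = (\<Sum>k<N. D k j x)" for j x
    define G' where "G' j x = (\<Sum>k<N. D (Suc k) j x)" for j x
    define \<psi> where "\<psi> j z = G j (snd z) - G' j (fst z)" for j and z :: "real \<times> real"
    define \<T> where "\<T> n x = (\<Sum>k<n. T k x)" for n x
    have b\<T>: "bounded_meas borel (\<T> n)" for n
      unfolding \<T>_def[abs_def] by (intro bounded_meas_intros bT)
    have \<T>0: "0 \<le> \<T> n x" for n x unfolding \<T>_def by (intro sum_nonneg T0)
    have bD: "bounded_meas borel (D k j)" if "j \<in> I" for k j
      unfolding D_def[abs_def]
      by (intro bounded_meas_intros linear_on_boundedD(1)[OF linear_on_bounded_funpow[OF linear_kernel_op]] bF that)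
    have bG: "bounded_meas borel (G j)" and bG': "bounded_meas borel (G' j)" if "j \<in> I" for j
      unfolding G_def[abs_def] G'_def[abs_def] by (intro bounded_meas_intros bD that)+
    have bsnd: "bounded_meas borel (\<lambda>z::real\<times>real. u (snd z))"
      and bfst: "bounded_meas borel (\<lambda>z::real\<times>real. u (fst z))" if "bounded_meas borel u" for u
      by (rule bounded_meas_comp[OF that], simp add: borel_prod[symmetric])+
    have b\<psi>: "bounded_meas borel (\<psi> j)" if "j \<in> I" for j
      unfolding \<psi>_def[abs_def] by (intro bounded_meas_intros bsnd bfst bG bG' that)
    have kD: "kernel_op P (D k j) = D (Suc k) j" if "j \<in> I" for k j
      unfolding D_def[abs_def]
      using kernel_op_const[of 1 "a j"]
        linear_on_bounded_diff[OF linear_kernel_op linear_on_boundedD(1)[OF linear_on_bounded_funpow[OF linear_kernel_op] bF[OF that]], of "\<lambda>_. a j" k]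
      by simp
    have kG: "kernel_op P (G j) = G' j" if "j \<in> I" for j
      unfolding G_def[abs_def] G'_def[abs_def]
      using linear_on_bounded_sum[OF linear_kernel_op bD[OF that], where K="{..<N}" and c="\<lambda>_. 1"] that
      by (simp add: kD)
    have mart: "step_op P (\<psi> j) x = 0" if "j \<in> I" for j x
    proof -
      have "step_op P (\<psi> j) x = kernel_op P (G j) x - G' j x"
        using prob_space.prob_space[OF prob_P]
        by (simp add: step_op_def \<psi>_def kernel_op_def integrable_P bG[OF that])
      then show ?thesis by (simp add: kG[OF that])
    qed
    have LD: "L2_set (\<lambda>j. D k j x) I \<le> \<beta> * T k x" for k x
      unfolding D_def a_def using bd by (intro kernel_op_pow_vector_bound fin bF \<beta> T) auto
    have LG: "L2_set (\<lambda>j. G j x) I \<le> \<beta> * \<T> (Suc N) x" for x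
    proof -
      have "L2_set (\<lambda>j. G j x) I \<le> (\<Sum>k<N. L2_set (\<lambda>j. D k j x) I)" unfolding G_def by (rule L2_set_sum_le)
      also have "\<dots> \<le> (\<Sum>k<N. \<beta> * T k x)" by (intro sum_mono LD)
      also have "\<dots> \<le> \<beta> * \<T> (Suc N) x" using T0[of N x] \<beta> by (simp add: \<T>_def sum_distrib_left[symmetric])
      finally show ?thesis .
    qed
    have LG': "L2_set (\<lambda>j. G' j x) I \<le> \<beta> * \<T> (Suc N) x" for x
    proof -
      have "L2_set (\<lambda>j. G' j x) I \<le> (\<Sum>k<N. L2_set (\<lambda>j. D (Suc k) j x) I)" unfolding G'_def by (rule L2_set_sum_le)
      also have "\<dots> \<le> (\<Sum>k<N. \<beta> * T (Suc k) x)" by (intro sum_mono LD)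
      also have "\<dots> \<le> \<beta> * \<T> (Suc N) x"
        using T0[of 0 x] \<beta> unfolding \<T>_def sum.lessThan_Suc_shift by (simp add: sum_distrib_left[symmetric])
      finally show ?thesis .
    qed
    have E\<T>: "(\<integral>\<omega>. (\<beta> * \<T> n (X i \<omega>)) ^ 8 \<partial>M) \<le> \<beta> ^ 8 * K1" for n i
    proof -
      have "(\<integral>\<omega>. (\<beta> * \<T> n (X i \<omega>)) ^ 8 \<partial>M) = (\<integral>x. (\<beta> * \<T> n x) ^ 8 \<partial>\<mu>)"
        by (rule expectation_X[where u="\<lambda>x. (\<beta> * \<T> n x) ^ 8"]) (intro bounded_meas_intros b\<T>)
      also have "\<dots> = \<beta> ^ 8 * (\<integral>x. \<T> n x ^ 8 \<partial>\<mu>)" by (simp add: power_mult_distrib)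
      also have "\<dots> \<le> \<beta> ^ 8 * K1" unfolding \<T>_def by (intro mult_left_mono K1) simp
      finally show ?thesis .
    qed
    define m where "m \<omega> = L2_set (\<lambda>j. path_sum (\<psi> j) N \<omega>) I" for \<omega>
    have Em: "(\<integral>\<omega>. m \<omega> ^ 8 \<partial>M) \<le> 1000 * exp 500 * (real N ^ 4 * (256 * (\<beta> ^ 8 * K1)))"
      unfolding m_def L2_set_eighth
    proof (rule martingale_eighth_moment[OF b\<psi> mart])
      fix i
      have "(\<integral>\<omega>. (\<Sum>j\<in>I. (\<psi> j (X (Suc i) \<omega>, X (Suc (Suc i)) \<omega>))\<^sup>2) ^ 4 \<partial>M)
        \<le> (\<integral>\<omega>. 2 ^ 7 * ((\<beta> * \<T> (Suc N) (X (Suc (Suc i)) \<omega>)) ^ 8 + (\<beta> * \<T> (Suc N) (X (Suc i) \<omega>)) ^ 8) \<partial>M)"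
      proof (intro integral_mono bounded_meas_integrable bounded_meas_intros bounded_pair b\<psi> bounded_X b\<T>)
        fix \<omega>
        let ?x = "X (Suc i) \<omega>" and ?y = "X (Suc (Suc i)) \<omega>"
        have "(\<Sum>j\<in>I. (\<psi> j (?x, ?y))\<^sup>2) ^ 4 = L2_set (\<lambda>j. G j ?y + - G' j ?x) I ^ 8"
          by (simp add: L2_set_eighth \<psi>_def)
        also have "\<dots> \<le> (L2_set (\<lambda>j. G j ?y) I + L2_set (\<lambda>j. - G' j ?x) I) ^ 8"
          by (intro power_mono L2_set_triangle_ineq) simp
        also have "\<dots> \<le> (\<beta> * \<T> (Suc N) ?y + \<beta> * \<T> (Suc N) ?x) ^ 8"
          using LG[of ?y] LG'[of ?x] by (intro power_mono add_mono) (simp_all add: L2_set_def sum_nonneg)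
        also have "\<dots> \<le> 2 ^ 7 * ((\<beta> * \<T> (Suc N) ?y) ^ 8 + (\<beta> * \<T> (Suc N) ?x) ^ 8)"
          by (rule eighth_power_sum2)
        finally show "(\<Sum>j\<in>I. (\<psi> j (?x, ?y))\<^sup>2) ^ 4 \<le> 2 ^ 7 * ((\<beta> * \<T> (Suc N) ?y) ^ 8 + (\<beta> * \<T> (Suc N) ?x) ^ 8)" .
      qed
      also have "\<dots> = 2 ^ 7 * ((\<integral>\<omega>. (\<beta> * \<T> (Suc N) (X (Suc (Suc i)) \<omega>)) ^ 8 \<partial>M) + (\<integral>\<omega>. (\<beta> * \<T> (Suc N) (X (Suc i) \<omega>)) ^ 8 \<partial>M))"
        by (subst integral_mult_right_zero, subst Bochner_Integration.integral_add,
            (intro bounded_meas_integrable bounded_meas_intros bounded_X b\<T>)+) simp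
      also have "\<dots> \<le> 2 ^ 7 * (\<beta> ^ 8 * K1 + \<beta> ^ 8 * K1)" by (intro mult_left_mono add_mono E\<T>) simp
      finally show "(\<integral>\<omega>. (\<Sum>j\<in>I. (\<psi> j (X (Suc i) \<omega>, X (Suc (Suc i)) \<omega>))\<^sup>2) ^ 4 \<partial>M) \<le> 256 * (\<beta> ^ 8 * K1)" by (simp add: mult.commute)
    qed auto
    define r where "r \<omega> = (\<Sum>i<N. \<beta> * T N (X (Suc i) \<omega>))" for \<omega>
    have br: "bounded_meas M r" unfolding r_def[abs_def] by (intro bounded_meas_intros bounded_X bT)
    have Er: "(\<integral>\<omega>. r \<omega> ^ 8 \<partial>M) \<le> \<beta> ^ 8 * K1"
    proof -
      have "(\<integral>\<omega>. r \<omega> ^ 8 \<partial>M) \<le> (\<integral>\<omega>. real N ^ 7 * (\<Sum>i<N. (\<beta> * T N (X (Suc i) \<omega>)) ^ 8) \<partial>M)"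
        using eighth_power_sum_le[of "{..<N}" "\<lambda>_. 1"]
        by (intro integral_mono bounded_meas_integrable bounded_meas_intros br bounded_X bT) (simp add: r_def)
      also have "\<dots> = real N ^ 7 * (\<Sum>i<N. (\<integral>\<omega>. (\<beta> * T N (X (Suc i) \<omega>)) ^ 8 \<partial>M))"
        by (subst integral_mult_right_zero, subst Bochner_Integration.integral_sum,
            intro bounded_meas_integrable bounded_meas_intros bounded_X bT) simp
      also have "\<dots> = real N ^ 7 * (\<Sum>i<N. (\<integral>x. (\<beta> * T N x) ^ 8 \<partial>\<mu>))"
        by (intro arg_cong2[where f="(*)"] sum.cong refl expectation_X[where u="\<lambda>x. (\<beta> * T N x) ^ 8"]
            bounded_meas_intros bT)
      also have "\<dots> = \<beta> ^ 8 * (real N ^ 8 * (\<integral>x. T N x ^ 8 \<partial>\<mu>))"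
      proof -
        have "real N ^ 8 = real N ^ 7 * real N" by (simp flip: power_Suc2)
        then show ?thesis by (simp add: power_mult_distrib)
      qed
      also have "\<dots> \<le> \<beta> ^ 8 * K1" by (intro mult_left_mono K1) simp
      finally show ?thesis .
    qed
    define t where "t i \<omega> = \<beta> * \<T> (Suc N) (X i \<omega>)" for i \<omega>
    have decomp: "(\<Sum>i<n. F j (X (Suc i) \<omega>) - a j)
        = path_sum (\<psi> j) n \<omega> + G j (X 1 \<omega>) + - G j (X (Suc n) \<omega>) + (\<Sum>i<n. D N j (X (Suc i) \<omega>))" for n j \<omega>
    proof (induction n)
      case (Suc n)
      have "G j x - G' j x = D 0 j x - D N j x" for x
        using sum_lessThan_telescope'[of "\<lambda>k. D k j x" N] by (simp add: G_def G'_def sum_subtractf)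
      from this[of "X (Suc n) \<omega>"] Suc show ?case
        by (simp add: path_sum_Suc \<psi>_def D_def)
    qed simp
    have bm_m: "bounded_meas M (\<lambda>\<omega>. m \<omega> ^ 8)"
      unfolding m_def L2_set_eighth by (intro bounded_meas_intros bounded_path_sum b\<psi>)
    have bt: "bounded_meas M (t i)" for i unfolding t_def[abs_def] by (intro bounded_meas_intros bounded_X b\<T>)
    have "(\<integral>\<omega>. (L2_set (\<lambda>j. \<Sum>i<N. F j (X (Suc i) \<omega>) - a j) I) ^ 8 \<partial>M)
      \<le> (\<integral>\<omega>. 4 ^ 7 * (m \<omega> ^ 8 + t 1 \<omega> ^ 8 + t (Suc N) \<omega> ^ 8 + r \<omega> ^ 8) \<partial>M)"
    proof (rule integral_mono)
      show "integrable M (\<lambda>\<omega>. (L2_set (\<lambda>j. \<Sum>i<N. F j (X (Suc i) \<omega>) - a j) I) ^ 8)"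
        unfolding L2_set_eighth by (intro bounded_meas_integrable bounded_meas_intros bounded_X bF)
      show "integrable M (\<lambda>\<omega>. 4 ^ 7 * (m \<omega> ^ 8 + t 1 \<omega> ^ 8 + t (Suc N) \<omega> ^ 8 + r \<omega> ^ 8))"
        by (intro bounded_meas_integrable bounded_meas_mult bounded_meas_add bounded_meas_const bm_m
            bounded_meas_power[OF bt] bounded_meas_power[OF br])
      fix \<omega>
      have "L2_set (\<lambda>j. \<Sum>i<N. F j (X (Suc i) \<omega>) - a j) I
          \<le> m \<omega> + L2_set (\<lambda>j. G j (X 1 \<omega>)) I + L2_set (\<lambda>j. - G j (X (Suc N) \<omega>)) I + L2_set (\<lambda>j. \<Sum>i<N. D N j (X (Suc i) \<omega>)) I"
        unfolding decomp m_def
        by (rule order_trans[OF L2_set_triangle_ineq add_right_mono],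
            rule order_trans[OF L2_set_triangle_ineq add_right_mono], rule L2_set_triangle_ineq)
      also have "\<dots> \<le> m \<omega> + t 1 \<omega> + t (Suc N) \<omega> + r \<omega>"
      proof (intro add_mono order_refl)
        show "L2_set (\<lambda>j. G j (X 1 \<omega>)) I \<le> t 1 \<omega>" unfolding t_def by (rule LG)
        show "L2_set (\<lambda>j. - G j (X (Suc N) \<omega>)) I \<le> t (Suc N) \<omega>"
          unfolding t_def using LG[of "X (Suc N) \<omega>"] by (simp add: L2_set_def)
        have "L2_set (\<lambda>j. \<Sum>i<N. D N j (X (Suc i) \<omega>)) I \<le> (\<Sum>i<N. L2_set (\<lambda>j. D N j (X (Suc i) \<omega>)) I)"
          by (rule L2_set_sum_le)
        also have "\<dots> \<le> r \<omega>" unfolding r_def by (intro sum_mono LD)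
        finally show "L2_set (\<lambda>j. \<Sum>i<N. D N j (X (Suc i) \<omega>)) I \<le> r \<omega>" .
      qed
      finally have "(L2_set (\<lambda>j. \<Sum>i<N. F j (X (Suc i) \<omega>) - a j) I) ^ 8 \<le> (m \<omega> + t 1 \<omega> + t (Suc N) \<omega> + r \<omega>) ^ 8"
        by (intro power_mono) auto
      also have "\<dots> \<le> 4 ^ 7 * (m \<omega> ^ 8 + t 1 \<omega> ^ 8 + t (Suc N) \<omega> ^ 8 + r \<omega> ^ 8)" by (rule eighth_power_sum4)
      finally show "(L2_set (\<lambda>j. \<Sum>i<N. F j (X (Suc i) \<omega>) - a j) I) ^ 8 \<le> 4 ^ 7 * (m \<omega> ^ 8 + t 1 \<omega> ^ 8 + t (Suc N) \<omega> ^ 8 + r \<omega> ^ 8)" .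
    qed
    also have "\<dots> = 4 ^ 7 * ((\<integral>\<omega>. m \<omega> ^ 8 \<partial>M) + (\<integral>\<omega>. t 1 \<omega> ^ 8 \<partial>M) + (\<integral>\<omega>. t (Suc N) \<omega> ^ 8 \<partial>M) + (\<integral>\<omega>. r \<omega> ^ 8 \<partial>M))"
    proof -
      have "integrable M (\<lambda>\<omega>. m \<omega> ^ 8)" "integrable M (\<lambda>\<omega>. r \<omega> ^ 8)" "integrable M (\<lambda>\<omega>. t i \<omega> ^ 8)" for i
        by (intro bounded_meas_integrable bm_m bounded_meas_power[OF bt] bounded_meas_power[OF br])+
      then show ?thesis by simp
    qed
    also have "\<dots> \<le> 4 ^ 7 * (1000 * exp 500 * (real N ^ 4 * (256 * (\<beta> ^ 8 * K1))) + \<beta> ^ 8 * K1 + \<beta> ^ 8 * K1 + \<beta> ^ 8 * K1)"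
      unfolding t_def by (intro mult_left_mono add_mono Em Er E\<T>) simp
    also have "\<dots> \<le> 4 ^ 7 * (1000 * exp 500 * (real N ^ 4 * (256 * (\<beta> ^ 8 * K1))) + 3 * (real N ^ 4 * (\<beta> ^ 8 * K1)))"
    proof -
      have "1 * (\<beta> ^ 8 * K1) \<le> real N ^ 4 * (\<beta> ^ 8 * K1)"
        using N K10 by (intro mult_right_mono) auto
      then show ?thesis by (intro mult_left_mono, linarith, simp)
    qed
    also have "\<dots> = K * (real N ^ 4 * \<beta> ^ 8)" by (simp add: K_def algebra_simps)
    finally show ?thesis by (simp add: a_def)
  qed
  then show ?thesis by blast
qed

end

section \<open>Fluctuations of tensor product bases\<close>

text \<open>
  Markov's inequality in the form in which it is used here: an excess over \<open>\<tau>\<close> occurs only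
  where \<open>x / \<tau>\<close> is at least 1, so that powers of this ratio can be inserted.
\<close>

lemma excess_le_power:
  fixes x \<tau> :: real
  assumes "0 < \<tau>" "odd p"
  shows "x - \<tau> \<le> x ^ Suc p / \<tau> ^ p"
proof (cases "x \<le> \<tau>")
  case True
  have "0 \<le> x ^ Suc p / \<tau> ^ p" using assms by (intro divide_nonneg_pos zero_le_even_power) auto
  then show ?thesis using True by linarith
next
  case False
  have "1 \<le> (x / \<tau>) ^ p" using False assms by (intro one_le_power) auto
  then have "x * 1 \<le> x * (x / \<tau>) ^ p" using False assms by (intro mult_left_mono) auto
  then show ?thesis using assms by (simp add: power_divide)
qed

lemma (in prob_space) square_expectation_le:
  assumes "bounded_meas M u"
  shows "(\<integral>x. u x \<partial>M)\<^sup>2 \<le> (\<integral>x. (u x)\<^sup>2 \<partial>M)"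
proof -
  define a where "a = (\<integral>x. u x \<partial>M)"
  have i: "integrable M u" "integrable M (\<lambda>x. (u x)\<^sup>2)"
    by (intro bounded_meas_integrable bounded_meas_intros assms)+
  have "0 \<le> (\<integral>x. (u x - a)\<^sup>2 \<partial>M)" by simp
  also have "(\<integral>x. (u x - a)\<^sup>2 \<partial>M) = (\<integral>x. (u x)\<^sup>2 - 2 * a * u x + a\<^sup>2 \<partial>M)"
    by (intro Bochner_Integration.integral_cong) (auto simp: power2_diff)
  also have "\<dots> = (\<integral>x. (u x)\<^sup>2 \<partial>M) - a\<^sup>2"
    using i by (simp add: a_def[symmetric] prob_space power2_eq_square)
  finally show ?thesis by (simp add: a_def)
qed

lemma integral_density_bounded_le:
  fixes p u :: "real \<Rightarrow> real"
  assumes [measurable]: "p \<in> borel_measurable borel" "u \<in> borel_measurable borel"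
    and p0: "\<And>y. 0 \<le> p y" and u0: "\<And>y. 0 \<le> u y" and supp: "\<And>y. y \<notin> {0..1} \<Longrightarrow> u y = 0"
    and pB: "AE y in lborel. y \<in> {0..1} \<longrightarrow> p y \<le> B"
    and i: "integrable lborel u"
  shows "(\<integral>y. u y \<partial>density lborel (\<lambda>y. ennreal (p y))) \<le> B * (\<integral>y. u y \<partial>lborel)"
proof -
  have le: "AE y in lborel. p y * u y \<le> B * u y"
    using pB by eventually_elim (metis supp u0 mult_right_mono mult_zero_right order_refl)
  have "integrable lborel (\<lambda>y. p y * u y)"
  proof (rule Bochner_Integration.integrable_bound)
    show "integrable lborel (\<lambda>y. B * u y)" using i by simp
    show "AE y in lborel. norm (p y * u y) \<le> norm (B * u y)"
      using le by eventually_elim (use p0 u0 in \<open>auto simp: abs_mult\<close>, metis abs_ge_self abs_mult abs_of_nonneg order_trans)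
  qed measurable
  then have "(\<integral>y. p y * u y \<partial>lborel) \<le> (\<integral>y. B * u y \<partial>lborel)"
    using i by (intro integral_mono_AE le) auto
  then show ?thesis using p0 by (subst integral_real_density) auto
qed

lemma integral_square_orthonormal:
  fixes b :: "'l \<Rightarrow> 'a \<Rightarrow> real"
  assumes fin: "finite L"
    and i: "\<And>k k'. k \<in> L \<Longrightarrow> k' \<in> L \<Longrightarrow> integrable M (\<lambda>y. b k y * b k' y)"
    and on: "\<And>k k'. k \<in> L \<Longrightarrow> k' \<in> L \<Longrightarrow> (\<integral>y. b k y * b k' y \<partial>M) = (if k = k' then 1 else 0)"
  shows "integrable M (\<lambda>y. (\<Sum>k\<in>L. c k * b k y)\<^sup>2)"
    "(\<integral>y. (\<Sum>k\<in>L. c k * b k y)\<^sup>2 \<partial>M) = (\<Sum>k\<in>L. (c k)\<^sup>2)"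
proof -
  have eq: "(\<lambda>y. (\<Sum>k\<in>L. c k * b k y)\<^sup>2) = (\<lambda>y. \<Sum>k\<in>L. \<Sum>k'\<in>L. c k * c k' * (b k y * b k' y))"
    by (simp add: power2_eq_square sum_product mult_ac)
  show "integrable M (\<lambda>y. (\<Sum>k\<in>L. c k * b k y)\<^sup>2)"
    unfolding eq by (intro Bochner_Integration.integrable_sum integrable_mult_right i)
  have "(\<integral>y. (\<Sum>k\<in>L. c k * b k y)\<^sup>2 \<partial>M) = (\<Sum>k\<in>L. \<Sum>k'\<in>L. c k * c k' * (if k = k' then 1 else 0))"
    unfolding eq
    by (simp add: Bochner_Integration.integral_sum integrable_mult_right i on cong: sum.cong)
  also have "\<dots> = (\<Sum>k\<in>L. (c k)\<^sup>2)"
    using fin by (intro sum.cong refl) (simp add: if_distrib[of "\<lambda>x. _ * x"] sum.delta power2_eq_square cong: if_cong)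
  finally show "(\<integral>y. (\<Sum>k\<in>L. c k * b k y)\<^sup>2 \<partial>M) = (\<Sum>k\<in>L. (c k)\<^sup>2)" .
qed

definition tensor :: "('l \<Rightarrow> real \<Rightarrow> real) \<Rightarrow> ('l \<Rightarrow> real \<Rightarrow> real) \<Rightarrow> 'l \<times> 'l \<Rightarrow> real \<times> real \<Rightarrow> real" where
  "tensor a b j z = a (fst j) (fst z) * b (snd j) (snd z)"

lemma sum_tensor_square:
  "(\<Sum>j\<in>L \<times> L. (tensor a b j z)\<^sup>2) = (\<Sum>l\<in>L. (a l (fst z))\<^sup>2) * (\<Sum>k\<in>L. (b k (snd z))\<^sup>2)"
  by (simp add: tensor_def power_mult_distrib sum_product sum.cartesian_product case_prod_beta')

text \<open>
  The squared length of a sum of centred vectors along the trajectory; for an orthonormal basis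
  of a model it is \<open>N\<^sup>2\<close> times the squared supremum of \<open>\<nu>\<close> over the unit ball.
\<close>

definition (in stationary_chain) deviation ::
    "'i set \<Rightarrow> ('i \<Rightarrow> real \<times> real \<Rightarrow> real) \<Rightarrow> nat \<Rightarrow> 'w \<Rightarrow> real" where
  "deviation I f N \<omega> = (\<Sum>j\<in>I. (\<Sum>i<N. f j (X (Suc i) \<omega>, X (Suc (Suc i)) \<omega>)
     - (\<integral>\<omega>. f j (X 1 \<omega>, X 2 \<omega>) \<partial>M))\<^sup>2)"

lemma (in stationary_chain) bounded_deviation:
  assumes "\<And>j. j \<in> I \<Longrightarrow> bounded_meas borel (f j)"
  shows "bounded_meas M (deviation I f N)"
  unfolding deviation_def[abs_def]
  by (intro bounded_meas_sum bounded_meas_power bounded_meas_diff bounded_meas_const bounded_pair assms)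

text \<open>
  Two versions \<open>a\<close> and \<open>b\<close> of one orthonormal family are used for the two coordinates, modified
  on null sets so that all bounds hold everywhere. The version \<open>a\<close> also vanishes at the states
  from which the transition density is not bounded by \<open>B\<close>; the version \<open>b\<close> must stay
  orthonormal.
\<close>

locale tensor_basis = stationary_chain M P X \<mu>
  for M :: "'w measure" and P X \<mu> +
  fixes \<pi> :: "real \<Rightarrow> real \<Rightarrow> real" and B R :: real and L :: "'l set" and a b :: "'l \<Rightarrow> real \<Rightarrow> real"
  assumes density: "has_transition_density P \<pi>"
    and B: "0 < B" and R: "0 < R" and fin: "finite L"
    and a_meas: "\<And>l. l \<in> L \<Longrightarrow> a l \<in> borel_measurable borel"
    and b_meas: "\<And>l. l \<in> L \<Longrightarrow> b l \<in> borel_measurable borel"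
    and a_bound: "\<And>x. (\<Sum>l\<in>L. (a l x)\<^sup>2) \<le> R" and b_bound: "\<And>x. (\<Sum>l\<in>L. (b l x)\<^sup>2) \<le> R"
    and b_supp: "\<And>l y. l \<in> L \<Longrightarrow> y \<notin> {0..1} \<Longrightarrow> b l y = 0"
    and a_good: "\<And>l x. l \<in> L \<Longrightarrow> a l x \<noteq> 0 \<Longrightarrow> (AE y in lborel. y \<in> {0..1} \<longrightarrow> \<pi> x y \<le> B)"
    and b_orth: "\<And>k k'. k \<in> L \<Longrightarrow> k' \<in> L \<Longrightarrow> (\<integral>y. b k y * b k' y \<partial>lborel) = (if k = k' then 1 else 0)"
begin

lemma bounded_a: "l \<in> L \<Longrightarrow> bounded_meas borel (a l)"
  and bounded_b: "l \<in> L \<Longrightarrow> bounded_meas borel (b l)"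
proof -
  have "\<bar>f l x\<bar> \<le> sqrt R" if "l \<in> L" "\<And>x. (\<Sum>l\<in>L. (f l x)\<^sup>2) \<le> R" for f :: "'l \<Rightarrow> real \<Rightarrow> real" and l x
  proof -
    have "(f l x)\<^sup>2 \<le> (\<Sum>l\<in>L. (f l x)\<^sup>2)" using that fin by (intro member_le_sum) auto
    then have "(f l x)\<^sup>2 \<le> R" using that(2)[of x] by linarith
    then show ?thesis by (simp add: real_le_rsqrt)
  qed
  from this[of _ a] this[of _ b]
  show "l \<in> L \<Longrightarrow> bounded_meas borel (a l)" "l \<in> L \<Longrightarrow> bounded_meas borel (b l)"
    using a_bound b_bound a_meas b_meas by (blast intro: bounded_measI)+
qed

lemma integrable_bb: "k \<in> L \<Longrightarrow> k' \<in> L \<Longrightarrow> integrable lborel (\<lambda>y. b k y * b k' y)"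
proof -
  assume k: "k \<in> L" "k' \<in> L"
  obtain c where c: "\<And>y. \<bar>b k y * b k' y\<bar> \<le> c"
    using bounded_meas_mult[OF bounded_b[OF k(1)] bounded_b[OF k(2)]] unfolding bounded_meas_def by blast
  show ?thesis
  proof (rule Bochner_Integration.integrable_bound)
    show "integrable lborel (\<lambda>y. indicator {0..1::real} y * c)" by (intro integrable_mult_left) simp
    show "AE y in lborel. norm (b k y * b k' y) \<le> norm (indicator {0..1} y * c)"
    proof (rule AE_I2)
      fix y
      show "norm (b k y * b k' y) \<le> norm (indicator {0..1} y * c)"
        using c[of y] b_supp[OF k(1), of y] by (cases "y \<in> {0..1}") auto
    qed
    show "(\<lambda>y. b k y * b k' y) \<in> borel_measurable lborel" using b_meas k by simp
  qed
qed

abbreviation "good x \<equiv> (AE y in lborel. y \<in> {0..1} \<longrightarrow> \<pi> x y \<le> B)"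

lemma P_density: "P x = density lborel (\<lambda>y. ennreal (\<pi> x y))"
  and \<pi>_nonneg: "0 \<le> \<pi> x y" and \<pi>_meas: "\<pi> x \<in> borel_measurable borel"
proof -
  have m: "(\<lambda>z. \<pi> (fst z) (snd z)) \<in> borel_measurable (borel \<Otimes>\<^sub>M borel)"
    using density by (simp add: has_transition_density_def case_prod_beta' borel_prod)
  have "(\<lambda>y. \<pi> x y) \<in> borel_measurable borel"
    using measurable_compose[OF measurable_Pair1' m, of x] by simp
  then show "\<pi> x \<in> borel_measurable borel" by simp
  show "P x = density lborel (\<lambda>y. ennreal (\<pi> x y))" "0 \<le> \<pi> x y"
    using density by (auto simp: has_transition_density_def)
qed

lemma one_step_square_le:
  assumes "good x"
  shows "(\<integral>y. (\<Sum>k\<in>L. c k * b k y)\<^sup>2 \<partial>P x) \<le> B * (\<Sum>k\<in>L. (c k)\<^sup>2)"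
proof -
  note o = integral_square_orthonormal[where b=b and L=L and M=lborel, OF fin integrable_bb b_orth]
  have "(\<integral>y. (\<Sum>k\<in>L. c k * b k y)\<^sup>2 \<partial>P x) \<le> B * (\<integral>y. (\<Sum>k\<in>L. c k * b k y)\<^sup>2 \<partial>lborel)"
    unfolding P_density
    by (intro integral_density_bounded_le \<pi>_meas \<pi>_nonneg assms)
       (use b_meas b_supp o in auto)
  then show ?thesis by (simp add: o)
qed

lemma square_sum_le: "(\<Sum>l\<in>L. t l * a l x)\<^sup>2 \<le> R * (\<Sum>l\<in>L. (t l)\<^sup>2)"
proof -
  have "(\<Sum>l\<in>L. t l * a l x)\<^sup>2 \<le> (\<Sum>l\<in>L. (t l)\<^sup>2) * (\<Sum>l\<in>L. (a l x)\<^sup>2)" by (rule Cauchy_Schwarz_ineq_sum)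
  also have "\<dots> \<le> (\<Sum>l\<in>L. (t l)\<^sup>2) * R" by (intro mult_left_mono a_bound sum_nonneg) auto
  finally show ?thesis by (simp add: mult.commute)
qed

abbreviation "\<Phi> \<equiv> tensor a b"
abbreviation "I \<equiv> L \<times> L"

lemma bounded_\<Phi>: "j \<in> I \<Longrightarrow> bounded_meas borel (\<Phi> j)"
  unfolding tensor_def[abs_def]
  by (intro bounded_meas_mult bounded_meas_comp[OF bounded_a] bounded_meas_comp[OF bounded_b])
     (auto simp: borel_prod[symmetric])

definition F :: "'l \<times> 'l \<Rightarrow> real \<Rightarrow> real" where "F j = step_op P (\<Phi> j)"

lemma bounded_F: "j \<in> I \<Longrightarrow> bounded_meas borel (F j)"
  unfolding F_def by (rule bounded_step_op[OF bounded_\<Phi>])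

lemma bounded_linear_\<Phi>: "bounded_meas borel (\<lambda>z. \<Sum>j\<in>I. t j * \<Phi> j z)"
  by (intro bounded_meas_sum bounded_meas_mult bounded_meas_const bounded_\<Phi>)

text \<open>
  Once \<open>x\<close> is fixed, a combination of the \<open>\<Phi> j\<close> is a combination of the orthonormal functions
  \<open>b k\<close> with coefficients \<open>\<Sum>l. t (l, k) * a l x\<close>. Only the factor \<open>a\<close> contributes a power of
  \<open>R\<close>, that is, of the dimension; integrating out the other factor costs the constant \<open>B\<close>.
\<close>

lemma one_step_variance:
  "step_op P (\<lambda>z. (\<Sum>j\<in>I. t j * \<Phi> j z)\<^sup>2) x \<le> B * R * (\<Sum>j\<in>I. (t j)\<^sup>2)"
proof (cases "good x")
  case True
  define c where "c k = (\<Sum>l\<in>L. t (l, k) * a l x)" for k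
  have "(\<Sum>j\<in>I. t j * \<Phi> j (x, y)) = (\<Sum>k\<in>L. c k * b k y)" for y
    unfolding c_def sum_distrib_right
    by (subst sum.swap) (simp add: sum.cartesian_product tensor_def case_prod_beta' mult_ac)
  then have "step_op P (\<lambda>z. (\<Sum>j\<in>I. t j * \<Phi> j z)\<^sup>2) x \<le> B * (\<Sum>k\<in>L. (c k)\<^sup>2)"
    using one_step_square_le[OF True, of c] by (simp add: step_op_def)
  also have "\<dots> \<le> B * (\<Sum>k\<in>L. R * (\<Sum>l\<in>L. (t (l, k))\<^sup>2))"
    unfolding c_def using B by (intro mult_left_mono sum_mono square_sum_le) auto
  also have "(\<Sum>k\<in>L. R * (\<Sum>l\<in>L. (t (l, k))\<^sup>2)) = R * (\<Sum>j\<in>I. (t j)\<^sup>2)"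
    unfolding sum_distrib_left[symmetric]
    by (subst sum.swap) (simp add: sum.cartesian_product case_prod_beta')
  finally show ?thesis by (simp add: mult.assoc)
next
  case False
  then have "a l x = 0" if "l \<in> L" for l using a_good[OF that] by blast
  then have "\<Phi> j (x, y) = 0" if "j \<in> I" for j y using that by (auto simp: tensor_def)
  then show ?thesis using B R by (simp add: step_op_def sum_nonneg)
qed

text \<open>
  The vector \<open>p\<close> of the conditional means of the \<open>b k\<close> has squared length \<open>s\<close> equal to the mean
  of a combination of the \<open>b k\<close> with coefficients \<open>p\<close>. The second moment of that combination is
  at most \<open>B s\<close>, so \<open>s\<^sup>2 \<le> B s\<close>. A Bessel inequality of this kind saves a factor \<open>R\<close> compared
  with the trivial bound \<open>R\<^sup>2\<close>.
\<close>

lemma F_square_sum: "(\<Sum>j\<in>I. (F j x)\<^sup>2) \<le> R * B"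
proof (cases "good x")
  case True
  interpret Px: prob_space "P x" by (rule prob_P)
  define p where "p k = (\<integral>y. b k y \<partial>P x)" for k
  define s where "s = (\<Sum>k\<in>L. (p k)\<^sup>2)"
  have s0: "0 \<le> s" by (simp add: s_def sum_nonneg)
  have "s = (\<integral>y. (\<Sum>k\<in>L. p k * b k y) \<partial>P x)"
    by (subst Bochner_Integration.integral_sum)
       (auto simp: s_def p_def power2_eq_square intro!: integrable_P bounded_b bounded_meas_cmult)
  moreover have "bounded_meas (P x) (\<lambda>y. \<Sum>k\<in>L. p k * b k y)"
    by (intro bounded_meas_P bounded_meas_sum bounded_meas_cmult bounded_b)
  ultimately have "s\<^sup>2 \<le> (\<integral>y. (\<Sum>k\<in>L. p k * b k y)\<^sup>2 \<partial>P x)"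
    using Px.square_expectation_le by metis
  also have "\<dots> \<le> B * s" unfolding s_def by (rule one_step_square_le[OF True])
  finally have "s * s \<le> B * s" by (simp add: power2_eq_square)
  then have sB: "s \<le> B" using s0 B by (cases "s = 0") auto
  have "(\<Sum>j\<in>I. (F j x)\<^sup>2) = (\<Sum>l\<in>L. (a l x)\<^sup>2) * s"
    unfolding s_def p_def F_def step_op_def
    by (simp add: tensor_def power_mult_distrib sum_product sum.cartesian_product case_prod_beta')
  also have "\<dots> \<le> R * B" using s0 sB R by (intro mult_mono a_bound) auto
  finally show ?thesis .
next
  case False
  then have "a l x = 0" if "l \<in> L" for l using a_good[OF that] by blast
  then have "\<Phi> j (x, y) = 0" if "j \<in> I" for j y using that by (auto simp: tensor_def)
  then show ?thesis using B R by (simp add: F_def step_op_def)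
qed

definition \<psi> :: "'l \<times> 'l \<Rightarrow> real \<times> real \<Rightarrow> real" where "\<psi> j z = \<Phi> j z - F j (fst z)"

lemma bounded_\<psi>: "j \<in> I \<Longrightarrow> bounded_meas borel (\<psi> j)"
  unfolding \<psi>_def[abs_def]
  by (intro bounded_meas_diff bounded_\<Phi> bounded_meas_comp[OF bounded_F]) (auto simp: borel_prod[symmetric])

lemma \<psi>_mart: "j \<in> I \<Longrightarrow> step_op P (\<psi> j) x = 0"
  using prob_space.prob_space[OF prob_P]
  by (simp add: step_op_def \<psi>_def F_def integrable_P bounded_meas_Pair bounded_\<Phi>)

lemma \<psi>_bound: "(\<Sum>j\<in>I. (\<psi> j z)\<^sup>2) \<le> 4 * R\<^sup>2"
proof -
  have \<Phi>b: "(\<Sum>j\<in>I. (\<Phi> j z)\<^sup>2) \<le> R\<^sup>2" for z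
    unfolding sum_tensor_square power2_eq_square[of R] using R
    by (intro mult_mono a_bound b_bound sum_nonneg) auto
  have Fb: "(\<Sum>j\<in>I. (F j x)\<^sup>2) \<le> R\<^sup>2" for x
  proof -
    interpret Px: prob_space "P x" by (rule prob_P)
    have "(\<Sum>j\<in>I. (F j x)\<^sup>2) \<le> (\<Sum>j\<in>I. \<integral>y. (\<Phi> j (x, y))\<^sup>2 \<partial>P x)"
      unfolding F_def step_op_def
      by (intro sum_mono Px.square_expectation_le bounded_meas_P bounded_meas_Pair bounded_\<Phi>)
    also have "\<dots> = (\<integral>y. (\<Sum>j\<in>I. (\<Phi> j (x, y))\<^sup>2) \<partial>P x)"
      by (intro Bochner_Integration.integral_sum[symmetric] integrable_P bounded_meas_power bounded_meas_Pair bounded_\<Phi>)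
    also have "\<dots> \<le> R\<^sup>2"
      by (intro Px.integral_le_const integrable_P bounded_meas_sum bounded_meas_power bounded_meas_Pair bounded_\<Phi> AE_I2 \<Phi>b)
    finally show ?thesis .
  qed
  have "(\<Sum>j\<in>I. (\<psi> j z)\<^sup>2) \<le> (\<Sum>j\<in>I. 2 * (\<Phi> j z)\<^sup>2 + 2 * (F j (fst z))\<^sup>2)"
  proof (rule sum_mono)
    fix j
    show "(\<psi> j z)\<^sup>2 \<le> 2 * (\<Phi> j z)\<^sup>2 + 2 * (F j (fst z))\<^sup>2"
      using sum_squares_bound[of "\<Phi> j z" "- F j (fst z)"] by (simp add: \<psi>_def power2_diff)
  qed
  also have "\<dots> = 2 * (\<Sum>j\<in>I. (\<Phi> j z)\<^sup>2) + 2 * (\<Sum>j\<in>I. (F j (fst z))\<^sup>2)"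
    by (simp add: sum.distrib sum_distrib_left)
  also have "\<dots> \<le> 4 * R\<^sup>2" using \<Phi>b[of z] Fb[of "fst z"] by simp
  finally show ?thesis .
qed

lemma \<psi>_variance: "step_op P (\<lambda>z. (\<Sum>j\<in>I. t j * \<psi> j z)\<^sup>2) x \<le> B * R * (\<Sum>j\<in>I. (t j)\<^sup>2)"
proof -
  interpret Px: prob_space "P x" by (rule prob_P)
  define u where "u y = (\<Sum>j\<in>I. t j * \<Phi> j (x, y))" for y
  define m where "m = (\<Sum>j\<in>I. t j * F j x)"
  have bu: "bounded_meas borel u" unfolding u_def[abs_def] by (rule bounded_meas_Pair[OF bounded_linear_\<Phi>])
  have m: "m = (\<integral>y. u y \<partial>P x)"
    unfolding m_def u_def F_def step_op_def
    by (subst Bochner_Integration.integral_sum)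
       (auto intro!: integrable_P bounded_meas_cmult bounded_meas_Pair bounded_\<Phi>)
  have iu: "integrable (P x) u" "integrable (P x) (\<lambda>y. (u y)\<^sup>2)"
    by (intro integrable_P bounded_meas_power bu)+
  have "step_op P (\<lambda>z. (\<Sum>j\<in>I. t j * \<psi> j z)\<^sup>2) x = (\<integral>y. (u y - m)\<^sup>2 \<partial>P x)"
    unfolding step_op_def
    by (intro Bochner_Integration.integral_cong refl)
       (simp add: u_def m_def \<psi>_def right_diff_distrib sum_subtractf)
  also have "\<dots> = (\<integral>y. (u y)\<^sup>2 - 2 * m * u y + m\<^sup>2 \<partial>P x)"
    by (intro Bochner_Integration.integral_cong) (auto simp: power2_diff)
  also have "\<dots> = (\<integral>y. (u y)\<^sup>2 \<partial>P x) - m\<^sup>2"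
    using iu Px.prob_space by (simp add: m[symmetric] power2_eq_square)
  also have "\<dots> \<le> step_op P (\<lambda>z. (\<Sum>j\<in>I. t j * \<Phi> j z)\<^sup>2) x"
    by (simp add: step_op_def u_def)
  also have "\<dots> \<le> B * R * (\<Sum>j\<in>I. (t j)\<^sup>2)" by (rule one_step_variance)
  finally show ?thesis .
qed

lemma integral_F: "j \<in> I \<Longrightarrow> (\<integral>x. F j x \<partial>\<mu>) = (\<integral>\<omega>. \<Phi> j (X 1 \<omega>, X 2 \<omega>) \<partial>M)"
  using one_step[of 1 "\<lambda>_. 1" "\<Phi> j"] expectation_X[OF bounded_F, of j 1] bounded_\<Phi>[of j]
  by (simp add: F_def numeral_2_eq_2)

text \<open>
  In the threshold, \<open>8 N R\<^sup>2\<close> absorbs the sum of the squared martingale differences, and each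
  of the two summands \<open>\<tau>\<close> is for one of the two parts of the decomposition.
\<close>

lemma fluctuation_excess:
  assumes K: "(\<integral>\<omega>. (L2_set (\<lambda>j. \<Sum>i<N. F j (X (Suc i) \<omega>) - (\<integral>y. F j y \<partial>\<mu>)) I) ^ 8 \<partial>M) \<le> K"
    and \<tau>: "0 < \<tau>"
  shows "(\<integral>\<omega>. max 0 (deviation I \<Phi> N \<omega> - (8 * real N * R\<^sup>2 + 2 * \<tau>)) \<partial>M)
    \<le> 4 ^ 8 * (500 * exp 500 * (1000 * exp 500)
        * (real N ^ 8 * (B * R) ^ 4 * (4 * R\<^sup>2) ^ 4 + real N ^ 5 * (4 * R\<^sup>2) ^ 8)) / \<tau> ^ 7 + 16 * K / \<tau> ^ 3"
proof -
  define Q where "Q = square_mart I \<psi> N"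
  define U where "U = deviation I \<Phi> N"
  have bounded_U: "bounded_meas M U" unfolding U_def by (rule bounded_deviation[OF bounded_\<Phi>])
  define w where "w \<omega> = L2_set (\<lambda>j. \<Sum>i<N. F j (X (Suc i) \<omega>) - (\<integral>y. F j y \<partial>\<mu>)) I" for \<omega>
  have w2: "(\<Sum>j\<in>I. (\<Sum>i<N. F j (X (Suc i) \<omega>) - (\<integral>y. F j y \<partial>\<mu>))\<^sup>2) = (w \<omega>)\<^sup>2" for \<omega>
    by (simp add: w_def L2_set_def sum_nonneg)
  have bQ: "bounded_meas M Q"
    unfolding Q_def by (rule bounded_meas_past[OF bounded_square_mart_past[OF bounded_\<psi>]])
  have bw: "bounded_meas M (\<lambda>\<omega>. w \<omega> ^ 8)"
    unfolding w_def L2_set_eighth by (intro bounded_meas_intros bounded_X bounded_F)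
  have pw: "max 0 (U \<omega> - (8 * real N * R\<^sup>2 + 2 * \<tau>)) \<le> (4 * Q \<omega>) ^ 8 / \<tau> ^ 7 + (2 * (w \<omega>)\<^sup>2) ^ 4 / \<tau> ^ 3" for \<omega>
  proof -
    have "U \<omega> = (\<Sum>j\<in>I. (path_sum (\<psi> j) N \<omega> + (\<Sum>i<N. F j (X (Suc i) \<omega>) - (\<integral>y. F j y \<partial>\<mu>)))\<^sup>2)"
      unfolding U_def deviation_def path_sum_def sum.distrib[symmetric]
      by (intro sum.cong refl) (simp add: \<psi>_def integral_F)
    also have "\<dots> \<le> (\<Sum>j\<in>I. 2 * (path_sum (\<psi> j) N \<omega>)\<^sup>2 + 2 * (\<Sum>i<N. F j (X (Suc i) \<omega>) - (\<integral>y. F j y \<partial>\<mu>))\<^sup>2)"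
    proof (rule sum_mono)
      fix j
      show "(path_sum (\<psi> j) N \<omega> + (\<Sum>i<N. F j (X (Suc i) \<omega>) - (\<integral>y. F j y \<partial>\<mu>)))\<^sup>2
        \<le> 2 * (path_sum (\<psi> j) N \<omega>)\<^sup>2 + 2 * (\<Sum>i<N. F j (X (Suc i) \<omega>) - (\<integral>y. F j y \<partial>\<mu>))\<^sup>2"
        using sum_squares_bound[of "path_sum (\<psi> j) N \<omega>" "\<Sum>i<N. F j (X (Suc i) \<omega>) - (\<integral>y. F j y \<partial>\<mu>)"]
        by (simp add: power2_sum)
    qed
    also have "\<dots> = 2 * (\<Sum>j\<in>I. (path_sum (\<psi> j) N \<omega>)\<^sup>2) + 2 * (w \<omega>)\<^sup>2"
      by (simp add: sum.distrib sum_distrib_left w2[symmetric])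
    also have "(\<Sum>j\<in>I. (path_sum (\<psi> j) N \<omega>)\<^sup>2) \<le> 2 * Q \<omega> + (\<Sum>i<N. 4 * R\<^sup>2)"
      unfolding square_path_sum Q_def by (intro add_left_mono sum_mono \<psi>_bound)
    finally have U: "U \<omega> - (8 * real N * R\<^sup>2 + 2 * \<tau>) \<le> (4 * Q \<omega> - \<tau>) + (2 * (w \<omega>)\<^sup>2 - \<tau>)"
      by simp
    also have "\<dots> \<le> (4 * Q \<omega>) ^ 8 / \<tau> ^ 7 + (2 * (w \<omega>)\<^sup>2) ^ 4 / \<tau> ^ 3"
      using excess_le_power[OF \<tau>, of 7 "4 * Q \<omega>"] excess_le_power[OF \<tau>, of 3 "2 * (w \<omega>)\<^sup>2"]
      by (intro add_mono) simp_all
    finally show ?thesis using \<tau> by simp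
  qed
  have "(\<integral>\<omega>. max 0 (U \<omega> - (8 * real N * R\<^sup>2 + 2 * \<tau>)) \<partial>M)
    \<le> (\<integral>\<omega>. 4 ^ 8 / \<tau> ^ 7 * Q \<omega> ^ 8 + 16 / \<tau> ^ 3 * w \<omega> ^ 8 \<partial>M)"
  proof (rule integral_mono)
    have "max 0 (U \<omega> - (8 * real N * R\<^sup>2 + 2 * \<tau>))
      = ((U \<omega> - (8 * real N * R\<^sup>2 + 2 * \<tau>)) + \<bar>U \<omega> - (8 * real N * R\<^sup>2 + 2 * \<tau>)\<bar>) * (1 / 2)" for \<omega>
      by (simp add: max_def abs_if)
    then show "integrable M (\<lambda>\<omega>. max 0 (U \<omega> - (8 * real N * R\<^sup>2 + 2 * \<tau>)))"
      by (simp only:) (intro bounded_meas_integrable bounded_meas_intros bounded_U)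
    show "integrable M (\<lambda>\<omega>. 4 ^ 8 / \<tau> ^ 7 * Q \<omega> ^ 8 + 16 / \<tau> ^ 3 * w \<omega> ^ 8)"
      by (intro bounded_meas_integrable bounded_meas_add bounded_meas_cmult bw bounded_meas_power[OF bQ])
    show "max 0 (U \<omega> - (8 * real N * R\<^sup>2 + 2 * \<tau>)) \<le> 4 ^ 8 / \<tau> ^ 7 * Q \<omega> ^ 8 + 16 / \<tau> ^ 3 * w \<omega> ^ 8" for \<omega>
      using pw[of \<omega>] by (simp add: power_mult_distrib flip: power_mult)
  qed
  also have "\<dots> = 4 ^ 8 / \<tau> ^ 7 * (\<integral>\<omega>. Q \<omega> ^ 8 \<partial>M) + 16 / \<tau> ^ 3 * (\<integral>\<omega>. w \<omega> ^ 8 \<partial>M)"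
    using bounded_meas_integrable[OF bw] bounded_meas_integrable[OF bounded_meas_power[OF bQ, of 8]] by simp
  also have "\<dots> \<le> 4 ^ 8 / \<tau> ^ 7 * (500 * exp 500 * (1000 * exp 500)
        * (real N ^ 8 * (B * R) ^ 4 * (4 * R\<^sup>2) ^ 4 + real N ^ 5 * (4 * R\<^sup>2) ^ 8)) + 16 / \<tau> ^ 3 * K"
    unfolding Q_def
  proof (intro add_mono mult_left_mono)
    show "(\<integral>\<omega>. (square_mart I \<psi> N \<omega>) ^ 8 \<partial>M) \<le> 500 * exp 500 * (1000 * exp 500)
        * (real N ^ 8 * (B * R) ^ 4 * (4 * R\<^sup>2) ^ 4 + real N ^ 5 * (4 * R\<^sup>2) ^ 8)"
      using B R by (intro square_mart_eighth_moment bounded_\<psi> \<psi>_mart \<psi>_bound \<psi>_variance) auto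
    show "(\<integral>\<omega>. w \<omega> ^ 8 \<partial>M) \<le> K" using K by (simp add: w_def)
  qed (use \<tau> in auto)
  finally show ?thesis by (simp add: U_def)
qed

end

text \<open>
  The two bounds of \<open>fluctuation_excess\<close> with \<open>R = r\<^sup>2 D\<close> and \<open>\<tau> = D\<^sup>2 n\<close>. The summand with
  \<open>n\<^sup>5 D\<^bsup>16\<^esup>\<close> is brought below \<open>n\<^sup>8 D\<^bsup>12\<^esup>\<close> by \<open>D\<^sup>4 \<le> 2 n\<close>; division by \<open>\<tau>\<^sup>7\<close>, respectively by
  \<open>\<tau>\<^sup>3\<close> for the second bound, then leaves \<open>n / D\<^sup>2\<close>.
\<close>

lemma excess_bound_arith:
  fixes D n B r K C :: real
  assumes D: "1 \<le> D" and n: "1 \<le> n" and Dn: "D ^ 4 \<le> 2 * n" and B: "0 < B" and r: "0 < r" and C: "0 \<le> C"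
  shows "4 ^ 8 * (C * (n ^ 8 * (B * (r\<^sup>2 * D)) ^ 4 * (4 * (r\<^sup>2 * D)\<^sup>2) ^ 4 + n ^ 5 * (4 * (r\<^sup>2 * D)\<^sup>2) ^ 8)) / (D\<^sup>2 * n) ^ 7
      + 16 * (K * (n ^ 4 * (r\<^sup>2 * D * B) ^ 4)) / (D\<^sup>2 * n) ^ 3
    \<le> (4 ^ 8 * C * (4 ^ 4 * B ^ 4 * r ^ 24 + 2 * 4 ^ 8 * r ^ 32) + 16 * K * r ^ 8 * B ^ 4) * (n / D\<^sup>2)"
proof -
  have "n ^ 5 * D ^ 16 \<le> 2 * (n ^ 8 * D ^ 12)"
  proof -
    have "n ^ 5 * D ^ 16 = n ^ 5 * D ^ 12 * D ^ 4" by (simp flip: power_add)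
    also have "\<dots> \<le> n ^ 5 * D ^ 12 * (2 * n)" using D n by (intro mult_left_mono Dn) auto
    also have "\<dots> = 2 * (n ^ 6 * D ^ 12)" by (simp add: eval_nat_numeral)
    also have "\<dots> \<le> 2 * (n ^ 8 * D ^ 12)"
      using D n by (intro mult_left_mono mult_right_mono power_increasing) auto
    finally show ?thesis .
  qed
  then have "4 ^ 8 * r ^ 32 * (n ^ 5 * D ^ 16) \<le> 4 ^ 8 * r ^ 32 * (2 * (n ^ 8 * D ^ 12))"
    by (intro mult_left_mono) auto
  then have "n ^ 8 * (B * (r\<^sup>2 * D)) ^ 4 * (4 * (r\<^sup>2 * D)\<^sup>2) ^ 4 + n ^ 5 * (4 * (r\<^sup>2 * D)\<^sup>2) ^ 8
     \<le> (4 ^ 4 * B ^ 4 * r ^ 24 + 2 * 4 ^ 8 * r ^ 32) * (n ^ 8 * D ^ 12)"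
    by (simp add: power_mult_distrib algebra_simps flip: power_mult power_add)
  then have "4 ^ 8 * (C * (n ^ 8 * (B * (r\<^sup>2 * D)) ^ 4 * (4 * (r\<^sup>2 * D)\<^sup>2) ^ 4 + n ^ 5 * (4 * (r\<^sup>2 * D)\<^sup>2) ^ 8)) / (D\<^sup>2 * n) ^ 7
    \<le> 4 ^ 8 * (C * ((4 ^ 4 * B ^ 4 * r ^ 24 + 2 * 4 ^ 8 * r ^ 32) * (n ^ 8 * D ^ 12))) / (D\<^sup>2 * n) ^ 7"
    using D n C by (intro divide_right_mono mult_left_mono) auto
  also have "\<dots> = 4 ^ 8 * C * (4 ^ 4 * B ^ 4 * r ^ 24 + 2 * 4 ^ 8 * r ^ 32) * ((n ^ 8 * D ^ 12) / (D\<^sup>2 * n) ^ 7)"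
    by simp
  also have "(n ^ 8 * D ^ 12) / (D\<^sup>2 * n) ^ 7 = n / D\<^sup>2"
    using D n by (simp add: power_mult_distrib field_simps flip: power_mult power_add power_Suc power_Suc2)
  finally have 1: "4 ^ 8 * (C * (n ^ 8 * (B * (r\<^sup>2 * D)) ^ 4 * (4 * (r\<^sup>2 * D)\<^sup>2) ^ 4 + n ^ 5 * (4 * (r\<^sup>2 * D)\<^sup>2) ^ 8)) / (D\<^sup>2 * n) ^ 7
    \<le> 4 ^ 8 * C * (4 ^ 4 * B ^ 4 * r ^ 24 + 2 * 4 ^ 8 * r ^ 32) * (n / D\<^sup>2)" .
  have "16 * (K * (n ^ 4 * (r\<^sup>2 * D * B) ^ 4)) / (D\<^sup>2 * n) ^ 3 = 16 * K * r ^ 8 * B ^ 4 * ((n ^ 4 * D ^ 4) / (D\<^sup>2 * n) ^ 3)"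
    by (simp add: power_mult_distrib flip: power_mult)
  also have "(n ^ 4 * D ^ 4) / (D\<^sup>2 * n) ^ 3 = n / D\<^sup>2"
    using D n by (simp add: power_mult_distrib field_simps flip: power_mult power_add power_Suc power_Suc2)
  finally show ?thesis using 1 by (simp add: algebra_simps)
qed

text \<open>
  The value \<open>r\<^sup>2 card L\<close> of \<open>R\<close> is the one that the connection between the norms provides. With
  \<open>D = card L\<close> and \<open>N = n - 1\<close>, the condition \<open>D\<^sup>4 \<le> 2 N\<close> follows from \<open>D\<^sup>2 \<le> \<surd>n\<close> because
  \<open>n \<le> 2 N\<close>.
\<close>

definition (in stationary_chain) excess_bounded ::
    "(real \<Rightarrow> real \<Rightarrow> real) \<Rightarrow> real \<Rightarrow> real \<Rightarrow> real \<Rightarrow> 'l set \<Rightarrow> bool" where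
  "excess_bounded \<pi> B r C L \<longleftrightarrow>
     (\<forall>a b N. tensor_basis M P X \<mu> \<pi> B (r\<^sup>2 * real (card L)) L a b \<longrightarrow> 1 \<le> card L \<longrightarrow>
        real (card L) ^ 4 \<le> 2 * real N \<longrightarrow> 1 \<le> N \<longrightarrow>
        (\<integral>\<omega>. max 0 (deviation (L \<times> L) (tensor a b) N \<omega> - (8 * r ^ 4 + 2) * (real (card L))\<^sup>2 * real N) \<partial>M)
          \<le> C * (real N / (real (card L))\<^sup>2))"

lemma (in stationary_chain) fluctuation_constant:
  assumes mix: "geometric_mixing P \<mu>" and B: "0 < B" and r: "0 < r"
  shows "\<exists>C\<ge>0. \<forall>L :: 'l set. excess_bounded \<pi> B r C L"
proof -
  obtain K0 where K0: "\<And>(I :: ('l \<times> 'l) set) F \<beta> N. finite I \<Longrightarrow> \<forall>j\<in>I. bounded_meas borel (F j) \<Longrightarrow>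
     \<forall>x. L2_set (\<lambda>j. F j x) I \<le> \<beta> \<Longrightarrow> 0 < \<beta> \<Longrightarrow> 1 \<le> N \<Longrightarrow>
     (\<integral>\<omega>. (L2_set (\<lambda>j. \<Sum>i<N. F j (X (Suc i) \<omega>) - (\<integral>y. F j y \<partial>\<mu>)) I) ^ 8 \<partial>M) \<le> K0 * (real N ^ 4 * \<beta> ^ 8)"
    using additive_functional_eighth_moment[OF mix, where 'i="'l \<times> 'l"] by blast
  define K where "K = max K0 0"
  define c where "c = 500 * exp 500 * (1000 * exp (500::real))"
  define C where "C = 4 ^ 8 * c * (4 ^ 4 * B ^ 4 * r ^ 24 + 2 * 4 ^ 8 * r ^ 32) + 16 * K * r ^ 8 * B ^ 4"
  have c0: "0 \<le> c" by (simp add: c_def)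
  have "0 \<le> C" using B r by (simp add: C_def c_def K_def)
  moreover have "(\<integral>\<omega>. max 0 (deviation (L \<times> L) (tensor a b) N \<omega>
        - (8 * r ^ 4 + 2) * (real (card L))\<^sup>2 * real N) \<partial>M) \<le> C * (real N / (real (card L))\<^sup>2)"
    if tb: "tensor_basis M P X \<mu> \<pi> B (r\<^sup>2 * real (card L)) L a b" and L: "1 \<le> card L"
      and LN: "real (card L) ^ 4 \<le> 2 * real N" and N: "1 \<le> N" for L :: "'l set" and a b N
  proof -
    interpret tb: tensor_basis M P X \<mu> \<pi> B "r\<^sup>2 * real (card L)" L a b by (rule tb)
    define D where "D = real (card L)"
    define R where "R = r\<^sup>2 * D"
    have D: "1 \<le> D" using L by (simp add: D_def)
    have N': "1 \<le> real N" using N by simp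
    have Kb: "(\<integral>\<omega>. (L2_set (\<lambda>j. \<Sum>i<N. tb.F j (X (Suc i) \<omega>) - (\<integral>y. tb.F j y \<partial>\<mu>)) (L \<times> L)) ^ 8 \<partial>M)
        \<le> K * (real N ^ 4 * (R * B) ^ 4)"
    proof -
      have Rp: "0 < R * B" using tb.R B by (simp add: R_def D_def)
      have "(\<integral>\<omega>. (L2_set (\<lambda>j. \<Sum>i<N. tb.F j (X (Suc i) \<omega>) - (\<integral>y. tb.F j y \<partial>\<mu>)) (L \<times> L)) ^ 8 \<partial>M)
          \<le> K0 * (real N ^ 4 * (sqrt (R * B)) ^ 8)"
        using tb.fin tb.bounded_F tb.F_square_sum Rp
        by (intro K0 N) (auto simp: L2_set_def R_def D_def)
      also have "(sqrt (R * B)) ^ 8 = ((sqrt (R * B))\<^sup>2) ^ 4" by (simp flip: power_mult)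
      also have "\<dots> = (R * B) ^ 4" using Rp by simp
      also have "K0 * (real N ^ 4 * (R * B) ^ 4) \<le> K * (real N ^ 4 * (R * B) ^ 4)"
        using Rp by (intro mult_right_mono) (auto simp: K_def)
      finally show ?thesis .
    qed
    have "0 < D\<^sup>2 * real N" using D N' by simp
    from tb.fluctuation_excess[OF Kb this]
    have "(\<integral>\<omega>. max 0 (deviation (L \<times> L) (tensor a b) N \<omega> - (8 * real N * R\<^sup>2 + 2 * (D\<^sup>2 * real N))) \<partial>M)
      \<le> 4 ^ 8 * (c * (real N ^ 8 * (B * R) ^ 4 * (4 * R\<^sup>2) ^ 4 + real N ^ 5 * (4 * R\<^sup>2) ^ 8)) / (D\<^sup>2 * real N) ^ 7
        + 16 * (K * (real N ^ 4 * (R * B) ^ 4)) / (D\<^sup>2 * real N) ^ 3"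
      unfolding c_def R_def D_def .
    also have "\<dots> \<le> C * (real N / D\<^sup>2)"
      unfolding C_def R_def
      by (rule excess_bound_arith[OF D N' _ B r c0]) (use LN in \<open>simp add: D_def\<close>)
    also have "8 * real N * R\<^sup>2 + 2 * (D\<^sup>2 * real N) = (8 * r ^ 4 + 2) * D\<^sup>2 * real N"
      by (simp add: R_def power_mult_distrib algebra_simps flip: power_mult)
    finally show ?thesis by (simp add: D_def)
  qed
  ultimately show ?thesis unfolding excess_bounded_def by blast
qed

section \<open>Model bases\<close>

text \<open>
  Properties of almost every real number hold for both coordinates of almost every point of the
  plane; in this form they pass to consecutive observations, whose joint law has a density.
\<close>

lemma AE_lborel_fst_snd:
  assumes "AE x in lborel. Q (x::real)"
  shows "AE z in lborel. Q (fst (z::real\<times>real))" "AE z in lborel. Q (snd (z::real\<times>real))"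
proof -
  obtain N where N: "{x \<in> space lborel. \<not> Q x} \<subseteq> N" "emeasure lborel N = 0" "N \<in> sets lborel"
    using AE_E[OF assms] by blast
  have QN: "Q x" if "x \<notin> N" for x using N(1) that by auto
  have Nb[measurable]: "N \<in> sets borel" using N(3) by simp
  have N0: "AE x in lborel. x \<notin> N" using N by (intro AE_not_in) (simp add: null_sets_def)
  have "AE x in lborel. AE y in lborel. fst (x, y :: real) \<notin> N"
    using N0 by eventually_elim simp
  then have f: "AE z in lborel \<Otimes>\<^sub>M lborel. fst (z :: real \<times> real) \<notin> N"
    by (intro lborel_pair.AE_pair_measure) measurable
  have "AE x in lborel. AE y in lborel. snd (x :: real, y) \<notin> N"
    using N0 by (rule_tac AE_I2) simp
  then have s: "AE z in lborel \<Otimes>\<^sub>M lborel. snd (z :: real \<times> real) \<notin> N"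
    by (intro lborel_pair.AE_pair_measure) measurable
  show "AE z in lborel. Q (fst (z::real\<times>real))"
    using f unfolding lborel_prod by eventually_elim (rule QN)
  show "AE z in lborel. Q (snd (z::real\<times>real))"
    using s unfolding lborel_prod by eventually_elim (rule QN)
qed

lemma transition_density_bounded:
  assumes "has_transition_density P \<pi>" "sup_norm unit_square (\<lambda>(x, y). \<pi> x y) < \<infinity>"
  shows "\<exists>B>0. AE x in lborel. x \<in> {0..1} \<longrightarrow> (AE y in lborel. y \<in> {0..1} \<longrightarrow> \<pi> x y \<le> B)"
proof -
  let ?s = "sup_norm unit_square (\<lambda>(x, y). \<pi> x y)"
  obtain B where B: "?s \<le> ereal B"
    using assms(2) by (cases ?s) auto
  have "AE z in unit_square. ereal \<bar>(\<lambda>(x, y). \<pi> x y) z\<bar> \<le> ?s"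
    unfolding sup_norm_def by (rule esssup_AE)
  then have "AE z in unit_square. \<pi> (fst z) (snd z) \<le> max B 1"
  proof eventually_elim
    case (elim z)
    then have "ereal \<bar>(\<lambda>(x, y). \<pi> x y) z\<bar> \<le> ereal B" using B by (rule order_trans)
    then show ?case by (simp add: case_prod_beta')
  qed
  then have "AE z in lborel. z \<in> {0..1} \<times> {0..1} \<longrightarrow> \<pi> (fst z) (snd z) \<le> max B 1"
    by (subst (asm) AE_restrict_space_iff) (auto simp: borel_prod[symmetric])
  then have "AE x in lborel. AE y in lborel. (x, y) \<in> {0..1} \<times> {0..1} \<longrightarrow> \<pi> x y \<le> max B 1"
    unfolding lborel_prod[symmetric] by (drule_tac lborel_pair.AE_pair) simp
  then have "AE x in lborel. x \<in> {0..1} \<longrightarrow> (AE y in lborel. y \<in> {0..1} \<longrightarrow> \<pi> x y \<le> max B 1)"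
    by eventually_elim auto
  then show ?thesis by (intro exI[of _ "max B 1"]) auto
qed

lemma square_integrable_mult:
  fixes u v :: "'a \<Rightarrow> real"
  assumes [measurable]: "u \<in> borel_measurable M" "v \<in> borel_measurable M"
    and "sq_norm M u < \<infinity>" "sq_norm M v < \<infinity>"
  shows "integrable M (\<lambda>x. u x * v x)"
proof (rule Bochner_Integration.integrable_bound)
  have "integrable M (\<lambda>x. (u x)\<^sup>2)" "integrable M (\<lambda>x. (v x)\<^sup>2)"
    using assms(3,4) unfolding sq_norm_def by (intro integrableI_bounded; simp)+
  then show "integrable M (\<lambda>x. (u x)\<^sup>2 + (v x)\<^sup>2)" by (rule Bochner_Integration.integrable_add)
  show "AE x in M. norm (u x * v x) \<le> norm ((u x)\<^sup>2 + (v x)\<^sup>2)"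
  proof (rule AE_I2)
    fix x
    have "2 * (\<bar>u x\<bar> * \<bar>v x\<bar>) \<le> (u x)\<^sup>2 + (v x)\<^sup>2"
      using sum_squares_bound[of "\<bar>u x\<bar>" "\<bar>v x\<bar>"] by (simp add: mult.assoc)
    moreover have "0 \<le> \<bar>u x\<bar> * \<bar>v x\<bar>" by simp
    ultimately have "\<bar>u x\<bar> * \<bar>v x\<bar> \<le> (u x)\<^sup>2 + (v x)\<^sup>2" by linarith
    then show "norm (u x * v x) \<le> norm ((u x)\<^sup>2 + (v x)\<^sup>2)" by (simp add: abs_mult)
  qed
qed measurable

lemma L2_norm_eq:
  assumes "integrable M (\<lambda>x. (t x)\<^sup>2)"
  shows "sq_norm M t = ennreal (\<integral>x. (t x)\<^sup>2 \<partial>M)" "(L2_norm M t)\<^sup>2 = (\<integral>x. (t x)\<^sup>2 \<partial>M)"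
    "L2_norm M t = sqrt (\<integral>x. (t x)\<^sup>2 \<partial>M)"
  using nn_integral_eq_integral[OF assms] by (simp_all add: sq_norm_def L2_norm_def)

lemma rational_sequence: "\<exists>f. (\<forall>k. f k \<in> \<rat>) \<and> f \<longlonglongrightarrow> (y::real)"
proof -
  have "\<exists>q\<in>\<rat>. y < q \<and> q < y + 1 / real (Suc k)" for k by (rule Rats_dense_in_real) simp
  then obtain f where f: "\<And>k. f k \<in> \<rat>" "\<And>k. y < f k" "\<And>k. f k < y + 1 / real (Suc k)" by metis
  have "(\<lambda>k. y + 1 / real (Suc k)) \<longlonglongrightarrow> y + 0"
    by (intro tendsto_add tendsto_const LIMSEQ_Suc[OF lim_1_over_n])
  then have "f \<longlonglongrightarrow> y"
    by (intro tendsto_sandwich[of "\<lambda>_. y" f sequentially "\<lambda>k. y + 1 / real (Suc k)"])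
       (auto intro!: always_eventually less_imp_le f simp del: of_nat_Suc)
  then show ?thesis using f(1) by blast
qed

text \<open>
  A linear form with coefficients \<open>v\<close> attains its norm in the direction \<open>v\<close>, which rational
  directions approximate.
\<close>

lemma square_sum_le_of_rational_bound:
  fixes v :: "'l \<Rightarrow> real"
  assumes fin: "finite L" and c: "0 \<le> c"
    and bd: "\<And>\<alpha>. \<alpha> \<in> PiE L (\<lambda>_. \<rat>) \<Longrightarrow> \<bar>\<Sum>l\<in>L. \<alpha> l * v l\<bar> \<le> c * sqrt (\<Sum>l\<in>L. (\<alpha> l)\<^sup>2)"
  shows "(\<Sum>l\<in>L. (v l)\<^sup>2) \<le> c\<^sup>2"
proof -
  have "\<forall>l. \<exists>f. (\<forall>k. f k \<in> \<rat>) \<and> f \<longlonglongrightarrow> v l" using rational_sequence by blast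
  from choice[OF this] obtain f where f: "\<And>l k. f l k \<in> \<rat>" "\<And>l. f l \<longlonglongrightarrow> v l" by blast
  define S where "S = (\<Sum>l\<in>L. (v l)\<^sup>2)"
  have S0: "0 \<le> S" by (simp add: S_def sum_nonneg)
  have "\<bar>\<Sum>l\<in>L. f l k * v l\<bar> \<le> c * sqrt (\<Sum>l\<in>L. (f l k)\<^sup>2)" for k
    using bd[of "restrict (\<lambda>l. f l k) L"] f(1) by (simp add: restrict_PiE_iff cong: sum.cong)
  moreover have "(\<lambda>k. \<bar>\<Sum>l\<in>L. f l k * v l\<bar>) \<longlonglongrightarrow> \<bar>\<Sum>l\<in>L. v l * v l\<bar>"
    by (intro tendsto_rabs tendsto_sum tendsto_mult tendsto_const f)
  moreover have "(\<lambda>k. c * sqrt (\<Sum>l\<in>L. (f l k)\<^sup>2)) \<longlonglongrightarrow> c * sqrt (\<Sum>l\<in>L. (v l)\<^sup>2)"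
    by (intro tendsto_mult tendsto_const tendsto_real_sqrt tendsto_sum tendsto_power f)
  ultimately have "\<bar>\<Sum>l\<in>L. v l * v l\<bar> \<le> c * sqrt (\<Sum>l\<in>L. (v l)\<^sup>2)" by (blast intro: LIMSEQ_le)
  then have "sqrt S * sqrt S \<le> c * sqrt S" using S0 by (simp add: S_def power2_eq_square)
  then have "sqrt S \<le> c"
    using S0 c mult_right_le_imp_le[of "sqrt S" "sqrt S" c] by (cases "S = 0") auto
  then have "(sqrt S)\<^sup>2 \<le> c\<^sup>2" using S0 by (intro power_mono) auto
  then show ?thesis using S0 by (simp add: S_def)
qed

text \<open>
  The connection between the norms bounds each function of the model outside a null set that
  depends on the function. Rational coefficients give a single null set, and at the remaining
  points the bound extends to real coefficients by continuity. The coefficients \<open>\<phi> m l x\<close>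
  themselves then give the claim.
\<close>

lemma model_basis_bound:
  fixes \<phi> :: "'m \<Rightarrow> 'l \<Rightarrow> real \<Rightarrow> real"
  assumes om: "orthonormal_models \<Lambda> \<phi>" and sc: "sup_norm_connected \<Lambda> \<phi> r\<^sub>0"
  shows "AE x in lborel. (\<Sum>l\<in>\<Lambda> m. (\<phi> m l x)\<^sup>2) \<le> (\<bar>r\<^sub>0\<bar> + 1)\<^sup>2 * real (card (\<Lambda> m))"
proof -
  have fin: "finite (\<Lambda> m)" and supp: "\<And>l x. l \<in> \<Lambda> m \<Longrightarrow> x \<notin> {0..1} \<Longrightarrow> \<phi> m l x = 0"
    and LL: "\<And>l. l \<in> \<Lambda> m \<Longrightarrow> \<phi> m l \<in> Linf_L2 unit_interval"
    and on: "\<And>l k. l \<in> \<Lambda> m \<Longrightarrow> k \<in> \<Lambda> m \<Longrightarrow> (\<integral>x. \<phi> m l x * \<phi> m k x \<partial>unit_interval) = (if l = k then 1 else 0)"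
    using om unfolding orthonormal_models_def by blast+
  define D where "D = real (card (\<Lambda> m))"
  have int: "integrable unit_interval (\<lambda>x. \<phi> m l x * \<phi> m k x)" if "l \<in> \<Lambda> m" "k \<in> \<Lambda> m" for l k
    using LL that by (intro square_integrable_mult) (auto simp: Linf_L2_def)
  note o = integral_square_orthonormal[where b="\<phi> m" and L="\<Lambda> m" and M=unit_interval, OF fin int on]
  define c where "c = \<bar>r\<^sub>0\<bar> * sqrt D"
  have bd: "AE x in unit_interval. \<bar>\<Sum>l\<in>\<Lambda> m. \<alpha> l * \<phi> m l x\<bar> \<le> c * sqrt (\<Sum>l\<in>\<Lambda> m. (\<alpha> l)\<^sup>2)" for \<alpha>
  proof (cases "\<exists>l\<in>\<Lambda> m. \<alpha> l \<noteq> 0")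
    case False
    then show ?thesis by simp
  next
    case True
    then have Dp: "0 < D" using fin by (auto simp: D_def card_gt_0_iff)
    define t where "t x = (\<Sum>l\<in>\<Lambda> m. \<alpha> l * \<phi> m l x)" for x
    define n where "n = sqrt (\<Sum>l\<in>\<Lambda> m. (\<alpha> l)\<^sup>2)"
    have n: "0 < n"
    proof -
      obtain l where l: "l \<in> \<Lambda> m" "\<alpha> l \<noteq> 0" using True by blast
      show ?thesis unfolding n_def real_sqrt_gt_0_iff
        using l(2) by (intro sum_pos2[OF fin l(1)]) auto
    qed
    have nt: "L2_norm unit_interval t = n"
      unfolding t_def[abs_def] n_def using o by (subst L2_norm_eq(3)) auto
    have "t \<noteq> (\<lambda>_. 0)"
    proof
      assume "t = (\<lambda>_. 0)"
      then have "L2_norm unit_interval t = 0" by (simp add: L2_norm_def sq_norm_def)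
      then show False using nt n by simp
    qed
    then have "t \<in> model_space \<Lambda> \<phi> m - {\<lambda>_. 0}"
      by (auto simp: model_space_def t_def[abs_def])
    then have "sup_norm unit_interval t / ereal (L2_norm unit_interval t) \<le>
        (SUP t\<in>model_space \<Lambda> \<phi> m - {\<lambda>_. 0}. sup_norm unit_interval t / ereal (L2_norm unit_interval t))"
      by (rule SUP_upper)
    then have "ereal (1 / sqrt D) * (sup_norm unit_interval t / ereal n) \<le> ereal (1 / sqrt D) *
        (SUP t\<in>model_space \<Lambda> \<phi> m - {\<lambda>_. 0}. sup_norm unit_interval t / ereal (L2_norm unit_interval t))"
      using Dp unfolding nt by (intro ereal_mult_left_mono) auto
    also have "\<dots> \<le> ereal r\<^sub>0" using sc by (simp add: sup_norm_connected_def model_dim_def D_def)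
    finally have le: "ereal (1 / sqrt D) * (sup_norm unit_interval t / ereal n) \<le> ereal r\<^sub>0" .
    have le2: "sup_norm unit_interval t \<le> ereal (r\<^sub>0 * sqrt D * n)"
    proof (cases "sup_norm unit_interval t")
      case (real s)
      then have "s / (sqrt D * n) \<le> r\<^sub>0" using le n by simp
      then show ?thesis using real Dp n by (simp add: pos_divide_le_eq mult_ac)
    next
      case PInf
      then show ?thesis using le n Dp by simp
    qed simp
    have "AE x in unit_interval. ereal \<bar>t x\<bar> \<le> sup_norm unit_interval t"
      unfolding sup_norm_def by (rule esssup_AE)
    then have "AE x in unit_interval. ereal \<bar>t x\<bar> \<le> ereal (r\<^sub>0 * sqrt D * n)"
      by eventually_elim (rule order_trans[OF _ le2])
    then show ?thesis
    proof eventually_elim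
      case (elim x)
      have "r\<^sub>0 * sqrt D * n \<le> c * n" using n Dp unfolding c_def by (intro mult_right_mono) auto
      then show ?case using elim by (simp add: t_def n_def)
    qed
  qed
  have "AE x in unit_interval. \<forall>\<alpha>\<in>PiE (\<Lambda> m) (\<lambda>_. \<rat>). \<bar>\<Sum>l\<in>\<Lambda> m. \<alpha> l * \<phi> m l x\<bar> \<le> c * sqrt (\<Sum>l\<in>\<Lambda> m. (\<alpha> l)\<^sup>2)"
    by (subst AE_ball_countable) (auto intro!: countable_PiE fin bd simp: countable_rat)
  then have "AE x in unit_interval. (\<Sum>l\<in>\<Lambda> m. (\<phi> m l x)\<^sup>2) \<le> c\<^sup>2"
    by eventually_elim (rule square_sum_le_of_rational_bound[OF fin], auto simp: c_def D_def)
  then have "AE x in lborel. x \<in> {0..1} \<longrightarrow> (\<Sum>l\<in>\<Lambda> m. (\<phi> m l x)\<^sup>2) \<le> c\<^sup>2"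
    by (subst (asm) AE_restrict_space_iff) auto
  then show ?thesis
  proof eventually_elim
    case (elim x)
    have "(\<Sum>l\<in>\<Lambda> m. (\<phi> m l x)\<^sup>2) \<le> c\<^sup>2" using elim supp[of _ x] by (cases "x \<in> {0..1}") auto
    also have "c\<^sup>2 = \<bar>r\<^sub>0\<bar>\<^sup>2 * D" by (simp add: c_def power_mult_distrib D_def)
    also have "\<dots> \<le> (\<bar>r\<^sub>0\<bar> + 1)\<^sup>2 * D" by (intro mult_right_mono power_mono) (auto simp: D_def)
    finally show ?case by (simp add: D_def)
  qed
qed

text \<open>
  Every property required in \<open>tensor_basis\<close> holds for the basis of a model up to null sets, so
  the basis is set to zero there.
\<close>

lemma (in stationary_chain) exists_tensor_basis:
  fixes \<phi> :: "'m \<Rightarrow> 'l \<Rightarrow> real \<Rightarrow> real"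
  assumes om: "orthonormal_models \<Lambda> \<phi>" and sc: "sup_norm_connected \<Lambda> \<phi> r\<^sub>0"
    and dens: "has_transition_density P \<pi>" and B: "0 < B"
    and good: "AE x in lborel. x \<in> {0..1} \<longrightarrow> (AE y in lborel. y \<in> {0..1} \<longrightarrow> \<pi> x y \<le> B)"
    and ne: "\<Lambda> m \<noteq> {}"
  shows "\<exists>a b. tensor_basis M P X \<mu> \<pi> B ((\<bar>r\<^sub>0\<bar> + 1)\<^sup>2 * real (card (\<Lambda> m))) (\<Lambda> m) a b \<and>
    (AE x in lborel. \<forall>l\<in>\<Lambda> m. a l x = \<phi> m l x \<and> b l x = \<phi> m l x)"
proof -
  have fin: "finite (\<Lambda> m)" and meas: "\<And>l. l \<in> \<Lambda> m \<Longrightarrow> \<phi> m l \<in> borel_measurable borel"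
    and supp: "\<And>l x. l \<in> \<Lambda> m \<Longrightarrow> x \<notin> {0..1} \<Longrightarrow> \<phi> m l x = 0"
    and on: "\<And>l k. l \<in> \<Lambda> m \<Longrightarrow> k \<in> \<Lambda> m \<Longrightarrow> (\<integral>x. \<phi> m l x * \<phi> m k x \<partial>unit_interval) = (if l = k then 1 else 0)"
    using om unfolding orthonormal_models_def by blast+
  define R where "R = (\<bar>r\<^sub>0\<bar> + 1)\<^sup>2 * real (card (\<Lambda> m))"
  have R: "0 < R"
  proof -
    have "0 < card (\<Lambda> m)" using fin ne by (simp add: card_gt_0_iff)
    moreover have "0 < (\<bar>r\<^sub>0\<bar> + 1)\<^sup>2" by (intro zero_less_power) linarith
    ultimately show ?thesis by (simp add: R_def)
  qed
  define E where "E = {x. (\<Sum>l\<in>\<Lambda> m. (\<phi> m l x)\<^sup>2) \<le> R}"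
  have E[measurable]: "E \<in> sets borel"
  proof -
    have "(\<lambda>x. \<Sum>l\<in>\<Lambda> m. (\<phi> m l x)\<^sup>2) \<in> borel_measurable borel"
      using meas by (intro borel_measurable_sum borel_measurable_power)
    then show ?thesis unfolding E_def by measurable
  qed
  obtain N where N: "{x \<in> space lborel. \<not> (x \<in> {0..1} \<longrightarrow> (AE y in lborel. y \<in> {0..1} \<longrightarrow> \<pi> x y \<le> B))} \<subseteq> N"
    "emeasure lborel N = 0" "N \<in> sets lborel"
    using AE_E[OF good] by blast
  have Nb[measurable]: "N \<in> sets borel" using N(3) by simp
  define a where "a l x = \<phi> m l x * indicator (E - N) x" for l x
  define b where "b l x = \<phi> m l x * indicator E x" for l x
  have EE: "AE x in lborel. x \<in> E"
    using model_basis_bound[OF om sc, of m] by (simp add: E_def R_def)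
  have NN: "AE x in lborel. x \<notin> N" using N by (intro AE_not_in) (simp add: null_sets_def)
  have eq: "AE x in lborel. \<forall>l\<in>\<Lambda> m. a l x = \<phi> m l x \<and> b l x = \<phi> m l x"
    using EE NN by eventually_elim (simp add: a_def b_def)
  have sumE: "(\<Sum>l\<in>\<Lambda> m. (\<phi> m l x * indicator S x)\<^sup>2) \<le> R" if "S \<subseteq> E" for S x
    using that R by (cases "x \<in> S") (auto simp: E_def)
  have "tensor_basis M P X \<mu> \<pi> B R (\<Lambda> m) a b"
  proof (unfold_locales)
    show "has_transition_density P \<pi>" "0 < B" "0 < R" "finite (\<Lambda> m)" by fact+
    show "a l \<in> borel_measurable borel" "b l \<in> borel_measurable borel" if "l \<in> \<Lambda> m" for l
      using meas[OF that] unfolding a_def[abs_def] b_def[abs_def] by measurable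
    show "(\<Sum>l\<in>\<Lambda> m. (a l x)\<^sup>2) \<le> R" "(\<Sum>l\<in>\<Lambda> m. (b l x)\<^sup>2) \<le> R" for x
      unfolding a_def b_def by (intro sumE; blast)+
    show "b l y = 0" if "l \<in> \<Lambda> m" "y \<notin> {0..1}" for l y using supp[OF that] by (simp add: b_def)
    show "AE y in lborel. y \<in> {0..1} \<longrightarrow> \<pi> x y \<le> B" if "l \<in> \<Lambda> m" "a l x \<noteq> 0" for l x
    proof -
      have "x \<notin> N" "x \<in> {0..1}" using that supp[OF that(1), of x] by (auto simp: a_def indicator_def split: if_splits)
      then show ?thesis using N(1) by auto
    qed
    show "(\<integral>y. b k y * b k' y \<partial>lborel) = (if k = k' then 1 else 0)" if k: "k \<in> \<Lambda> m" "k' \<in> \<Lambda> m" for k k'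
    proof -
      have "(\<integral>y. b k y * b k' y \<partial>lborel) = (\<integral>y. indicator {0..1} y *\<^sub>R (\<phi> m k y * \<phi> m k' y) \<partial>lborel)"
      proof (rule integral_cong_AE)
        show "AE y in lborel. b k y * b k' y = indicator {0..1} y *\<^sub>R (\<phi> m k y * \<phi> m k' y)"
          using EE by eventually_elim (use supp[OF k(1)] in \<open>auto simp: b_def indicator_def\<close>)
      qed (use meas k in \<open>auto simp: b_def[abs_def] intro!: borel_measurable_times\<close>)
      also have "\<dots> = (\<integral>y. \<phi> m k y * \<phi> m k' y \<partial>unit_interval)"
        by (subst integral_restrict_space) auto
      finally show ?thesis using on[OF k] by simp
    qed
  qed
  then show ?thesis using eq unfolding R_def by blast
qed

section \<open>The oracle inequality on a trajectory\<close>

abbreviation basis2 :: "('m \<Rightarrow> 'l \<Rightarrow> real \<Rightarrow> real) \<Rightarrow> 'm \<Rightarrow> 'l \<times> 'l \<Rightarrow> real \<times> real \<Rightarrow> real" where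
  "basis2 \<phi> m \<equiv> tensor (\<phi> m) (\<phi> m)"

lemma bivariate_space_eq:
  "bivariate_space \<Lambda> \<phi> m = range (\<lambda>\<alpha> z. \<Sum>j\<in>\<Lambda> m \<times> \<Lambda> m. \<alpha> j * basis2 \<phi> m j z)"
proof -
  have eq: "(\<lambda>(x, y). \<Sum>l\<in>\<Lambda> m. \<Sum>k\<in>\<Lambda> m. \<alpha> l k * \<phi> m l x * \<phi> m k y)
      = (\<lambda>z. \<Sum>j\<in>\<Lambda> m \<times> \<Lambda> m. case_prod \<alpha> j * basis2 \<phi> m j z)" for \<alpha>
    by (auto simp: fun_eq_iff tensor_def sum.cartesian_product case_prod_beta' mult.assoc)
  show ?thesis
  proof (intro set_eqI iffI)
    fix t assume "t \<in> bivariate_space \<Lambda> \<phi> m"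
    then show "t \<in> range (\<lambda>\<alpha> z. \<Sum>j\<in>\<Lambda> m \<times> \<Lambda> m. \<alpha> j * basis2 \<phi> m j z)"
      unfolding bivariate_space_def eq by blast
  next
    fix t assume "t \<in> range (\<lambda>\<alpha> z. \<Sum>j\<in>\<Lambda> m \<times> \<Lambda> m. \<alpha> j * basis2 \<phi> m j z)"
    then obtain \<alpha> where "t = (\<lambda>z. \<Sum>j\<in>\<Lambda> m \<times> \<Lambda> m. \<alpha> j * basis2 \<phi> m j z)" by blast
    then have "t = (\<lambda>z. \<Sum>j\<in>\<Lambda> m \<times> \<Lambda> m. case_prod (curry \<alpha>) j * basis2 \<phi> m j z)" by simp
    then show "t \<in> bivariate_space \<Lambda> \<phi> m" unfolding bivariate_space_def eq by blast
  qed
qed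

lemma bivariate_spaceI: "(\<lambda>z. \<Sum>j\<in>\<Lambda> m \<times> \<Lambda> m. \<alpha> j * basis2 \<phi> m j z) \<in> bivariate_space \<Lambda> \<phi> m"
  unfolding bivariate_space_eq by (rule rangeI)

lemma bivariate_spaceE:
  assumes "t \<in> bivariate_space \<Lambda> \<phi> m"
  obtains \<alpha> where "t = (\<lambda>z. \<Sum>j\<in>\<Lambda> m \<times> \<Lambda> m. \<alpha> j * basis2 \<phi> m j z)"
  using assms unfolding bivariate_space_eq by (elim rangeE)

lemma bivariate_space_diff:
  assumes "s \<in> bivariate_space \<Lambda> \<phi> m" "t \<in> bivariate_space \<Lambda> \<phi> m"
  shows "(\<lambda>z. s z - t z) \<in> bivariate_space \<Lambda> \<phi> m"
proof -
  obtain \<alpha> where s: "s = (\<lambda>z. \<Sum>j\<in>\<Lambda> m \<times> \<Lambda> m. \<alpha> j * basis2 \<phi> m j z)"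
    using assms(1) by (rule bivariate_spaceE)
  obtain \<beta> where t: "t = (\<lambda>z. \<Sum>j\<in>\<Lambda> m \<times> \<Lambda> m. \<beta> j * basis2 \<phi> m j z)"
    using assms(2) by (rule bivariate_spaceE)
  from s t have eq: "(\<lambda>z. s z - t z) = (\<lambda>z. \<Sum>j\<in>\<Lambda> m \<times> \<Lambda> m. (\<alpha> j - \<beta> j) * basis2 \<phi> m j z)"
    by (simp add: left_diff_distrib sum_subtractf)
  show ?thesis unfolding eq by (rule bivariate_spaceI)
qed

text \<open>
  Nesting is assumed for functions of one variable. Since it is an inclusion of sets of
  functions, and not only of classes modulo null sets, the tensor products are nested at every
  point too, in particular at the observations.
\<close>

lemma bivariate_space_mono:
  assumes fin: "finite (\<Lambda> m)" and sub: "model_space \<Lambda> \<phi> m \<subseteq> model_space \<Lambda> \<phi> m'"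
  shows "bivariate_space \<Lambda> \<phi> m \<subseteq> bivariate_space \<Lambda> \<phi> m'"
proof
  fix t assume "t \<in> bivariate_space \<Lambda> \<phi> m"
  then obtain \<alpha> where t: "t = (\<lambda>(x, y). \<Sum>l\<in>\<Lambda> m. \<Sum>k\<in>\<Lambda> m. \<alpha> l k * \<phi> m l x * \<phi> m k y)"
    unfolding bivariate_space_def by blast
  have "\<exists>A. \<phi> m l = (\<lambda>x. \<Sum>p\<in>\<Lambda> m'. A p * \<phi> m' p x)" if "l \<in> \<Lambda> m" for l
  proof -
    have eq: "\<phi> m l = (\<lambda>x. \<Sum>k\<in>\<Lambda> m. (if k = l then 1 else 0) * \<phi> m k x)"
      using fin that by (simp add: if_distrib[of "\<lambda>c. c * _"] sum.delta cong: if_cong)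
    have "\<phi> m l \<in> model_space \<Lambda> \<phi> m"
      unfolding model_space_def
      by (rule image_eqI[where x="\<lambda>k. if k = l then 1 else 0", OF _ UNIV_I]) (rule eq)
    then have "\<phi> m l \<in> model_space \<Lambda> \<phi> m'" using sub by blast
    then show ?thesis unfolding model_space_def by (elim rangeE) blast
  qed
  then obtain A where A: "\<And>l. l \<in> \<Lambda> m \<Longrightarrow> \<phi> m l = (\<lambda>x. \<Sum>p\<in>\<Lambda> m'. A l p * \<phi> m' p x)" by metis
  have eq: "t = (\<lambda>(x, y). \<Sum>p\<in>\<Lambda> m'. \<Sum>q\<in>\<Lambda> m'. (\<Sum>l\<in>\<Lambda> m. \<Sum>k\<in>\<Lambda> m. \<alpha> l k * A l p * A k q) * \<phi> m' p x * \<phi> m' q y)"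
  proof (rule ext, clarify)
    fix x y
    have "t (x, y) = (\<Sum>l\<in>\<Lambda> m. \<Sum>k\<in>\<Lambda> m. \<alpha> l k * (\<Sum>p\<in>\<Lambda> m'. A l p * \<phi> m' p x) * (\<Sum>q\<in>\<Lambda> m'. A k q * \<phi> m' q y))"
      unfolding t by (auto intro!: sum.cong simp: A)
    also have "\<dots> = (\<Sum>l\<in>\<Lambda> m. \<Sum>k\<in>\<Lambda> m. \<Sum>p\<in>\<Lambda> m'. \<Sum>q\<in>\<Lambda> m'. \<alpha> l k * A l p * A k q * \<phi> m' p x * \<phi> m' q y)"
      by (simp add: sum_distrib_left sum_distrib_right mult_ac)
    also have "\<dots> = (\<Sum>l\<in>\<Lambda> m. \<Sum>p\<in>\<Lambda> m'. \<Sum>q\<in>\<Lambda> m'. \<Sum>k\<in>\<Lambda> m. \<alpha> l k * A l p * A k q * \<phi> m' p x * \<phi> m' q y)"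
      by (rule sum.cong[OF refl], subst sum.swap, rule sum.cong[OF refl], rule sum.swap)
    also have "\<dots> = (\<Sum>p\<in>\<Lambda> m'. \<Sum>q\<in>\<Lambda> m'. \<Sum>l\<in>\<Lambda> m. \<Sum>k\<in>\<Lambda> m. \<alpha> l k * A l p * A k q * \<phi> m' p x * \<phi> m' q y)"
      by (subst sum.swap, rule sum.cong[OF refl], rule sum.swap)
    also have "\<dots> = (\<Sum>p\<in>\<Lambda> m'. \<Sum>q\<in>\<Lambda> m'. (\<Sum>l\<in>\<Lambda> m. \<Sum>k\<in>\<Lambda> m. \<alpha> l k * A l p * A k q) * \<phi> m' p x * \<phi> m' q y)"
      by (simp add: sum_distrib_right)
    finally show "t (x, y) = (\<Sum>p\<in>\<Lambda> m'. \<Sum>q\<in>\<Lambda> m'. (\<Sum>l\<in>\<Lambda> m. \<Sum>k\<in>\<Lambda> m. \<alpha> l k * A l p * A k q) * \<phi> m' p x * \<phi> m' q y)" .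
  qed
  show "t \<in> bivariate_space \<Lambda> \<phi> m'"
    unfolding bivariate_space_def
    by (rule image_eqI[where x="\<lambda>p q. \<Sum>l\<in>\<Lambda> m. \<Sum>k\<in>\<Lambda> m. \<alpha> l k * A l p * A k q", OF _ UNIV_I]) (rule eq)
qed

locale orthonormal_family =
  fixes \<Lambda> :: "'m \<Rightarrow> 'l set" and \<phi> :: "'m \<Rightarrow> 'l \<Rightarrow> real \<Rightarrow> real"
  assumes om: "orthonormal_models \<Lambda> \<phi>"
begin

lemma finite_\<Lambda>: "finite (\<Lambda> m)"
  and basis_meas: "l \<in> \<Lambda> m \<Longrightarrow> \<phi> m l \<in> borel_measurable borel"
  and basis_supp: "l \<in> \<Lambda> m \<Longrightarrow> x \<notin> {0..1} \<Longrightarrow> \<phi> m l x = 0"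
  and basis_orth: "l \<in> \<Lambda> m \<Longrightarrow> k \<in> \<Lambda> m \<Longrightarrow> (\<integral>x. \<phi> m l x * \<phi> m k x \<partial>unit_interval) = (if l = k then 1 else 0)"
  and bivariate_Linf_L2: "bivariate_space \<Lambda> \<phi> m \<subseteq> Linf_L2 unit_square"
  using om unfolding orthonormal_models_def by blast+

abbreviation "J m \<equiv> \<Lambda> m \<times> \<Lambda> m"
abbreviation "e \<equiv> basis2 \<phi>"

lemma finite_J: "finite (J m)" by (simp add: finite_\<Lambda>)

lemma e_bivariate: "j \<in> J m \<Longrightarrow> e m j \<in> bivariate_space \<Lambda> \<phi> m"
proof -
  assume j: "j \<in> J m"
  have eq: "e m j = (\<lambda>z. \<Sum>i\<in>J m. (if i = j then 1 else 0) * e m i z)"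
    using j finite_J by (simp add: if_distrib[of "\<lambda>c. c * _"] sum.delta cong: if_cong)
  show ?thesis
    unfolding bivariate_space_eq
    by (rule image_eqI[where x="\<lambda>i. if i = j then 1 else 0", OF _ UNIV_I]) (rule eq)
qed

lemma bivariate_meas: "t \<in> bivariate_space \<Lambda> \<phi> m \<Longrightarrow> t \<in> borel_measurable unit_square"
  and bivariate_sq: "t \<in> bivariate_space \<Lambda> \<phi> m \<Longrightarrow> sq_norm unit_square t < \<infinity>"
  using bivariate_Linf_L2 by (auto simp: Linf_L2_def)

lemma bivariate_integrable_mult:
  "s \<in> bivariate_space \<Lambda> \<phi> m \<Longrightarrow> t \<in> bivariate_space \<Lambda> \<phi> m' \<Longrightarrow> integrable unit_square (\<lambda>z. s z * t z)"
  by (intro square_integrable_mult bivariate_meas bivariate_sq)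

lemma e_borel: "j \<in> J m \<Longrightarrow> e m j \<in> borel_measurable borel"
  unfolding tensor_def[abs_def] borel_prod[symmetric]
  using basis_meas[of "fst j" m] basis_meas[of "snd j" m] by auto

lemma e_supp: "j \<in> J m \<Longrightarrow> z \<notin> {0..1} \<times> {0..1} \<Longrightarrow> e m j z = 0"
  using basis_supp[of "fst j" m "fst z"] basis_supp[of "snd j" m "snd z"]
  by (cases z) (auto simp: tensor_def)

lemma unit_square_sets: "{0..1} \<times> {0..1} \<inter> space lborel \<in> sets (lborel :: (real \<times> real) measure)"
  by (simp add: borel_prod[symmetric])

lemma e_orth:
  assumes "i \<in> J m" "j \<in> J m"
  shows "(\<integral>z. e m i z * e m j z \<partial>unit_square) = (if i = j then 1 else 0)"
proof -
  define u where "u x = \<phi> m (fst i) x * \<phi> m (fst j) x" for x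
  define v where "v x = \<phi> m (snd i) x * \<phi> m (snd j) x" for x
  have ij: "fst i \<in> \<Lambda> m" "fst j \<in> \<Lambda> m" "snd i \<in> \<Lambda> m" "snd j \<in> \<Lambda> m" using assms by auto
  have u: "(\<integral>x. u x \<partial>lborel) = (if fst i = fst j then 1 else 0)"
  proof -
    have "(\<integral>x. u x \<partial>lborel) = (\<integral>x. indicator {0..1} x *\<^sub>R u x \<partial>lborel)"
      using basis_supp[OF ij(1)] by (intro Bochner_Integration.integral_cong) (auto simp: u_def indicator_def)
    also have "\<dots> = (\<integral>x. u x \<partial>unit_interval)" by (subst integral_restrict_space) auto
    finally show ?thesis using basis_orth[OF ij(1,2)] by (simp add: u_def)
  qed
  have v: "(\<integral>x. v x \<partial>lborel) = (if snd i = snd j then 1 else 0)"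
  proof -
    have "(\<integral>x. v x \<partial>lborel) = (\<integral>x. indicator {0..1} x *\<^sub>R v x \<partial>lborel)"
      using basis_supp[OF ij(3)] by (intro Bochner_Integration.integral_cong) (auto simp: v_def indicator_def)
    also have "\<dots> = (\<integral>x. v x \<partial>unit_interval)" by (subst integral_restrict_space) auto
    finally show ?thesis using basis_orth[OF ij(3,4)] by (simp add: v_def)
  qed
  have eq: "indicator ({0..1} \<times> {0..1}) z *\<^sub>R (e m i z * e m j z) = u (fst z) * v (snd z)" for z
    using e_supp[OF assms(1), of z] by (cases "z \<in> {0..1} \<times> {0..1}") (auto simp: u_def v_def tensor_def)
  have "integrable unit_square (\<lambda>z. e m i z * e m j z)"
    by (rule bivariate_integrable_mult[OF e_bivariate[OF assms(1)] e_bivariate[OF assms(2)]])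
  then have int: "integrable (lborel \<Otimes>\<^sub>M lborel) (\<lambda>z. u (fst z) * v (snd z))"
    unfolding integrable_restrict_space[OF unit_square_sets] eq lborel_prod .
  have "(\<integral>z. e m i z * e m j z \<partial>unit_square) = (\<integral>z. u (fst z) * v (snd z) \<partial>(lborel \<Otimes>\<^sub>M lborel))"
    unfolding integral_restrict_space[OF unit_square_sets] eq lborel_prod ..
  also have "\<dots> = (\<integral>x. (\<integral>y. u x * v y \<partial>lborel) \<partial>lborel)"
    using lborel_pair.integral_fst'[OF int] by simp
  also have "\<dots> = (if i = j then 1 else 0)" by (simp add: u v prod_eq_iff)
  finally show ?thesis .
qed

lemma coefficients_norm:
  "integrable unit_square (\<lambda>z. (\<Sum>j\<in>J m. \<alpha> j * e m j z)\<^sup>2)"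
  "(\<integral>z. (\<Sum>j\<in>J m. \<alpha> j * e m j z)\<^sup>2 \<partial>unit_square) = (\<Sum>j\<in>J m. (\<alpha> j)\<^sup>2)"
proof -
  have i: "integrable unit_square (\<lambda>z. e m i z * e m j z)" if "i \<in> J m" "j \<in> J m" for i j
    by (rule bivariate_integrable_mult[OF e_bivariate[OF that(1)] e_bivariate[OF that(2)]])
  show "integrable unit_square (\<lambda>z. (\<Sum>j\<in>J m. \<alpha> j * e m j z)\<^sup>2)"
    "(\<integral>z. (\<Sum>j\<in>J m. \<alpha> j * e m j z)\<^sup>2 \<partial>unit_square) = (\<Sum>j\<in>J m. (\<alpha> j)\<^sup>2)"
    by (rule integral_square_orthonormal[OF finite_J i e_orth]; assumption)+
qed

definition emp :: "nat \<Rightarrow> (nat \<Rightarrow> real) \<Rightarrow> (real \<times> real \<Rightarrow> real) \<Rightarrow> real" where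
  "emp n x t = 1 / (real n - 1) * (\<Sum>i=1..n - 1. t (x i, x (Suc i)))"

lemma emp_sum: "emp n x (\<lambda>z. \<Sum>j\<in>I. \<alpha> j * f j z) = (\<Sum>j\<in>I. \<alpha> j * emp n x (f j))"
proof -
  have "(\<Sum>i=1..n - 1. \<Sum>j\<in>I. \<alpha> j * f j (x i, x (Suc i))) = (\<Sum>j\<in>I. \<alpha> j * (\<Sum>i=1..n - 1. f j (x i, x (Suc i))))"
    by (subst sum.swap) (simp add: sum_distrib_left)
  then show ?thesis by (simp add: emp_def sum_distrib_left mult_ac)
qed

lemma emp_diff: "emp n x (\<lambda>z. s z - t z) = emp n x s - emp n x t"
  by (simp add: emp_def sum_subtractf right_diff_distrib)

lemma contrast_eq:
  assumes "2 \<le> n" "integrable unit_square (\<lambda>z. (t z)\<^sup>2)"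
  shows "contrast n x t = (\<integral>z. (t z)\<^sup>2 \<partial>unit_square) - 2 * emp n x t"
proof -
  have "(\<Sum>i=1..n - 1. (L2_norm unit_square t)\<^sup>2 - 2 * t (x i, x (Suc i)))
    = (real n - 1) * (\<integral>z. (t z)\<^sup>2 \<partial>unit_square) - 2 * (\<Sum>i=1..n - 1. t (x i, x (Suc i)))"
    using assms(1) by (simp add: L2_norm_eq(2)[OF assms(2)] sum_subtractf sum_distrib_left of_nat_diff)
  then show ?thesis using assms(1) by (simp add: contrast_def emp_def right_diff_distrib)
qed

lemma contrast_coefficients:
  assumes "2 \<le> n"
  shows "contrast n x (\<lambda>z. \<Sum>j\<in>J m. \<alpha> j * e m j z)
    = (\<Sum>j\<in>J m. (\<alpha> j - emp n x (e m j))\<^sup>2) - (\<Sum>j\<in>J m. (emp n x (e m j))\<^sup>2)"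
  unfolding contrast_eq[OF assms coefficients_norm(1)] coefficients_norm(2) emp_sum
  by (simp add: power2_diff sum.distrib sum_subtractf sum_distrib_left mult.assoc)

text \<open>
  In coordinates the contrast is the squared distance to the vector of empirical means minus a
  constant, so a minimiser exists and the choice made in \<open>g_hat\<close> is one.
\<close>

lemma g_hat_minimises:
  assumes "2 \<le> n"
  shows "g_hat \<Lambda> \<phi> n x m \<in> bivariate_space \<Lambda> \<phi> m"
    "t \<in> bivariate_space \<Lambda> \<phi> m \<Longrightarrow> contrast n x (g_hat \<Lambda> \<phi> n x m) \<le> contrast n x t"
proof -
  let ?s = "\<lambda>z. \<Sum>j\<in>J m. emp n x (e m j) * e m j z"
  have "is_arg_min (contrast n x) (\<lambda>t. t \<in> bivariate_space \<Lambda> \<phi> m) ?s"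
    unfolding is_arg_min_linorder
  proof (intro conjI allI impI)
    show "?s \<in> bivariate_space \<Lambda> \<phi> m" by (rule bivariate_spaceI)
    fix t assume "t \<in> bivariate_space \<Lambda> \<phi> m"
    then obtain \<alpha> where t: "t = (\<lambda>z. \<Sum>j\<in>J m. \<alpha> j * e m j z)" by (rule bivariate_spaceE)
    show "contrast n x ?s \<le> contrast n x t"
      unfolding t contrast_coefficients[OF assms] by (simp add: sum_nonneg)
  qed
  then have "is_arg_min (contrast n x) (\<lambda>t. t \<in> bivariate_space \<Lambda> \<phi> m) (g_hat \<Lambda> \<phi> n x m)"
    unfolding g_hat_def arg_min_def
    by (rule someI[where P="is_arg_min (contrast n x) (\<lambda>t. t \<in> bivariate_space \<Lambda> \<phi> m)"])
  then show "g_hat \<Lambda> \<phi> n x m \<in> bivariate_space \<Lambda> \<phi> m"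
    "t \<in> bivariate_space \<Lambda> \<phi> m \<Longrightarrow> contrast n x (g_hat \<Lambda> \<phi> n x m) \<le> contrast n x t"
    by (auto simp: is_arg_min_linorder)
qed

text \<open>
  The squared supremum of \<open>\<nu>\<close> over the unit ball of the bivariate model \<open>m\<close>.
\<close>

definition fluct :: "(real \<times> real \<Rightarrow> real) \<Rightarrow> nat \<Rightarrow> (nat \<Rightarrow> real) \<Rightarrow> 'm \<Rightarrow> real" where
  "fluct g n x m = (\<Sum>j\<in>J m. (emp n x (e m j) - (\<integral>z. e m j z * g z \<partial>unit_square))\<^sup>2)"

text \<open>
  Write \<open>Z\<close> for \<open>fluct g n x ms\<close>. The loss of \<open>t\<close> is \<open>\<parallel>g\<parallel>\<^sup>2 + \<gamma>(t) + 2 \<nu>(t)\<close>. Subtracting the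
  expressions for the estimator and for \<open>s\<close> leaves \<open>2 \<nu>(d)\<close> with \<open>d\<close> in the larger model, and
  \<open>2 \<nu>(d) \<le> \<parallel>d\<parallel>\<^sup>2 / 4 + 4 Z\<close>. As \<open>\<parallel>d\<parallel>\<^sup>2\<close> is at most twice the sum of both losses, half the loss
  of the estimator moves to the left-hand side, which gives the factor 3. The penalty of the
  larger model is one of the two penalties, and the bound on the right has \<open>pen m\<close> to spare and
  \<open>- 2 pen mh\<close>, so it can be subtracted from \<open>8 Z\<close>. The model \<open>ms\<close> is any model of the larger
  dimension; this freedom allows one representative for each dimension.
\<close>

lemma oracle_inequality:
  assumes n: "2 \<le> n" and K: "0 \<le> K"
    and nested: "nested_models \<Lambda> \<phi>"
    and g: "g \<in> borel_measurable unit_square" "sq_norm unit_square g < \<infinity>"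
    and sel: "selected_model \<Lambda> \<phi> K n x mh" and m: "m \<in> model_indices \<Lambda> n"
    and s: "s \<in> bivariate_space \<Lambda> \<phi> m"
    and ms: "model_dim \<Lambda> ms = max (model_dim \<Lambda> m) (model_dim \<Lambda> mh)"
  shows "(\<integral>z. (g_hat \<Lambda> \<phi> n x mh z - g z)\<^sup>2 \<partial>unit_square)
    \<le> 3 * ((\<integral>z. (g z - s z)\<^sup>2 \<partial>unit_square) + pen \<Lambda> K n m)
      + max 0 (8 * fluct g n x ms - pen \<Lambda> K n ms)"
proof -
  let ?I = "\<lambda>t. \<integral>z. t z \<partial>unit_square"
  define \<gamma> where "\<gamma> = contrast n x"
  define h where "h = g_hat \<Lambda> \<phi> n x mh"
  have hb: "h \<in> bivariate_space \<Lambda> \<phi> mh" unfolding h_def by (rule g_hat_minimises[OF n])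
  have "\<gamma> h + pen \<Lambda> K n mh \<le> \<gamma> (g_hat \<Lambda> \<phi> n x m) + pen \<Lambda> K n m"
    using sel m unfolding selected_model_def is_arg_min_linorder by (simp add: \<gamma>_def h_def)
  moreover have "\<gamma> (g_hat \<Lambda> \<phi> n x m) \<le> \<gamma> s"
    unfolding \<gamma>_def by (rule g_hat_minimises(2)[OF n s])
  ultimately have sel': "\<gamma> h \<le> \<gamma> s + pen \<Lambda> K n m - pen \<Lambda> K n mh" by linarith
  have gg: "integrable unit_square (\<lambda>z. (g z)\<^sup>2)"
    using square_integrable_mult[OF g(1) g(1) g(2) g(2)] by (simp add: power2_eq_square)
  have gt: "integrable unit_square (\<lambda>z. t z * g z)" "integrable unit_square (\<lambda>z. (t z)\<^sup>2)"
    if "t \<in> bivariate_space \<Lambda> \<phi> m'" for t m'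
    using bivariate_meas[OF that] bivariate_sq[OF that] g bivariate_integrable_mult[OF that that]
    by (auto intro!: square_integrable_mult simp: power2_eq_square)
  define \<nu> where "\<nu> t = emp n x t - ?I (\<lambda>z. t z * g z)" for t
  have dist: "?I (\<lambda>z. (t z - g z)\<^sup>2) = ?I (\<lambda>z. (g z)\<^sup>2) + \<gamma> t + 2 * \<nu> t"
    if t: "t \<in> bivariate_space \<Lambda> \<phi> m'" for t m'
  proof -
    have "?I (\<lambda>z. (t z - g z)\<^sup>2) = ?I (\<lambda>z. (t z)\<^sup>2 - 2 * (t z * g z) + (g z)\<^sup>2)"
      by (simp add: power2_diff algebra_simps)
    also have "\<dots> = ?I (\<lambda>z. (t z)\<^sup>2) - 2 * ?I (\<lambda>z. t z * g z) + ?I (\<lambda>z. (g z)\<^sup>2)"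
      using gt[OF t] gg by simp
    finally show ?thesis by (simp add: \<gamma>_def contrast_eq[OF n gt(2)[OF t]] \<nu>_def)
  qed
  have sub: "bivariate_space \<Lambda> \<phi> m \<subseteq> bivariate_space \<Lambda> \<phi> ms" "bivariate_space \<Lambda> \<phi> mh \<subseteq> bivariate_space \<Lambda> \<phi> ms"
    using nested ms unfolding nested_models_def by (intro bivariate_space_mono finite_\<Lambda>; simp)+
  define d where "d z = h z - s z" for z
  have db: "d \<in> bivariate_space \<Lambda> \<phi> ms"
    unfolding d_def[abs_def] using hb s sub by (intro bivariate_space_diff) auto
  then obtain \<beta> where \<beta>: "d = (\<lambda>z. \<Sum>j\<in>J ms. \<beta> j * e ms j z)" by (rule bivariate_spaceE)
  define Z where "Z = fluct g n x ms"
  have Z0: "0 \<le> Z" by (simp add: Z_def fluct_def sum_nonneg)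
  have \<nu>d: "\<nu> d = \<nu> h - \<nu> s"
    using gt(1)[OF hb] gt(1)[OF s] by (simp add: \<nu>_def d_def[abs_def] emp_diff left_diff_distrib)
  have "\<nu> d = (\<Sum>j\<in>J ms. \<beta> j * (emp n x (e ms j) - ?I (\<lambda>z. e ms j z * g z)))"
  proof -
    have "?I (\<lambda>z. d z * g z) = ?I (\<lambda>z. \<Sum>j\<in>J ms. \<beta> j * (e ms j z * g z))"
      by (simp add: \<beta> sum_distrib_right mult.assoc)
    also have "\<dots> = (\<Sum>j\<in>J ms. \<beta> j * ?I (\<lambda>z. e ms j z * g z))"
      using gt(1)[OF e_bivariate] by (simp add: Bochner_Integration.integral_sum)
    finally show ?thesis by (simp add: \<nu>_def \<beta> emp_sum right_diff_distrib sum_subtractf)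
  qed
  then have "(\<nu> d)\<^sup>2 \<le> (\<Sum>j\<in>J ms. (\<beta> j)\<^sup>2) * Z"
    unfolding Z_def fluct_def by (simp only: Cauchy_Schwarz_ineq_sum)
  also have "(\<Sum>j\<in>J ms. (\<beta> j)\<^sup>2) = ?I (\<lambda>z. (d z)\<^sup>2)" unfolding \<beta> coefficients_norm(2) ..
  finally have cs: "(\<nu> d)\<^sup>2 \<le> ?I (\<lambda>z. (d z)\<^sup>2) * Z" .
  have d0: "0 \<le> ?I (\<lambda>z. (d z)\<^sup>2)" by simp
  have "2 * \<nu> d \<le> ?I (\<lambda>z. (d z)\<^sup>2) / 4 + 4 * Z"
  proof -
    have "\<bar>\<nu> d\<bar> \<le> sqrt (?I (\<lambda>z. (d z)\<^sup>2) * Z)" using cs by (simp add: real_le_rsqrt)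
    also have "\<dots> = sqrt (?I (\<lambda>z. (d z)\<^sup>2)) * sqrt Z" by (rule real_sqrt_mult)
    finally have "2 * \<nu> d \<le> 2 * (sqrt (?I (\<lambda>z. (d z)\<^sup>2)) / 2) * (2 * sqrt Z)" by simp
    also have "\<dots> \<le> (sqrt (?I (\<lambda>z. (d z)\<^sup>2)) / 2)\<^sup>2 + (2 * sqrt Z)\<^sup>2" by (rule sum_squares_bound)
    also have "\<dots> = ?I (\<lambda>z. (d z)\<^sup>2) / 4 + 4 * Z" using d0 Z0 by (simp add: power_divide power_mult_distrib)
    finally show ?thesis .
  qed
  moreover have "?I (\<lambda>z. (d z)\<^sup>2) \<le> 2 * ?I (\<lambda>z. (h z - g z)\<^sup>2) + 2 * ?I (\<lambda>z. (s z - g z)\<^sup>2)"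
  proof -
    have i: "integrable unit_square (\<lambda>z. (t z - g z)\<^sup>2)" if t: "t \<in> bivariate_space \<Lambda> \<phi> m'" for t m'
    proof -
      have "integrable unit_square (\<lambda>z. (t z)\<^sup>2 - 2 * (t z * g z) + (g z)\<^sup>2)" using gt[OF t] gg by simp
      then show ?thesis by (simp add: power2_diff algebra_simps)
    qed
    have "?I (\<lambda>z. (d z)\<^sup>2) \<le> ?I (\<lambda>z. 2 * (h z - g z)\<^sup>2 + 2 * (s z - g z)\<^sup>2)"
    proof (rule integral_mono)
      fix z
      show "(d z)\<^sup>2 \<le> 2 * (h z - g z)\<^sup>2 + 2 * (s z - g z)\<^sup>2"
        using sum_squares_bound[of "h z - g z" "- (s z - g z)"]
        unfolding d_def by (simp add: power2_eq_square algebra_simps)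
    qed (use gt[OF db] i[OF hb] i[OF s] in auto)
    then show ?thesis using i[OF hb] i[OF s] by simp
  qed
  ultimately have "?I (\<lambda>z. (h z - g z)\<^sup>2) \<le> 3 * ?I (\<lambda>z. (s z - g z)\<^sup>2) + 2 * pen \<Lambda> K n m - 2 * pen \<Lambda> K n mh + 8 * Z"
    using dist[OF hb] dist[OF s] sel' \<nu>d by (simp add: field_simps)
  moreover have "pen \<Lambda> K n ms \<le> pen \<Lambda> K n m + 2 * pen \<Lambda> K n mh"
  proof -
    have "0 \<le> pen \<Lambda> K n m" "0 \<le> pen \<Lambda> K n mh" using K by (simp_all add: pen_def)
    moreover have "pen \<Lambda> K n ms = pen \<Lambda> K n m \<or> pen \<Lambda> K n ms = pen \<Lambda> K n mh"
      using ms by (auto simp: pen_def max_def)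
    ultimately show ?thesis by linarith
  qed
  moreover have "?I (\<lambda>z. (s z - g z)\<^sup>2) = ?I (\<lambda>z. (g z - s z)\<^sup>2)" by (simp add: power2_commute)
  ultimately show ?thesis by (simp add: h_def Z_def)
qed

end

section \<open>The risk bound\<close>

lemma le_INF_ennreal_affine:
  fixes f :: "'a \<Rightarrow> ennreal"
  assumes le: "\<And>i. i \<in> I \<Longrightarrow> a \<le> 3 * f i + c" and c: "c \<noteq> top"
  shows "a \<le> 3 * (INF i\<in>I. f i) + c"
proof -
  have d: "(a - c) / 3 \<le> (INF i\<in>I. f i)"
  proof (rule INF_greatest)
    fix i assume "i \<in> I"
    then have "a - c \<le> 3 * f i" using le[of i] c by (simp add: ennreal_minus_le_iff add.commute)
    then show "(a - c) / 3 \<le> f i" by (intro divide_le_posI_ennreal) auto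
  qed
  have "a - c = 3 * ((a - c) / 3)"
    by (simp add: ennreal_times_divide mult_divide_eq_ennreal mult.commute)
  also have "\<dots> \<le> 3 * (INF i\<in>I. f i)" by (intro mult_left_mono d) simp
  finally show ?thesis using c by (simp add: ennreal_minus_le_iff add.commute)
qed

lemma sum_inverse_squares_le: "(\<Sum>d=1..n. 1 / (real d)\<^sup>2) \<le> 2"
proof -
  have "(\<Sum>d=1..Suc n. 1 / (real d)\<^sup>2) \<le> 2 - 1 / real (Suc n)" for n
  proof (induction n)
    case (Suc n)
    have "1 / (real (Suc (Suc n)))\<^sup>2 \<le> 1 / (real (Suc n) * real (Suc (Suc n)))"
      unfolding power2_eq_square by (intro divide_left_mono mult_right_mono) auto
    also have "\<dots> = 1 / real (Suc n) - 1 / real (Suc (Suc n))" by (simp add: field_simps)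
    finally show ?case using Suc by simp
  qed simp
  note le = this
  show ?thesis
  proof (cases n)
    case (Suc k)
    have "0 \<le> 1 / real (Suc k)" by simp
    then show ?thesis using le[of k] unfolding Suc by linarith
  qed simp
qed

lemma distributed_AE:
  assumes d: "distributed M N Y f" and Q: "AE z in N. Q z"
  shows "AE \<omega> in M. Q (Y \<omega>)"
proof -
  have deq: "distr M N Y = density N f" using d by (simp add: distributed_def)
  have "AE z in density N f. Q z"
    using d Q by (subst AE_density) (auto simp: distributed_def elim: eventually_mono)
  then have "AE z in distr M N Y. Q z" unfolding deq .
  then show ?thesis by (rule AE_distrD[OF distributed_measurable[OF d]])
qed

locale estimation = stationary_chain M P X \<mu> + orthonormal_family \<Lambda> \<phi>
  for M :: "'w measure" and P X \<mu> and \<Lambda> :: "'m \<Rightarrow> 'l set" and \<phi> +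
  fixes q g :: "real \<times> real \<Rightarrow> real" and \<pi> :: "real \<Rightarrow> real \<Rightarrow> real" and B r\<^sub>0 :: real
  assumes q: "\<And>z. 0 \<le> q z"
      "\<And>i. distributed M lborel (\<lambda>\<omega>. (X i \<omega>, X (Suc i) \<omega>)) (\<lambda>z. ennreal (q z))"
    and g: "g = (\<lambda>z. q z * indicator ({0..1} \<times> {0..1}) z)"
    and density: "has_transition_density P \<pi>" and B: "0 < B"
    and good: "AE x in lborel. x \<in> {0..1} \<longrightarrow> (AE y in lborel. y \<in> {0..1} \<longrightarrow> \<pi> x y \<le> B)"
    and sc: "sup_norm_connected \<Lambda> \<phi> r\<^sub>0"
begin

lemma q_meas: "q \<in> borel_measurable borel"
  using distributed_real_measurable[OF _ q(2)[of 0]] q(1) by simp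

lemma g_meas: "g \<in> borel_measurable borel"
proof -
  have "({0..1} \<times> {0..1} :: (real \<times> real) set) \<in> sets borel" by (simp add: borel_prod[symmetric])
  then show ?thesis unfolding g using q_meas by measurable
qed

text \<open>
  The summand 1 makes \<open>r\<close> positive whatever the sign of \<open>r\<^sub>0\<close>.
\<close>

abbreviation "r \<equiv> \<bar>r\<^sub>0\<bar> + 1"

lemma bounded_excess_meas:
  "(\<lambda>\<omega>. max 0 (8 * fluct g n (\<lambda>i. X i \<omega>) m - c)) \<in> borel_measurable M"
proof -
  have "(\<lambda>\<omega>. e m j (X i \<omega>, X (Suc i) \<omega>)) \<in> borel_measurable M" if "j \<in> J m" for i j
    by (rule measurable_compose[OF _ e_borel[OF that]]) (simp add: borel_prod[symmetric])
  then have "(\<lambda>\<omega>. fluct g n (\<lambda>i. X i \<omega>) m) \<in> borel_measurable M"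
    unfolding fluct_def emp_def
    by (intro borel_measurable_sum borel_measurable_power borel_measurable_diff borel_measurable_times
        borel_measurable_const) auto
  then show ?thesis by measurable
qed

text \<open>
  The bases of \<open>tensor_basis\<close> agree with the given one at almost all pairs of consecutive
  observations. The threshold for \<open>K\<close> is such that \<open>pen\<close> dominates \<open>8 / N\<^sup>2\<close> times the threshold
  for \<open>deviation\<close>; a factor 2 is lost in comparing \<open>n\<close> with \<open>N = n - 1\<close>.
\<close>

lemma model_excess:
  assumes C0: "0 \<le> C"
    and C: "\<And>L :: 'l set. excess_bounded \<pi> B r C L"
    and n: "2 \<le> n" and m: "m \<in> model_indices \<Lambda> n" and D: "1 \<le> model_dim \<Lambda> m"
    and K: "16 * (8 * r ^ 4 + 2) \<le> K"
  shows "(\<integral>\<^sup>+\<omega>. ennreal (max 0 (8 * fluct g n (\<lambda>i. X i \<omega>) m - pen \<Lambda> K n m)) \<partial>M)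
    \<le> ennreal (16 * C / real n * (1 / (real (model_dim \<Lambda> m))\<^sup>2))"
proof -
  define L where "L = \<Lambda> m"
  define d where "d = real (card L)"
  define N where "N = n - 1"
  define \<kappa> where "\<kappa> = 8 * r ^ 4 + 2"
  have L1: "1 \<le> card L" using D by (simp add: L_def model_dim_def)
  have d1: "1 \<le> d" using L1 by (simp add: d_def)
  have N1: "1 \<le> N" using n by (simp add: N_def)
  have Nn: "real n = real N + 1" using n by (simp add: N_def of_nat_diff)
  have nN: "real n \<le> 2 * real N" using Nn N1 by simp
  have d4: "d ^ 4 \<le> 2 * real N"
  proof -
    have "d\<^sup>2 \<le> sqrt (real n)" using m by (simp add: model_indices_def model_dim_def d_def L_def)
    then have "(d\<^sup>2)\<^sup>2 \<le> (sqrt (real n))\<^sup>2" by (intro power_mono) auto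
    then show ?thesis using nN by (simp flip: power_mult)
  qed
  have ne: "\<Lambda> m \<noteq> {}" using L1 by (auto simp: L_def)
  obtain a b where tb: "tensor_basis M P X \<mu> \<pi> B (r\<^sup>2 * real (card L)) L a b"
    and eq: "AE x in lborel. \<forall>l\<in>L. a l x = \<phi> m l x \<and> b l x = \<phi> m l x"
    using exists_tensor_basis[OF om sc density B good ne] unfolding L_def by blast
  interpret tb: tensor_basis M P X \<mu> \<pi> B "r\<^sup>2 * real (card L)" L a b by (rule tb)
  have eq2: "AE z in lborel. \<forall>j\<in>L \<times> L. tensor a b j z = e m j z"
    using AE_lborel_fst_snd(1)[OF eq] AE_lborel_fst_snd(2)[OF eq]
    by eventually_elim (auto simp: tensor_def)
  have mean: "(\<integral>\<omega>. tensor a b j (X 1 \<omega>, X 2 \<omega>) \<partial>M) = (\<integral>z. e m j z * g z \<partial>unit_square)" if j: "j \<in> L \<times> L" for j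
  proof -
    have tm: "tensor a b j \<in> borel_measurable borel" using tb.bounded_\<Phi>[OF j] by (rule bounded_meas_measurable)
    have em: "e m j \<in> borel_measurable borel" using e_borel[of j m] j by (simp add: L_def)
    have "(\<integral>\<omega>. tensor a b j (X 1 \<omega>, X 2 \<omega>) \<partial>M) = (\<integral>z. q z * tensor a b j z \<partial>lborel)"
      using distributed_integral[OF q(2)[of 1], of "tensor a b j"] tm q(1) by (simp add: numeral_2_eq_2)
    also have "\<dots> = (\<integral>z. indicator ({0..1} \<times> {0..1}) z *\<^sub>R (e m j z * g z) \<partial>lborel)"
    proof (rule integral_cong_AE)
      show "AE z in lborel. q z * tensor a b j z = indicator ({0..1} \<times> {0..1}) z *\<^sub>R (e m j z * g z)"
        using eq2
      proof eventually_elim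
        case (elim z)
        then show ?case using j e_supp[of j m z]
          by (cases "z \<in> {0..1} \<times> {0..1}") (auto simp: g L_def)
      qed
      have "({0..1} \<times> {0..1} :: (real \<times> real) set) \<in> sets borel" by (simp add: borel_prod[symmetric])
      then show "(\<lambda>z. indicator ({0..1} \<times> {0..1}) z *\<^sub>R (e m j z * g z)) \<in> borel_measurable lborel"
        using em g_meas by (intro borel_measurable_scaleR borel_measurable_times borel_measurable_indicator) auto
      show "(\<lambda>z. q z * tensor a b j z) \<in> borel_measurable lborel" using tm q_meas by simp
    qed
    also have "\<dots> = (\<integral>z. e m j z * g z \<partial>unit_square)"
      by (rule integral_restrict_space[OF unit_square_sets, symmetric])
    finally show ?thesis .
  qed
  define U where "U = deviation (L \<times> L) (tensor a b) N"
  have "AE \<omega> in M. \<forall>i. \<forall>j\<in>L \<times> L. tensor a b j (X i \<omega>, X (Suc i) \<omega>) = e m j (X i \<omega>, X (Suc i) \<omega>)"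
    unfolding AE_all_countable using distributed_AE[OF q(2) eq2] by blast
  then have "AE \<omega> in M. ennreal (max 0 (8 * fluct g n (\<lambda>i. X i \<omega>) m - pen \<Lambda> K n m))
      \<le> ennreal (8 / (real N)\<^sup>2 * max 0 (U \<omega> - \<kappa> * d\<^sup>2 * real N))"
  proof eventually_elim
    case (elim \<omega>)
    have "fluct g n (\<lambda>i. X i \<omega>) m = (\<Sum>j\<in>L \<times> L. (1 / real N)\<^sup>2 * (\<Sum>i<N. tensor a b j (X (Suc i) \<omega>, X (Suc (Suc i)) \<omega>)
          - (\<integral>\<omega>. tensor a b j (X 1 \<omega>, X 2 \<omega>) \<partial>M))\<^sup>2)"
      unfolding fluct_def L_def[symmetric]
    proof (rule sum.cong[OF refl])
      fix j assume j: "j \<in> L \<times> L"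
      define c where "c = (\<integral>\<omega>. tensor a b j (X 1 \<omega>, X 2 \<omega>) \<partial>M)"
      have "emp n (\<lambda>i. X i \<omega>) (e m j) = 1 / real N * (\<Sum>i<N. tensor a b j (X (Suc i) \<omega>, X (Suc (Suc i)) \<omega>))"
      proof -
        have "(\<Sum>i=1..n - 1. e m j (X i \<omega>, X (Suc i) \<omega>)) = (\<Sum>i<N. e m j (X (Suc i) \<omega>, X (Suc (Suc i)) \<omega>))"
          unfolding N_def[symmetric] by (simp add: sum.atLeast1_atMost_eq)
        also have "\<dots> = (\<Sum>i<N. tensor a b j (X (Suc i) \<omega>, X (Suc (Suc i)) \<omega>))"
          using elim j by (intro sum.cong refl) auto
        finally show ?thesis using Nn by (simp add: emp_def)
      qed
      then have "emp n (\<lambda>i. X i \<omega>) (e m j) - c = 1 / real N * (\<Sum>i<N. tensor a b j (X (Suc i) \<omega>, X (Suc (Suc i)) \<omega>) - c)"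
        using N1 by (simp add: sum_subtractf field_simps)
      then show "(emp n (\<lambda>i. X i \<omega>) (e m j) - (\<integral>z. e m j z * g z \<partial>unit_square))\<^sup>2
        = (1 / real N)\<^sup>2 * (\<Sum>i<N. tensor a b j (X (Suc i) \<omega>, X (Suc (Suc i)) \<omega>)
          - (\<integral>\<omega>. tensor a b j (X 1 \<omega>, X 2 \<omega>) \<partial>M))\<^sup>2"
        unfolding mean[OF j, symmetric] c_def by (simp only: power_mult_distrib)
    qed
    then have fl: "fluct g n (\<lambda>i. X i \<omega>) m = U \<omega> / (real N)\<^sup>2"
      by (simp add: U_def deviation_def power_divide sum_divide_distrib)
    have "8 * (\<kappa> * d\<^sup>2 * real N) / (real N)\<^sup>2 \<le> pen \<Lambda> K n m"
    proof -
      have "8 * (\<kappa> * d\<^sup>2 * real N) / (real N)\<^sup>2 = (16 * \<kappa>) * d\<^sup>2 / (2 * real N)"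
        using N1 by (simp add: power2_eq_square)
      also have "\<dots> \<le> K * d\<^sup>2 / (2 * real N)"
        using K by (intro divide_right_mono mult_right_mono) (auto simp: \<kappa>_def)
      also have "\<dots> \<le> K * d\<^sup>2 / real n"
      proof (rule divide_left_mono[OF nN])
        have "0 \<le> 16 * (8 * r ^ 4 + 2)" by simp
        then have "0 \<le> K" using K by linarith
        then show "0 \<le> K * d\<^sup>2" by simp
        show "0 < 2 * real N * real n" using N1 n by simp
      qed
      also have "\<dots> = pen \<Lambda> K n m" by (simp add: pen_def model_dim_def d_def L_def)
      finally show ?thesis .
    qed
    then have "8 * fluct g n (\<lambda>i. X i \<omega>) m - pen \<Lambda> K n m \<le> 8 / (real N)\<^sup>2 * (U \<omega> - \<kappa> * d\<^sup>2 * real N)"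
      unfolding fl by (simp add: right_diff_distrib)
    also have "\<dots> \<le> 8 / (real N)\<^sup>2 * max 0 (U \<omega> - \<kappa> * d\<^sup>2 * real N)" by (intro mult_left_mono) auto
    finally show ?case by (intro ennreal_leI) simp
  qed
  then have "(\<integral>\<^sup>+\<omega>. ennreal (max 0 (8 * fluct g n (\<lambda>i. X i \<omega>) m - pen \<Lambda> K n m)) \<partial>M)
    \<le> (\<integral>\<^sup>+\<omega>. ennreal (8 / (real N)\<^sup>2 * max 0 (U \<omega> - \<kappa> * d\<^sup>2 * real N)) \<partial>M)"
    by (rule nn_integral_mono_AE)
  also have "\<dots> = ennreal (\<integral>\<omega>. 8 / (real N)\<^sup>2 * max 0 (U \<omega> - \<kappa> * d\<^sup>2 * real N) \<partial>M)"
  proof (rule nn_integral_eq_integral)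
    have bU: "bounded_meas M U" unfolding U_def by (rule bounded_deviation[OF tb.bounded_\<Phi>])
    have "max 0 (U \<omega> - \<kappa> * d\<^sup>2 * real N) = ((U \<omega> - \<kappa> * d\<^sup>2 * real N) + \<bar>U \<omega> - \<kappa> * d\<^sup>2 * real N\<bar>) * (1 / 2)" for \<omega>
      by (simp add: max_def abs_if)
    then show "integrable M (\<lambda>\<omega>. 8 / (real N)\<^sup>2 * max 0 (U \<omega> - \<kappa> * d\<^sup>2 * real N))"
      by (simp only:) (intro bounded_meas_integrable bounded_meas_intros bU)
  qed simp
  also have "\<dots> \<le> ennreal (16 * C / real n * (1 / (real (model_dim \<Lambda> m))\<^sup>2))"
  proof (rule ennreal_leI)
    have "(\<integral>\<omega>. 8 / (real N)\<^sup>2 * max 0 (U \<omega> - \<kappa> * d\<^sup>2 * real N) \<partial>M) \<le> 8 / (real N)\<^sup>2 * (C * (real N / d\<^sup>2))"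
      unfolding integral_mult_right_zero U_def \<kappa>_def d_def
      using C[of L, unfolded excess_bounded_def, rule_format, OF tb L1 _ N1] d4
      by (intro mult_left_mono) (auto simp: d_def)
    also have "\<dots> = (C / d\<^sup>2) * (16 / (2 * real N))" using N1 by (simp add: power2_eq_square mult_ac)
    also have "\<dots> \<le> (C / d\<^sup>2) * (16 / real n)"
      using nN C0 n N1 by (intro mult_left_mono divide_left_mono) auto
    also have "\<dots> = 16 * C / real n * (1 / (real (model_dim \<Lambda> m))\<^sup>2)"
      by (simp add: model_dim_def d_def L_def mult_ac)
    finally show "(\<integral>\<omega>. 8 / (real N)\<^sup>2 * max 0 (U \<omega> - \<kappa> * d\<^sup>2 * real N) \<partial>M) \<le> 16 * C / real n * (1 / (real (model_dim \<Lambda> m))\<^sup>2)" .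
  qed
  finally show ?thesis .
qed

text \<open>
  On each trajectory the excess in the oracle inequality is dominated by the sum of the
  excesses over all dimensions, each taken at one representative model. This sum is measurable
  and its mean is known, whatever the selection \<open>mhat\<close> does as a function on the probability
  space. Without loss of generality \<open>g - s\<close> is square integrable, since otherwise the right-hand
  side is infinite.
\<close>

lemma risk_bound:
  assumes C0: "0 \<le> C"
    and C: "\<And>L :: 'l set. excess_bounded \<pi> B r C L"
    and nested: "nested_models \<Lambda> \<phi>"
    and n: "2 \<le> n" and K: "16 * (8 * r ^ 4 + 2) \<le> K"
    and sel: "\<And>\<omega>. \<omega> \<in> space M \<Longrightarrow> selected_model \<Lambda> \<phi> K n (\<lambda>i. X i \<omega>) (mhat \<omega>)"
    and m: "m \<in> model_indices \<Lambda> n" and s: "s \<in> bivariate_space \<Lambda> \<phi> m"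
  shows "(\<integral>\<^sup>+\<omega>. sq_norm unit_square (\<lambda>z. g_hat \<Lambda> \<phi> n (\<lambda>i. X i \<omega>) (mhat \<omega>) z - g z) \<partial>M)
    \<le> 3 * (sq_norm unit_square (\<lambda>z. g z - s z) + ennreal (pen \<Lambda> K n m)) + ennreal (32 * C / real n)"
proof (cases "sq_norm unit_square (\<lambda>z. g z - s z) = \<infinity>")
  case True
  then show ?thesis by (simp add: ennreal_mult_top)
next
  case False
  have "0 \<le> 16 * (8 * r ^ 4 + 2)" by simp
  then have K0: "0 \<le> K" using K by linarith
  have gm: "g \<in> borel_measurable unit_square"
    using g_meas by (intro measurable_restrict_space1) simp
  note sm = bivariate_meas[OF s] and ss = bivariate_sq[OF s]
  have dm: "(\<lambda>z. g z - s z) \<in> borel_measurable unit_square" using gm sm by simp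
  have dfin: "sq_norm unit_square (\<lambda>z. g z - s z) < \<infinity>" using False by (simp add: less_top)
  have ids: "integrable unit_square (\<lambda>z. (g z - s z)\<^sup>2)"
    using square_integrable_mult[OF dm dm dfin dfin] by (simp add: power2_eq_square)
  have i_s: "integrable unit_square (\<lambda>z. (s z)\<^sup>2)"
    using square_integrable_mult[OF sm sm ss ss] by (simp add: power2_eq_square)
  have ig: "integrable unit_square (\<lambda>z. (g z)\<^sup>2)"
  proof -
    have "integrable unit_square (\<lambda>z. (g z - s z) * s z)" by (rule square_integrable_mult[OF dm sm dfin ss])
    then have "integrable unit_square (\<lambda>z. (g z - s z)\<^sup>2 + 2 * ((g z - s z) * s z) + (s z)\<^sup>2)"
      using ids i_s by simp
    also have "(\<lambda>z. (g z - s z)\<^sup>2 + 2 * ((g z - s z) * s z) + (s z)\<^sup>2) = (\<lambda>z. (g z)\<^sup>2)"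
      by (auto simp: power2_eq_square algebra_simps)
    finally show ?thesis .
  qed
  have gs: "sq_norm unit_square g < \<infinity>" unfolding L2_norm_eq(1)[OF ig] by simp
  define G where "G = (\<integral>z. (g z - s z)\<^sup>2 \<partial>unit_square)"
  have G0: "0 \<le> G" by (simp add: G_def)
  have p0: "0 \<le> pen \<Lambda> K n m" using K0 by (simp add: pen_def)
  define Ds where "Ds = {d\<in>{1..n}. \<exists>m\<in>model_indices \<Lambda> n. model_dim \<Lambda> m = d}"
  define rep where "rep d = (SOME m. m \<in> model_indices \<Lambda> n \<and> model_dim \<Lambda> m = d)" for d
  have rep: "rep d \<in> model_indices \<Lambda> n" "model_dim \<Lambda> (rep d) = d" if "d \<in> Ds" for d
  proof -
    have "\<exists>m. m \<in> model_indices \<Lambda> n \<and> model_dim \<Lambda> m = d" using that by (auto simp: Ds_def)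
    from someI_ex[OF this] show "rep d \<in> model_indices \<Lambda> n" "model_dim \<Lambda> (rep d) = d"
      unfolding rep_def by auto
  qed
  have in_Ds: "model_dim \<Lambda> m' \<in> Ds" if "m' \<in> model_indices \<Lambda> n" "model_dim \<Lambda> m' \<noteq> 0" for m'
  proof -
    let ?d = "real (model_dim \<Lambda> m')"
    have "?d * 1 \<le> ?d * ?d" using that(2) by (intro mult_left_mono) auto
    also have "\<dots> \<le> sqrt (real n)" using that(1) by (simp add: model_indices_def power2_eq_square)
    also have "\<dots> \<le> real n" using n by (intro real_le_lsqrt) (auto simp: power2_eq_square)
    finally show ?thesis using that by (auto simp: Ds_def)
  qed
  have finDs: "finite Ds" by (simp add: Ds_def)
  define h where "h d \<omega> = max 0 (8 * fluct g n (\<lambda>i. X i \<omega>) (rep d) - pen \<Lambda> K n (rep d))" for d \<omega>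
  have h0: "0 \<le> h d \<omega>" for d \<omega> by (simp add: h_def)
  have path: "sq_norm unit_square (\<lambda>z. g_hat \<Lambda> \<phi> n (\<lambda>i. X i \<omega>) (mhat \<omega>) z - g z)
      \<le> ennreal (3 * (G + pen \<Lambda> K n m)) + (\<Sum>d\<in>Ds. ennreal (h d \<omega>))" if \<omega>: "\<omega> \<in> space M" for \<omega>
  proof -
    let ?x = "\<lambda>i. X i \<omega>"
    define t where "t = g_hat \<Lambda> \<phi> n ?x (mhat \<omega>)"
    have mh: "mhat \<omega> \<in> model_indices \<Lambda> n"
      using sel[OF \<omega>] by (simp add: selected_model_def is_arg_min_def)
    have tb: "t \<in> bivariate_space \<Lambda> \<phi> (mhat \<omega>)" unfolding t_def by (rule g_hat_minimises(1)[OF n])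
    have it: "integrable unit_square (\<lambda>z. (t z - g z)\<^sup>2)"
    proof -
      note tm = bivariate_meas[OF tb] and ts = bivariate_sq[OF tb]
      have "integrable unit_square (\<lambda>z. (t z)\<^sup>2 - 2 * (t z * g z) + (g z)\<^sup>2)"
        using ig square_integrable_mult[OF tm gm ts gs] square_integrable_mult[OF tm tm ts ts]
        by (simp add: power2_eq_square)
      then show ?thesis by (simp add: power2_diff algebra_simps)
    qed
    define D where "D = max (model_dim \<Lambda> m) (model_dim \<Lambda> (mhat \<omega>))"
    have "(\<integral>z. (t z - g z)\<^sup>2 \<partial>unit_square) \<le> 3 * (G + pen \<Lambda> K n m) + (\<Sum>d\<in>Ds. h d \<omega>)"
    \<comment> \<open>A model of dimension 0 has no basis function, hence no fluctuation.\<close>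
    proof (cases "D = 0")
      case True
      then have "(\<integral>z. (t z - g z)\<^sup>2 \<partial>unit_square) \<le> 3 * (G + pen \<Lambda> K n m)
          + max 0 (8 * fluct g n ?x m - pen \<Lambda> K n m)"
        unfolding t_def G_def
        by (intro oracle_inequality n K0 nested gm gs sel \<omega> m s) (simp add: D_def)
      moreover have "\<Lambda> m = {}" using True finite_\<Lambda>[of m] by (simp add: D_def model_dim_def)
      then have "fluct g n ?x m = 0" by (simp add: fluct_def)
      moreover have "0 \<le> (\<Sum>d\<in>Ds. h d \<omega>)" by (intro sum_nonneg h0)
      ultimately show ?thesis using p0 by simp
    next
      case False
      have DD: "D \<in> Ds"
        using in_Ds[OF m] in_Ds[OF mh] False by (cases "model_dim \<Lambda> m \<le> model_dim \<Lambda> (mhat \<omega>)") (auto simp: D_def max_def)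
      have "(\<integral>z. (t z - g z)\<^sup>2 \<partial>unit_square) \<le> 3 * (G + pen \<Lambda> K n m) + h D \<omega>"
        unfolding t_def G_def h_def
        by (intro oracle_inequality n K0 nested gm gs sel \<omega> m s) (simp add: rep(2)[OF DD], simp add: D_def)
      also have "h D \<omega> \<le> (\<Sum>d\<in>Ds. h d \<omega>)" by (rule member_le_sum[OF DD h0 finDs])
      finally show ?thesis by simp
    qed
    then have "ennreal (\<integral>z. (t z - g z)\<^sup>2 \<partial>unit_square) \<le> ennreal (3 * (G + pen \<Lambda> K n m) + (\<Sum>d\<in>Ds. h d \<omega>))"
      by (rule ennreal_leI)
    also have "\<dots> = ennreal (3 * (G + pen \<Lambda> K n m)) + (\<Sum>d\<in>Ds. ennreal (h d \<omega>))"
      using G0 p0 h0 by (simp add: ennreal_plus sum_nonneg sum_ennreal)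
    finally show ?thesis unfolding t_def[symmetric] L2_norm_eq(1)[OF it] .
  qed
  have hm: "(\<lambda>\<omega>. ennreal (h d \<omega>)) \<in> borel_measurable M" for d
    unfolding h_def using bounded_excess_meas by measurable
  have "(\<integral>\<^sup>+\<omega>. sq_norm unit_square (\<lambda>z. g_hat \<Lambda> \<phi> n (\<lambda>i. X i \<omega>) (mhat \<omega>) z - g z) \<partial>M)
    \<le> (\<integral>\<^sup>+\<omega>. ennreal (3 * (G + pen \<Lambda> K n m)) + (\<Sum>d\<in>Ds. ennreal (h d \<omega>)) \<partial>M)"
    by (rule nn_integral_mono) (rule path)
  also have "\<dots> = ennreal (3 * (G + pen \<Lambda> K n m)) + (\<Sum>d\<in>Ds. \<integral>\<^sup>+\<omega>. ennreal (h d \<omega>) \<partial>M)"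
    using hm by (subst nn_integral_add) (auto simp: nn_integral_sum emeasure_space_1)
  also have "\<dots> \<le> ennreal (3 * (G + pen \<Lambda> K n m)) + (\<Sum>d\<in>Ds. ennreal (16 * C / real n * (1 / (real d)\<^sup>2)))"
  proof (intro add_left_mono sum_mono)
    fix d assume d: "d \<in> Ds"
    have "1 \<le> model_dim \<Lambda> (rep d)" using rep(2)[OF d] d by (simp add: Ds_def)
    from model_excess[OF C0 C n rep(1)[OF d] this K]
    show "(\<integral>\<^sup>+\<omega>. ennreal (h d \<omega>) \<partial>M) \<le> ennreal (16 * C / real n * (1 / (real d)\<^sup>2))"
      unfolding h_def rep(2)[OF d] by simp
  qed
  also have "(\<Sum>d\<in>Ds. ennreal (16 * C / real n * (1 / (real d)\<^sup>2))) \<le> ennreal (32 * C / real n)"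
  proof -
    have "(\<Sum>d\<in>Ds. 1 / (real d)\<^sup>2) \<le> (\<Sum>d=1..n. 1 / (real d)\<^sup>2)"
      by (intro sum_mono2) (auto simp: Ds_def)
    also have "\<dots> \<le> 2" by (rule sum_inverse_squares_le)
    finally have "16 * C / real n * (\<Sum>d\<in>Ds. 1 / (real d)\<^sup>2) \<le> 16 * C / real n * 2"
      using C0 by (intro mult_left_mono) auto
    then have "(\<Sum>d\<in>Ds. 16 * C / real n * (1 / (real d)\<^sup>2)) \<le> 32 * C / real n"
      unfolding sum_distrib_left by simp
    then show ?thesis using C0 by (subst sum_ennreal) (auto intro: ennreal_leI)
  qed
  also have "ennreal (3 * (G + pen \<Lambda> K n m)) = 3 * (sq_norm unit_square (\<lambda>z. g z - s z) + ennreal (pen \<Lambda> K n m))"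
    using G0 p0 unfolding L2_norm_eq(1)[OF ids] G_def[symmetric]
    by (simp add: ennreal_mult ennreal_plus)
  finally show ?thesis by (simp add: add_left_mono)
qed

end

theorem theorem7:
  fixes M :: "'w measure" and X :: "nat \<Rightarrow> 'w \<Rightarrow> real"
    and P :: "real \<Rightarrow> real measure" and \<pi> :: "real \<Rightarrow> real \<Rightarrow> real"
    and \<mu> :: "real measure" and q g :: "real \<times> real \<Rightarrow> real" and r\<^sub>0 :: real
  assumes chain: "markov_chain M X P" "has_transition_density P \<pi>"
    and A1: "irreducible_kernel P" "positive_recurrent_kernel P"
      "stationary_distribution P \<mu>" "has_lebesgue_density \<mu>"
    and A2: "distr M borel (X 0) = \<mu>"
    and A3': "sup_norm unit_square (\<lambda>(x, y). \<pi> x y) < \<infinity>"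
    and A4: "minorization P \<mu>"
    and A5: "geometrically_ergodic P \<mu>"
    and q: "\<And>z. 0 \<le> q z"
      "\<And>i. distributed M lborel (\<lambda>\<omega>. (X i \<omega>, X (Suc i) \<omega>)) (\<lambda>z. ennreal (q z))"
    and g: "g = (\<lambda>z. q z * indicator ({0..1} \<times> {0..1}) z)"
  shows "\<exists>K\<^sub>0::real. \<forall>(\<Lambda> :: 'm \<Rightarrow> 'l set) (\<phi> :: 'm \<Rightarrow> 'l \<Rightarrow> real \<Rightarrow> real).
    orthonormal_models \<Lambda> \<phi> \<and> sup_norm_connected \<Lambda> \<phi> r\<^sub>0 \<and> nested_models \<Lambda> \<phi> \<longrightarrow>
    (\<forall>K>K\<^sub>0. \<exists>C\<^sub>1::real. \<forall>n\<ge>2. \<forall>mhat :: 'w \<Rightarrow> 'm.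
      (\<forall>\<omega>\<in>space M. selected_model \<Lambda> \<phi> K n (\<lambda>i. X i \<omega>) (mhat \<omega>)) \<longrightarrow>
      (\<integral>\<^sup>+\<omega>. sq_norm unit_square
           (\<lambda>z. g_hat \<Lambda> \<phi> n (\<lambda>i. X i \<omega>) (mhat \<omega>) z - g z) \<partial>M)
        \<le> 3 * (INF m\<in>model_indices \<Lambda> n.
                 sq_dist unit_square g (bivariate_space \<Lambda> \<phi> m) + ennreal (pen \<Lambda> K n m))
          + ennreal (C\<^sub>1 / real n))"
proof -
  interpret prob_space M using chain(1) by (simp add: markov_chain_def)
  interpret markov_kernel P
    using chain(1) by unfold_locales (simp add: markov_chain_def)
  interpret stationary_chain M P X \<mu>
    using chain(1) A1(3) A2
    by unfold_locales (auto simp: markov_chain_def stationary_distribution_def)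
  have mix: "geometric_mixing P \<mu>"
    by (rule geometrically_ergodic_imp_mixing[OF A1(3) A4 A5])
  obtain B where B: "0 < B"
    and good: "AE x in lborel. x \<in> {0..1} \<longrightarrow> (AE y in lborel. y \<in> {0..1} \<longrightarrow> \<pi> x y \<le> B)"
    using transition_density_bounded[OF chain(2) A3'] by blast
  define r where "r = \<bar>r\<^sub>0\<bar> + 1"
  have r: "0 < r" by (simp add: r_def add_nonneg_pos)
  obtain C where C0: "0 \<le> C" and C: "\<And>L :: 'l set. excess_bounded \<pi> B r C L"
    using fluctuation_constant[OF mix B r, where 'l='l and \<pi>=\<pi>] by blast
  show ?thesis
  proof (rule exI[of _ "16 * (8 * r ^ 4 + 2)"], intro allI impI, rule exI[of _ "32 * C"], intro allI impI)
    fix \<Lambda> :: "'m \<Rightarrow> 'l set" and \<phi> :: "'m \<Rightarrow> 'l \<Rightarrow> real \<Rightarrow> real" and K :: real and n :: nat and mhat :: "'w \<Rightarrow> 'm"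
    assume models: "orthonormal_models \<Lambda> \<phi> \<and> sup_norm_connected \<Lambda> \<phi> r\<^sub>0 \<and> nested_models \<Lambda> \<phi>"
      and K: "16 * (8 * r ^ 4 + 2) < K" and n: "2 \<le> n"
      and sel: "\<forall>\<omega>\<in>space M. selected_model \<Lambda> \<phi> K n (\<lambda>i. X i \<omega>) (mhat \<omega>)"
    interpret estimation M P X \<mu> \<Lambda> \<phi> q g \<pi> B r\<^sub>0
      using models q g chain(2) B good by unfold_locales auto
    let ?risk = "\<integral>\<^sup>+\<omega>. sq_norm unit_square (\<lambda>z. g_hat \<Lambda> \<phi> n (\<lambda>i. X i \<omega>) (mhat \<omega>) z - g z) \<partial>M"
    show "?risk \<le> 3 * (INF m\<in>model_indices \<Lambda> n.
                 sq_dist unit_square g (bivariate_space \<Lambda> \<phi> m) + ennreal (pen \<Lambda> K n m))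
          + ennreal (32 * C / real n)"
    proof (rule le_INF_ennreal_affine)
      fix m assume m: "m \<in> model_indices \<Lambda> n"
      have "?risk \<le> 3 * sq_norm unit_square (\<lambda>z. g z - s z)
          + (3 * ennreal (pen \<Lambda> K n m) + ennreal (32 * C / real n))"
        if s: "s \<in> bivariate_space \<Lambda> \<phi> m" for s
        using risk_bound[OF C0 C[unfolded r_def] _ n _ _ m s, of K mhat] models K sel
        by (simp add: r_def distrib_left add.assoc)
      then have "?risk \<le> 3 * sq_dist unit_square g (bivariate_space \<Lambda> \<phi> m)
          + (3 * ennreal (pen \<Lambda> K n m) + ennreal (32 * C / real n))"
        unfolding sq_dist_def by (rule le_INF_ennreal_affine) (auto simp: ennreal_mult_eq_top_iff)
      then show "?risk \<le> 3 * (sq_dist unit_square g (bivariate_space \<Lambda> \<phi> m) + ennreal (pen \<Lambda> K n m))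
          + ennreal (32 * C / real n)"
        by (simp add: distrib_left add.assoc)
    qed simp
  qed
qed

end
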